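(* Let $X$ be a terminating $\Omega$-$1$-polygraph, and let $Y$ be a cellular extension of the free $1$-algebra $\mathscr A_\Omega(X)$. If $X$ is critically $Y$-confluent, then $X$ is $Y$-confluent.
   Context: $\mathbf k$ is a field of characteristic zero, $\Omega$ is a set, algebras are associative and unital over $\mathbf k$. An $\Omega$-algebra is an algebra $A$ with $\mathbf k$-linear maps $\mathcal T_\tau:A\to A$, $\tau\in\Omega$; morphisms are algebra morphisms commuting with the operators. For a set $Z$, the free $\Omega$-monoid $Z^\Omega$ is the union of $Z^\Omega_0=Z^*\subset Z^\Omega_1\subset\cdots$, $Z_n^\Omega=(Z\sqcup\{\lfloor u\rfloor_\tau: u\in Z^\Omega_{n-1},\tau\in\Omega\})^*$, with operators $u\mapsto\lfloor u\rfloor_\tau$; set $\lfloor u\rfloor_0=u$, where $0\notin\Omega$. $\mathscr A_\Omega(Z)$ is the $\mathbf k$-linear span of $Z^\Omega$ (free $\Omega$-algebra); $\mathrm{supp}(a)$ is the set of monomials with nonzero coefficient in $a$. $Z^\Omega[\square]$ is the set of elements of $(Z\sqcup\{\square\})^\Omega$ in which $\square$ occurs exactly once; $q|_a$ denotes substitution of $a$ for $\square$ in $q$. An $n$-algebra is a strict $n$-category internal to $\Omega$-algebras (composition $a\star_k b$ defined when $t_k(a)=s_k(b)$; lower cells identified with their identities). A cellular extension of an $n$-algebra $A$ is a set $Y$ with maps $s,t:Y\to A_n$ such that $s(y),t(y)$ are parallel (same source and target, if $n\ge1$); $A[Y]$ is the $(n+1)$-algebra obtained by freely adjoining to $A$ each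 $y\in Y$ as an $(n+1)$-cell $s(y)\to t(y)$. An $\Omega$-$1$-polygraph $X=(Z,X_1)$ is a set $Z$ with a cellular extension $X_1$ of $\mathscr A_\Omega(Z)$; $\mathscr A_\Omega(X)=\mathscr A_\Omega(Z)[X_1]$. All are assumed left-monomial: for $\alpha\in X_1$, $s(\alpha)\in Z^\Omega$ and $s(\alpha)\notin\mathrm{supp}(t(\alpha))$. A $1$-monomial is a $1$-cell $q|_\alpha$, $\alpha\in X_1$, $q\in Z^\Omega[\square]$. A rewriting step is a $1$-cell $\lambda f+1_c$ with $\lambda\ne0$, $f$ a $1$-monomial, $c$ a $0$-cell with $s(f)\notin\mathrm{supp}(c)$. A positive $1$-cell is a (possibly empty) $\star_0$-composite of rewriting steps. $X$ is terminating if there is no infinite sequence of composable rewriting steps. A branching is a pair $(f,g)$ of positive $1$-cells with $s(f)=s(g)$; it is local if $f,g$ are rewriting steps. It is $Y$-confluent if there are positive $1$-cells $h,k$ with a common target and a $2$-cell $F:f\star_0h\Rightarrow g\star_0k$ in $\mathscr A_\Omega(X)[Y]$. $X$ is $Y$-confluent if every branching is. Local branchings are of four types: aspherical $(\lambda f+c,\lambda f+c)$; additive $(\lambda f+\mu v+c,\lambda u+\mu g+c)$ for $1$-monomials $f:u\to a$, $g:v\to b$, nonzero $\lambda,\mu$, $u\ne v$, $u,v\notin\mathrm{supp}(c)$; Peiffer $(\lambda q|_{\lfloor fv\rfloor_\tau}+c,\lambda q|_{\lfloor ug\rfloor_\tau}+c)$ for $1$-monomials $f:u\to a$, $g:v\to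 b$, $q\in Z^\Omega[\square]$, $\tau\in\Omega\sqcup\{0\}$, $\lambda\ne0$, $q|_{\lfloor uv\rfloor_\tau}\notin\mathrm{supp}(c)$; overlapping $(\lambda f+c,\lambda g+c)$ for $1$-monomials $f:u\to a$, $g:u\to b$ such that $(f,g)$ is none of the previous types, $\lambda\ne0$, $u\notin\mathrm{supp}(c)$. A critical branching is an overlapping branching with $\lambda=1$, $c=0$ that cannot be written $(q|_{f'},q|_{g'})$ with $q\in Z^\Omega[\square]$, $q\ne\square$. $X$ is critically $Y$-confluent if every critical branching of $X$ is $Y$-confluent. *)

theory Defs
  imports "HOL-Library.Poly_Mapping"
begin

section \<open>Internal strict n-categories in Omega-algebras\<close>

datatype side = Src | Tgt

text \<open>
  An n-algebra is encoded by the \<open>\<Omega>\<close>-algebra of its n-cells only: a k-cell with \<open>k < n\<close>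
  is identified with its iterated identity, so the k-source and k-target become
  endomorphisms \<open>bd A Src k\<close>, \<open>bd A Tgt k\<close> of that algebra, whose common image is the
  algebra of k-cells. Boundaries and compositions of index \<open>k \<ge> n\<close> are irrelevant, and
  a 0-algebra is just an \<open>\<Omega>\<close>-algebra.
\<close>

record ('a, 'o, 'k) n_alg =
  carr :: "'a set"
  add :: "'a \<Rightarrow> 'a \<Rightarrow> 'a"
  zero :: 'a
  scl :: "'k \<Rightarrow> 'a \<Rightarrow> 'a"
  mul :: "'a \<Rightarrow> 'a \<Rightarrow> 'a"
  one :: 'a
  opr :: "'o \<Rightarrow> 'a \<Rightarrow> 'a"
  bd :: "side \<Rightarrow> nat \<Rightarrow> 'a \<Rightarrow> 'a"
  cmp :: "nat \<Rightarrow> 'a \<Rightarrow> 'a \<Rightarrow> 'a"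

locale omega_algebra =
  fixes \<Omega> :: "'o set" and A :: "('a, 'o, 'k::field) n_alg"
  assumes zero_closed: "zero A \<in> carr A"
    and one_closed: "one A \<in> carr A"
    and add_closed: "\<lbrakk>a \<in> carr A; b \<in> carr A\<rbrakk> \<Longrightarrow> add A a b \<in> carr A"
    and scl_closed: "a \<in> carr A \<Longrightarrow> scl A r a \<in> carr A"
    and mul_closed: "\<lbrakk>a \<in> carr A; b \<in> carr A\<rbrakk> \<Longrightarrow> mul A a b \<in> carr A"
    and opr_closed: "\<lbrakk>\<tau> \<in> \<Omega>; a \<in> carr A\<rbrakk> \<Longrightarrow> opr A \<tau> a \<in> carr A"
    and add_assoc: "\<lbrakk>a \<in> carr A; b \<in> carr A; c \<in> carr A\<rbrakk>
          \<Longrightarrow> add A (add A a b) c = add A a (add A b c)"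
    and add_comm: "\<lbrakk>a \<in> carr A; b \<in> carr A\<rbrakk> \<Longrightarrow> add A a b = add A b a"
    and add_zero: "a \<in> carr A \<Longrightarrow> add A a (zero A) = a"
    and add_inv: "a \<in> carr A \<Longrightarrow> add A a (scl A (- 1) a) = zero A"
    and scl_add: "\<lbrakk>a \<in> carr A; b \<in> carr A\<rbrakk> \<Longrightarrow> scl A r (add A a b) = add A (scl A r a) (scl A r b)"
    and add_scl: "a \<in> carr A \<Longrightarrow> scl A (r + r') a = add A (scl A r a) (scl A r' a)"
    and scl_scl: "a \<in> carr A \<Longrightarrow> scl A r (scl A r' a) = scl A (r * r') a"
    and scl_one: "a \<in> carr A \<Longrightarrow> scl A 1 a = a"
    and mul_assoc: "\<lbrakk>a \<in> carr A; b \<in> carr A; c \<in> carr A\<rbrakk>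
          \<Longrightarrow> mul A (mul A a b) c = mul A a (mul A b c)"
    and one_mul: "a \<in> carr A \<Longrightarrow> mul A (one A) a = a"
    and mul_one: "a \<in> carr A \<Longrightarrow> mul A a (one A) = a"
    and add_mul: "\<lbrakk>a \<in> carr A; b \<in> carr A; c \<in> carr A\<rbrakk>
          \<Longrightarrow> mul A (add A a b) c = add A (mul A a c) (mul A b c)"
    and mul_add: "\<lbrakk>a \<in> carr A; b \<in> carr A; c \<in> carr A\<rbrakk>
          \<Longrightarrow> mul A c (add A a b) = add A (mul A c a) (mul A c b)"
    and scl_mul: "\<lbrakk>a \<in> carr A; b \<in> carr A\<rbrakk> \<Longrightarrow> mul A (scl A r a) b = scl A r (mul A a b)"
    and mul_scl: "\<lbrakk>a \<in> carr A; b \<in> carr A\<rbrakk> \<Longrightarrow> mul A a (scl A r b) = scl A r (mul A a b)"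
    and opr_add: "\<lbrakk>\<tau> \<in> \<Omega>; a \<in> carr A; b \<in> carr A\<rbrakk>
          \<Longrightarrow> opr A \<tau> (add A a b) = add A (opr A \<tau> a) (opr A \<tau> b)"
    and opr_scl: "\<lbrakk>\<tau> \<in> \<Omega>; a \<in> carr A\<rbrakk> \<Longrightarrow> opr A \<tau> (scl A r a) = scl A r (opr A \<tau> a)"

text \<open>The compositions are written in diagrammatic order.\<close>

locale n_algebra = omega_algebra \<Omega> A
  for \<Omega> :: "'o set" and A :: "('a, 'o, 'k::field) n_alg" +
  fixes n :: nat
  assumes bd_closed: "\<lbrakk>k < n; a \<in> carr A\<rbrakk> \<Longrightarrow> bd A d k a \<in> carr A"
    and bd_add: "\<lbrakk>k < n; a \<in> carr A; b \<in> carr A\<rbrakk>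
          \<Longrightarrow> bd A d k (add A a b) = add A (bd A d k a) (bd A d k b)"
    and bd_scl: "\<lbrakk>k < n; a \<in> carr A\<rbrakk> \<Longrightarrow> bd A d k (scl A r a) = scl A r (bd A d k a)"
    and bd_mul: "\<lbrakk>k < n; a \<in> carr A; b \<in> carr A\<rbrakk>
          \<Longrightarrow> bd A d k (mul A a b) = mul A (bd A d k a) (bd A d k b)"
    and bd_one: "k < n \<Longrightarrow> bd A d k (one A) = one A"
    and bd_opr: "\<lbrakk>k < n; \<tau> \<in> \<Omega>; a \<in> carr A\<rbrakk> \<Longrightarrow> bd A d k (opr A \<tau> a) = opr A \<tau> (bd A d k a)"
    and bd_bd_less: "\<lbrakk>j < k; k < n; a \<in> carr A\<rbrakk> \<Longrightarrow> bd A d j (bd A e k a) = bd A d j a"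
    and bd_bd_ge: "\<lbrakk>j \<le> k; k < n; a \<in> carr A\<rbrakk> \<Longrightarrow> bd A d k (bd A e j a) = bd A e j a"
    and cmp_closed: "\<lbrakk>k < n; a \<in> carr A; b \<in> carr A; bd A Tgt k a = bd A Src k b\<rbrakk>
          \<Longrightarrow> cmp A k a b \<in> carr A"
    and src_cmp: "\<lbrakk>k < n; a \<in> carr A; b \<in> carr A; bd A Tgt k a = bd A Src k b\<rbrakk>
          \<Longrightarrow> bd A Src k (cmp A k a b) = bd A Src k a"
    and tgt_cmp: "\<lbrakk>k < n; a \<in> carr A; b \<in> carr A; bd A Tgt k a = bd A Src k b\<rbrakk>
          \<Longrightarrow> bd A Tgt k (cmp A k a b) = bd A Tgt k b"
    and bd_cmp: "\<lbrakk>k < j; j < n; a \<in> carr A; b \<in> carr A; bd A Tgt k a = bd A Src k b\<rbrakk>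
          \<Longrightarrow> bd A d j (cmp A k a b) = cmp A k (bd A d j a) (bd A d j b)"
    and cmp_unit_left: "\<lbrakk>k < n; a \<in> carr A\<rbrakk> \<Longrightarrow> cmp A k (bd A Src k a) a = a"
    and cmp_unit_right: "\<lbrakk>k < n; a \<in> carr A\<rbrakk> \<Longrightarrow> cmp A k a (bd A Tgt k a) = a"
    and cmp_assoc: "\<lbrakk>k < n; a \<in> carr A; b \<in> carr A; c \<in> carr A;
          bd A Tgt k a = bd A Src k b; bd A Tgt k b = bd A Src k c\<rbrakk>
          \<Longrightarrow> cmp A k (cmp A k a b) c = cmp A k a (cmp A k b c)"
    and interchange: "\<lbrakk>j < k; k < n; a \<in> carr A; b \<in> carr A; a' \<in> carr A; b' \<in> carr A;
          bd A Tgt k a = bd A Src k b; bd A Tgt k a' = bd A Src k b'; bd A Tgt j a = bd A Src j a'\<rbrakk>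
          \<Longrightarrow> cmp A j (cmp A k a b) (cmp A k a' b') = cmp A k (cmp A j a a') (cmp A j b b')"
    and cmp_add: "\<lbrakk>k < n; a \<in> carr A; b \<in> carr A; a' \<in> carr A; b' \<in> carr A;
          bd A Tgt k a = bd A Src k b; bd A Tgt k a' = bd A Src k b'\<rbrakk>
          \<Longrightarrow> cmp A k (add A a a') (add A b b') = add A (cmp A k a b) (cmp A k a' b')"
    and cmp_scl: "\<lbrakk>k < n; a \<in> carr A; b \<in> carr A; bd A Tgt k a = bd A Src k b\<rbrakk>
          \<Longrightarrow> cmp A k (scl A r a) (scl A r b) = scl A r (cmp A k a b)"
    and cmp_mul: "\<lbrakk>k < n; a \<in> carr A; b \<in> carr A; a' \<in> carr A; b' \<in> carr A;
          bd A Tgt k a = bd A Src k b; bd A Tgt k a' = bd A Src k b'\<rbrakk>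
          \<Longrightarrow> cmp A k (mul A a a') (mul A b b') = mul A (cmp A k a b) (cmp A k a' b')"
    and cmp_opr: "\<lbrakk>k < n; \<tau> \<in> \<Omega>; a \<in> carr A; b \<in> carr A; bd A Tgt k a = bd A Src k b\<rbrakk>
          \<Longrightarrow> cmp A k (opr A \<tau> a) (opr A \<tau> b) = opr A \<tau> (cmp A k a b)"

definition n_hom ::
    "nat \<Rightarrow> 'o set \<Rightarrow> ('a, 'o, 'k) n_alg \<Rightarrow> ('b, 'o, 'k) n_alg \<Rightarrow> ('a \<Rightarrow> 'b) \<Rightarrow> bool" where
  "n_hom n \<Omega> A B \<phi> \<longleftrightarrow>
     (\<forall>a\<in>carr A. \<phi> a \<in> carr B) \<and>
     (\<forall>a\<in>carr A. \<forall>b\<in>carr A. \<phi> (add A a b) = add B (\<phi> a) (\<phi> b)) \<and>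
     (\<forall>r. \<forall>a\<in>carr A. \<phi> (scl A r a) = scl B r (\<phi> a)) \<and>
     (\<forall>a\<in>carr A. \<forall>b\<in>carr A. \<phi> (mul A a b) = mul B (\<phi> a) (\<phi> b)) \<and>
     \<phi> (one A) = one B \<and>
     (\<forall>\<tau>\<in>\<Omega>. \<forall>a\<in>carr A. \<phi> (opr A \<tau> a) = opr B \<tau> (\<phi> a)) \<and>
     (\<forall>k<n. \<forall>d. \<forall>a\<in>carr A. \<phi> (bd A d k a) = bd B d k (\<phi> a)) \<and>
     (\<forall>k<n. \<forall>a\<in>carr A. \<forall>b\<in>carr A. bd A Tgt k a = bd A Src k b \<longrightarrow>
        \<phi> (cmp A k a b) = cmp B k (\<phi> a) (\<phi> b))"


section \<open>Cellular extensions and the free (n+1)-algebra\<close>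

record ('y, 'a) cell_ext =
  cells :: "'y set"
  csrc :: "'y \<Rightarrow> 'a"
  ctgt :: "'y \<Rightarrow> 'a"

definition parallel_cells :: "nat \<Rightarrow> ('a, 'o, 'k) n_alg \<Rightarrow> 'a \<Rightarrow> 'a \<Rightarrow> bool" where
  "parallel_cells n A a b \<longleftrightarrow> (n \<ge> 1 \<longrightarrow> (\<forall>d. bd A d (n - 1) a = bd A d (n - 1) b))"

definition cellular_extension :: "nat \<Rightarrow> ('a, 'o, 'k) n_alg \<Rightarrow> ('y, 'a) cell_ext \<Rightarrow> bool" where
  "cellular_extension n A Y \<longleftrightarrow>
     (\<forall>y\<in>cells Y. csrc Y y \<in> carr A \<and> ctgt Y y \<in> carr A \<and> parallel_cells n A (csrc Y y) (ctgt Y y))"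

text \<open>
  \<open>A[Y]\<close> is built from formal expressions in the n-cells of \<open>A\<close> and the elements of \<open>Y\<close>.
  The relation \<open>feq\<close> below is a partial equivalence: \<open>feq n \<Omega> A Y x x\<close> says that \<open>x\<close> is
  well-formed, i.e. that all compositions in \<open>x\<close> are between cells which are provably composable.
  The elements of \<open>A[Y]\<close> are the classes of well-formed expressions. By rule \<open>inc_id\<close>, an
  n-cell of \<open>A\<close> becomes an identity (n+1)-cell. The results \<open>n_algebra_free_ext\<close> and
  \<open>free_ext_universal\<close> below say that this is the free (n+1)-algebra over \<open>A\<close> and \<open>Y\<close>.
\<close>

datatype ('a, 'y, 'o, 'k) cterm =
    Inc 'a
  | Gen 'y
  | Add "('a, 'y, 'o, 'k) cterm" "('a, 'y, 'o, 'k) cterm"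
  | Scl 'k "('a, 'y, 'o, 'k) cterm"
  | Mul "('a, 'y, 'o, 'k) cterm" "('a, 'y, 'o, 'k) cterm"
  | Opr 'o "('a, 'y, 'o, 'k) cterm"
  | Bd side nat "('a, 'y, 'o, 'k) cterm"
  | Cmp nat "('a, 'y, 'o, 'k) cterm" "('a, 'y, 'o, 'k) cterm"

context
  fixes n :: nat and \<Omega> :: "'o set" and A :: "('a, 'o, 'k::field) n_alg"
    and Y :: "('y, 'a) cell_ext"
begin

inductive feq :: "('a, 'y, 'o, 'k) cterm \<Rightarrow> ('a, 'y, 'o, 'k) cterm \<Rightarrow> bool"
    (infix \<open>\<approx>\<close> 50) where
  sym: "x \<approx> y \<Longrightarrow> y \<approx> x"
| trans: "\<lbrakk>x \<approx> y; y \<approx> z\<rbrakk> \<Longrightarrow> x \<approx> z"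
| inc_wf: "a \<in> carr A \<Longrightarrow> Inc a \<approx> Inc a"
| gen_wf: "y \<in> cells Y \<Longrightarrow> Gen y \<approx> Gen y"
| add_cong: "\<lbrakk>x \<approx> x'; y \<approx> y'\<rbrakk> \<Longrightarrow> Add x y \<approx> Add x' y'"
| scl_cong: "x \<approx> x' \<Longrightarrow> Scl r x \<approx> Scl r x'"
| mul_cong: "\<lbrakk>x \<approx> x'; y \<approx> y'\<rbrakk> \<Longrightarrow> Mul x y \<approx> Mul x' y'"
| opr_cong: "\<lbrakk>\<tau> \<in> \<Omega>; x \<approx> x'\<rbrakk> \<Longrightarrow> Opr \<tau> x \<approx> Opr \<tau> x'"
| bd_cong: "\<lbrakk>k \<le> n; x \<approx> x'\<rbrakk> \<Longrightarrow> Bd d k x \<approx> Bd d k x'"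
| cmp_cong: "\<lbrakk>k \<le> n; x \<approx> x'; y \<approx> y'; Bd Tgt k x \<approx> Bd Src k y\<rbrakk> \<Longrightarrow> Cmp k x y \<approx> Cmp k x' y'"
| inc_add: "\<lbrakk>a \<in> carr A; b \<in> carr A\<rbrakk> \<Longrightarrow> Add (Inc a) (Inc b) \<approx> Inc (add A a b)"
| inc_scl: "a \<in> carr A \<Longrightarrow> Scl r (Inc a) \<approx> Inc (scl A r a)"
| inc_mul: "\<lbrakk>a \<in> carr A; b \<in> carr A\<rbrakk> \<Longrightarrow> Mul (Inc a) (Inc b) \<approx> Inc (mul A a b)"
| inc_opr: "\<lbrakk>\<tau> \<in> \<Omega>; a \<in> carr A\<rbrakk> \<Longrightarrow> Opr \<tau> (Inc a) \<approx> Inc (opr A \<tau> a)"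
| inc_bd: "\<lbrakk>k < n; a \<in> carr A\<rbrakk> \<Longrightarrow> Bd d k (Inc a) \<approx> Inc (bd A d k a)"
| inc_cmp: "\<lbrakk>k < n; a \<in> carr A; b \<in> carr A; bd A Tgt k a = bd A Src k b\<rbrakk>
    \<Longrightarrow> Cmp k (Inc a) (Inc b) \<approx> Inc (cmp A k a b)"
| inc_id: "a \<in> carr A \<Longrightarrow> Bd d n (Inc a) \<approx> Inc a"
| gen_src: "y \<in> cells Y \<Longrightarrow> Bd Src n (Gen y) \<approx> Inc (csrc Y y)"
| gen_tgt: "y \<in> cells Y \<Longrightarrow> Bd Tgt n (Gen y) \<approx> Inc (ctgt Y y)"
| add_assoc: "\<lbrakk>x \<approx> x; y \<approx> y; z \<approx> z\<rbrakk> \<Longrightarrow> Add (Add x y) z \<approx> Add x (Add y z)"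
| add_comm: "\<lbrakk>x \<approx> x; y \<approx> y\<rbrakk> \<Longrightarrow> Add x y \<approx> Add y x"
| add_zero: "x \<approx> x \<Longrightarrow> Add x (Inc (zero A)) \<approx> x"
| add_inv: "x \<approx> x \<Longrightarrow> Add x (Scl (- 1) x) \<approx> Inc (zero A)"
| scl_add: "\<lbrakk>x \<approx> x; y \<approx> y\<rbrakk> \<Longrightarrow> Scl r (Add x y) \<approx> Add (Scl r x) (Scl r y)"
| add_scl: "x \<approx> x \<Longrightarrow> Scl (r + r') x \<approx> Add (Scl r x) (Scl r' x)"
| scl_scl: "x \<approx> x \<Longrightarrow> Scl r (Scl r' x) \<approx> Scl (r * r') x"
| scl_one: "x \<approx> x \<Longrightarrow> Scl 1 x \<approx> x"
| mul_assoc: "\<lbrakk>x \<approx> x; y \<approx> y; z \<approx> z\<rbrakk> \<Longrightarrow> Mul (Mul x y) z \<approx> Mul x (Mul y z)"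
| one_mul: "x \<approx> x \<Longrightarrow> Mul (Inc (one A)) x \<approx> x"
| mul_one: "x \<approx> x \<Longrightarrow> Mul x (Inc (one A)) \<approx> x"
| add_mul: "\<lbrakk>x \<approx> x; y \<approx> y; z \<approx> z\<rbrakk> \<Longrightarrow> Mul (Add x y) z \<approx> Add (Mul x z) (Mul y z)"
| mul_add: "\<lbrakk>x \<approx> x; y \<approx> y; z \<approx> z\<rbrakk> \<Longrightarrow> Mul z (Add x y) \<approx> Add (Mul z x) (Mul z y)"
| scl_mul: "\<lbrakk>x \<approx> x; y \<approx> y\<rbrakk> \<Longrightarrow> Mul (Scl r x) y \<approx> Scl r (Mul x y)"
| mul_scl: "\<lbrakk>x \<approx> x; y \<approx> y\<rbrakk> \<Longrightarrow> Mul x (Scl r y) \<approx> Scl r (Mul x y)"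
| opr_add: "\<lbrakk>\<tau> \<in> \<Omega>; x \<approx> x; y \<approx> y\<rbrakk> \<Longrightarrow> Opr \<tau> (Add x y) \<approx> Add (Opr \<tau> x) (Opr \<tau> y)"
| opr_scl: "\<lbrakk>\<tau> \<in> \<Omega>; x \<approx> x\<rbrakk> \<Longrightarrow> Opr \<tau> (Scl r x) \<approx> Scl r (Opr \<tau> x)"
| bd_add: "\<lbrakk>k \<le> n; x \<approx> x; y \<approx> y\<rbrakk> \<Longrightarrow> Bd d k (Add x y) \<approx> Add (Bd d k x) (Bd d k y)"
| bd_scl: "\<lbrakk>k \<le> n; x \<approx> x\<rbrakk> \<Longrightarrow> Bd d k (Scl r x) \<approx> Scl r (Bd d k x)"
| bd_mul: "\<lbrakk>k \<le> n; x \<approx> x; y \<approx> y\<rbrakk> \<Longrightarrow> Bd d k (Mul x y) \<approx> Mul (Bd d k x) (Bd d k y)"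
| bd_one: "k \<le> n \<Longrightarrow> Bd d k (Inc (one A)) \<approx> Inc (one A)"
| bd_opr: "\<lbrakk>k \<le> n; \<tau> \<in> \<Omega>; x \<approx> x\<rbrakk> \<Longrightarrow> Bd d k (Opr \<tau> x) \<approx> Opr \<tau> (Bd d k x)"
| bd_bd_less: "\<lbrakk>j < k; k \<le> n; x \<approx> x\<rbrakk> \<Longrightarrow> Bd d j (Bd e k x) \<approx> Bd d j x"
| bd_bd_ge: "\<lbrakk>j \<le> k; k \<le> n; x \<approx> x\<rbrakk> \<Longrightarrow> Bd d k (Bd e j x) \<approx> Bd e j x"
| src_cmp: "\<lbrakk>k \<le> n; x \<approx> x; y \<approx> y; Bd Tgt k x \<approx> Bd Src k y\<rbrakk>
    \<Longrightarrow> Bd Src k (Cmp k x y) \<approx> Bd Src k x"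
| tgt_cmp: "\<lbrakk>k \<le> n; x \<approx> x; y \<approx> y; Bd Tgt k x \<approx> Bd Src k y\<rbrakk>
    \<Longrightarrow> Bd Tgt k (Cmp k x y) \<approx> Bd Tgt k y"
| bd_cmp: "\<lbrakk>k < j; j \<le> n; x \<approx> x; y \<approx> y; Bd Tgt k x \<approx> Bd Src k y\<rbrakk>
    \<Longrightarrow> Bd d j (Cmp k x y) \<approx> Cmp k (Bd d j x) (Bd d j y)"
| cmp_unit_left: "\<lbrakk>k \<le> n; x \<approx> x\<rbrakk> \<Longrightarrow> Cmp k (Bd Src k x) x \<approx> x"
| cmp_unit_right: "\<lbrakk>k \<le> n; x \<approx> x\<rbrakk> \<Longrightarrow> Cmp k x (Bd Tgt k x) \<approx> x"
| cmp_assoc: "\<lbrakk>k \<le> n; x \<approx> x; y \<approx> y; z \<approx> z; Bd Tgt k x \<approx> Bd Src k y; Bd Tgt k y \<approx> Bd Src k z\<rbrakk>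
    \<Longrightarrow> Cmp k (Cmp k x y) z \<approx> Cmp k x (Cmp k y z)"
| interchange: "\<lbrakk>j < k; k \<le> n; x \<approx> x; y \<approx> y; x' \<approx> x'; y' \<approx> y';
    Bd Tgt k x \<approx> Bd Src k y; Bd Tgt k x' \<approx> Bd Src k y'; Bd Tgt j x \<approx> Bd Src j x'\<rbrakk>
    \<Longrightarrow> Cmp j (Cmp k x y) (Cmp k x' y') \<approx> Cmp k (Cmp j x x') (Cmp j y y')"
| cmp_add: "\<lbrakk>k \<le> n; x \<approx> x; y \<approx> y; x' \<approx> x'; y' \<approx> y';
    Bd Tgt k x \<approx> Bd Src k y; Bd Tgt k x' \<approx> Bd Src k y'\<rbrakk>
    \<Longrightarrow> Cmp k (Add x x') (Add y y') \<approx> Add (Cmp k x y) (Cmp k x' y')"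
| cmp_scl: "\<lbrakk>k \<le> n; x \<approx> x; y \<approx> y; Bd Tgt k x \<approx> Bd Src k y\<rbrakk>
    \<Longrightarrow> Cmp k (Scl r x) (Scl r y) \<approx> Scl r (Cmp k x y)"
| cmp_mul: "\<lbrakk>k \<le> n; x \<approx> x; y \<approx> y; x' \<approx> x'; y' \<approx> y';
    Bd Tgt k x \<approx> Bd Src k y; Bd Tgt k x' \<approx> Bd Src k y'\<rbrakk>
    \<Longrightarrow> Cmp k (Mul x x') (Mul y y') \<approx> Mul (Cmp k x y) (Cmp k x' y')"
| cmp_opr: "\<lbrakk>k \<le> n; \<tau> \<in> \<Omega>; x \<approx> x; y \<approx> y; Bd Tgt k x \<approx> Bd Src k y\<rbrakk>
    \<Longrightarrow> Cmp k (Opr \<tau> x) (Opr \<tau> y) \<approx> Opr \<tau> (Cmp k x y)"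

definition cls :: "('a, 'y, 'o, 'k) cterm \<Rightarrow> ('a, 'y, 'o, 'k) cterm set" where
  "cls x = {y. x \<approx> y}"

definition lift1 where
  "lift1 f P = {z. \<exists>x\<in>P. f x \<approx> z}"

definition lift2 where
  "lift2 f P Q = {z. \<exists>x\<in>P. \<exists>y\<in>Q. f x y \<approx> z}"

definition free_ext :: "(('a, 'y, 'o, 'k) cterm set, 'o, 'k) n_alg" where
  "free_ext =
    \<lparr> carr = {cls x |x. x \<approx> x},
      add = lift2 Add,
      zero = cls (Inc (zero A)),
      scl = (\<lambda>r. lift1 (Scl r)),
      mul = lift2 Mul,
      one = cls (Inc (one A)),
      opr = (\<lambda>\<tau>. lift1 (Opr \<tau>)),
      bd = (\<lambda>d k. lift1 (Bd d k)),
      cmp = (\<lambda>k. lift2 (Cmp k)) \<rparr>"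

abbreviation inc :: "'a \<Rightarrow> ('a, 'y, 'o, 'k) cterm set" where
  "inc a \<equiv> cls (Inc a)"

abbreviation gen :: "'y \<Rightarrow> ('a, 'y, 'o, 'k) cterm set" where
  "gen y \<equiv> cls (Gen y)"

lemma feq_wf: "x \<approx> y \<Longrightarrow> x \<approx> x" "x \<approx> y \<Longrightarrow> y \<approx> y"
  by (blast intro: feq.sym feq.trans)+

lemma cls_eq_iff: "x \<approx> x \<Longrightarrow> cls x = cls y \<longleftrightarrow> x \<approx> y"
  unfolding cls_def by (blast intro: feq.sym feq.trans)

lemma lift1_cls:
  assumes "x \<approx> x" "\<And>x'. x \<approx> x' \<Longrightarrow> f x \<approx> f x'"
  shows "lift1 f (cls x) = cls (f x)"
  using assms unfolding lift1_def cls_def by (blast intro: feq.sym feq.trans)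

lemma lift2_cls:
  assumes "x \<approx> x" "y \<approx> y" "\<And>x' y'. \<lbrakk>x \<approx> x'; y \<approx> y'\<rbrakk> \<Longrightarrow> f x y \<approx> f x' y'"
  shows "lift2 f (cls x) (cls y) = cls (f x y)"
  using assms unfolding lift2_def cls_def by (blast intro: feq.sym feq.trans)

lemma cls_eqI: "x \<approx> y \<Longrightarrow> cls x = cls y"
  using cls_eq_iff feq_wf(1) by blast

lemma free_ext_simps:
  "carr free_ext = {cls x |x. x \<approx> x}"
  "zero free_ext = inc (zero A)"
  "one free_ext = inc (one A)"
  "\<lbrakk>x \<approx> x; y \<approx> y\<rbrakk> \<Longrightarrow> add free_ext (cls x) (cls y) = cls (Add x y)"
  "x \<approx> x \<Longrightarrow> scl free_ext r (cls x) = cls (Scl r x)"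
  "\<lbrakk>x \<approx> x; y \<approx> y\<rbrakk> \<Longrightarrow> mul free_ext (cls x) (cls y) = cls (Mul x y)"
  "\<lbrakk>\<tau> \<in> \<Omega>; x \<approx> x\<rbrakk> \<Longrightarrow> opr free_ext \<tau> (cls x) = cls (Opr \<tau> x)"
  "\<lbrakk>k \<le> n; x \<approx> x\<rbrakk> \<Longrightarrow> bd free_ext d k (cls x) = cls (Bd d k x)"
  "\<lbrakk>k \<le> n; x \<approx> x; y \<approx> y; Bd Tgt k x \<approx> Bd Src k y\<rbrakk>
     \<Longrightarrow> cmp free_ext k (cls x) (cls y) = cls (Cmp k x y)"
  unfolding free_ext_def
  by (simp_all add: lift1_cls lift2_cls feq.add_cong feq.mul_cong feq.scl_cong feq.opr_cong
      feq.bd_cong feq.cmp_cong)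

lemma feq_comp_add: "Bd Tgt k (Add x x') \<approx> Bd Src k (Add y y')"
  if "k \<le> n" "x \<approx> x" "y \<approx> y" "x' \<approx> x'" "y' \<approx> y'"
    "Bd Tgt k x \<approx> Bd Src k y" "Bd Tgt k x' \<approx> Bd Src k y'" for k x y x' y'
  using that by (meson feq.bd_add feq.add_cong feq.sym feq.trans)

lemma feq_comp_mul: "Bd Tgt k (Mul x x') \<approx> Bd Src k (Mul y y')"
  if "k \<le> n" "x \<approx> x" "y \<approx> y" "x' \<approx> x'" "y' \<approx> y'"
    "Bd Tgt k x \<approx> Bd Src k y" "Bd Tgt k x' \<approx> Bd Src k y'" for k x y x' y'
  using that by (meson feq.bd_mul feq.mul_cong feq.sym feq.trans)

lemma feq_comp_scl: "Bd Tgt k (Scl r x) \<approx> Bd Src k (Scl r y)"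
  if "k \<le> n" "x \<approx> x" "y \<approx> y" "Bd Tgt k x \<approx> Bd Src k y" for k x y r
  using that by (meson feq.bd_scl feq.scl_cong feq.sym feq.trans)

lemma feq_comp_opr: "Bd Tgt k (Opr \<tau> x) \<approx> Bd Src k (Opr \<tau> y)"
  if "k \<le> n" "x \<approx> x" "y \<approx> y" "Bd Tgt k x \<approx> Bd Src k y" "\<tau> \<in> \<Omega>" for k x y \<tau>
  using that by (meson feq.bd_opr feq.opr_cong feq.sym feq.trans)

lemma feq_comp_bd: "Bd Tgt k (Bd d j x) \<approx> Bd Src k (Bd d j y)"
  if "k < j" "j \<le> n" "x \<approx> x" "y \<approx> y" "Bd Tgt k x \<approx> Bd Src k y" for k j d x y
  using that by (meson feq.bd_bd_less feq.sym feq.trans)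

lemma feq_comp_unit: "Bd Tgt k (Bd Src k x) \<approx> Bd Src k x" "Bd Tgt k x \<approx> Bd Src k (Bd Tgt k x)"
  if "k \<le> n" "x \<approx> x" for k x
  using that by (auto intro: feq.bd_bd_ge feq.sym)

lemma feq_comp_cmp: "Bd Tgt k (Cmp k x y) \<approx> Bd Src k z" "Bd Tgt k x \<approx> Bd Src k (Cmp k y z)"
  if "k \<le> n" "x \<approx> x" "y \<approx> y" "z \<approx> z" "Bd Tgt k x \<approx> Bd Src k y"
    "Bd Tgt k y \<approx> Bd Src k z" for k x y z
  using that by (blast intro: feq.tgt_cmp feq.src_cmp feq.sym feq.trans)+

lemma feq_bd_lower: "Bd d j (Cmp k x y) \<approx> Bd d j x" "Bd d j y \<approx> Bd d j x"
  if "j < k" "k \<le> n" "x \<approx> x" "y \<approx> y" "Bd Tgt k x \<approx> Bd Src k y" for d j k x y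
proof -
  note [trans] = feq.trans
  have j: "j \<le> n" using that by simp
  have c: "Cmp k x y \<approx> Cmp k x y" using that by (simp add: feq.cmp_cong)
  have "Bd d j (Cmp k x y) \<approx> Bd d j (Bd Src k (Cmp k x y))"
    using feq.bd_bd_less that c feq.sym by blast
  also have "\<dots> \<approx> Bd d j (Bd Src k x)"
    using feq.bd_cong[OF j] feq.src_cmp that by blast
  also have "\<dots> \<approx> Bd d j x" using feq.bd_bd_less that by blast
  finally show "Bd d j (Cmp k x y) \<approx> Bd d j x" .
  have "Bd d j y \<approx> Bd d j (Bd Src k y)" using feq.bd_bd_less that feq.sym by blast
  also have "\<dots> \<approx> Bd d j (Bd Tgt k x)" using feq.bd_cong[OF j] that feq.sym by blast
  also have "\<dots> \<approx> Bd d j x" using feq.bd_bd_less that by blast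
  finally show "Bd d j y \<approx> Bd d j x" .
qed

lemma feq_comp_interchange: "Bd Tgt j (Cmp k x y) \<approx> Bd Src j (Cmp k x' y')"
    "Bd Tgt j y \<approx> Bd Src j y'"
    "Bd Tgt k (Cmp j x x') \<approx> Bd Src k (Cmp j y y')"
  if "j < k" "k \<le> n" "x \<approx> x" "y \<approx> y" "x' \<approx> x'" "y' \<approx> y'"
    "Bd Tgt k x \<approx> Bd Src k y" "Bd Tgt k x' \<approx> Bd Src k y'"
    "Bd Tgt j x \<approx> Bd Src j x'" for j k x y x' y'
proof -
  note [trans] = feq.trans
  have j: "j \<le> n" using that by simp
  show "Bd Tgt j (Cmp k x y) \<approx> Bd Src j (Cmp k x' y')"
    using feq_bd_lower(1)[of j k x y Tgt] feq_bd_lower(1)[of j k x' y' Src] that feq.sym feq.trans by meson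
  show yy: "Bd Tgt j y \<approx> Bd Src j y'"
    using feq_bd_lower(2)[of j k x y Tgt] feq_bd_lower(2)[of j k x' y' Src] that feq.sym feq.trans by meson
  have "Bd Tgt k (Cmp j x x') \<approx> Cmp j (Bd Tgt k x) (Bd Tgt k x')"
    using that by (blast intro: feq.bd_cmp)
  also have "\<dots> \<approx> Cmp j (Bd Src k y) (Bd Src k y')"
    using that j by (intro feq.cmp_cong feq_comp_bd)
  also have "\<dots> \<approx> Bd Src k (Cmp j y y')"
    using that yy by (blast intro: feq.bd_cmp feq.sym)
  finally show "Bd Tgt k (Cmp j x x') \<approx> Bd Src k (Cmp j y y')" .
qed

end

theorem n_algebra_free_ext:
  assumes "omega_algebra \<Omega> A"
  shows "n_algebra \<Omega> (free_ext n \<Omega> A Y) (Suc n)"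
proof -
  interpret omega_algebra \<Omega> A by fact
  let ?E = "feq n \<Omega> A Y" and ?c = "cls n \<Omega> A Y" and ?F = "free_ext n \<Omega> A Y"
  note wf = feq.inc_wf[OF zero_closed] feq.inc_wf[OF one_closed] feq.add_cong feq.scl_cong
    feq.mul_cong feq.opr_cong feq.bd_cong feq.cmp_cong
  note S = free_ext_simps(2-)[where n=n and \<Omega>=\<Omega> and A=A and Y=Y] wf cls_eq_iff[where n=n and \<Omega>=\<Omega> and A=A and Y=Y]
  have car: "?E x x \<Longrightarrow> ?c x \<in> carr ?F" for x
    by (auto simp: free_ext_simps(1))
  have carE: thesis if "a \<in> carr ?F" "\<And>x. \<lbrakk>a = ?c x; ?E x x\<rbrakk> \<Longrightarrow> thesis" for a thesis
    using that by (auto simp: free_ext_simps(1))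
  note C = feq_comp_add feq_comp_mul feq_comp_scl feq_comp_opr feq_comp_bd feq_comp_unit feq_comp_cmp feq_comp_interchange
  show ?thesis
    by (unfold_locales; (elim carE)?;
        simp add: car S C less_Suc_eq_le; (blast intro: feq.intros(20-))?)
qed

lemma (in n_algebra) bd_cmp_lower:
  assumes "j < k" "k < n" "a \<in> carr A" "b \<in> carr A" "bd A Tgt k a = bd A Src k b"
  shows "bd A d j (cmp A k a b) = bd A d j a"
proof -
  have "bd A d j (cmp A k a b) = bd A d j (bd A Src k (cmp A k a b))"
    using assms by (simp only: bd_bd_less cmp_closed)
  also have "\<dots> = bd A d j a"
    using assms by (simp only: src_cmp bd_bd_less)
  finally show ?thesis .
qed

primrec cterm_eval ::
    "('b, 'o, 'k) n_alg \<Rightarrow> ('a \<Rightarrow> 'b) \<Rightarrow> ('y \<Rightarrow> 'b) \<Rightarrow> ('a, 'y, 'o, 'k) cterm \<Rightarrow> 'b" where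
  "cterm_eval B \<phi> v (Inc a) = \<phi> a"
| "cterm_eval B \<phi> v (Gen y) = v y"
| "cterm_eval B \<phi> v (Add x y) = add B (cterm_eval B \<phi> v x) (cterm_eval B \<phi> v y)"
| "cterm_eval B \<phi> v (Scl r x) = scl B r (cterm_eval B \<phi> v x)"
| "cterm_eval B \<phi> v (Mul x y) = mul B (cterm_eval B \<phi> v x) (cterm_eval B \<phi> v y)"
| "cterm_eval B \<phi> v (Opr \<tau> x) = opr B \<tau> (cterm_eval B \<phi> v x)"
| "cterm_eval B \<phi> v (Bd d k x) = bd B d k (cterm_eval B \<phi> v x)"
| "cterm_eval B \<phi> v (Cmp k x y) = cmp B k (cterm_eval B \<phi> v x) (cterm_eval B \<phi> v y)"

lemma n_hom_zero:
  assumes "omega_algebra \<Omega> A" "omega_algebra \<Omega> B" "n_hom n \<Omega> A B \<phi>"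
  shows "\<phi> (zero A) = zero B"
proof -
  interpret A: omega_algebra \<Omega> A by fact
  interpret B: omega_algebra \<Omega> B by fact
  have "\<phi> (zero A) = \<phi> (add A (zero A) (scl A (- 1) (zero A)))"
    by (simp add: A.zero_closed A.add_inv)
  also have "\<dots> = add B (\<phi> (zero A)) (scl B (- 1) (\<phi> (zero A)))"
    using assms(3) by (simp add: n_hom_def A.zero_closed A.scl_closed)
  also have "\<dots> = zero B"
    using assms(3) by (simp add: n_hom_def A.zero_closed B.add_inv)
  finally show ?thesis .
qed

lemma cterm_eval_feq:
  assumes A: "omega_algebra \<Omega> A" and B: "n_algebra \<Omega> B (Suc n)"
    and hom: "n_hom n \<Omega> A B \<phi>" and id: "\<And>a d. a \<in> carr A \<Longrightarrow> bd B d n (\<phi> a) = \<phi> a"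
    and v: "\<And>y. y \<in> cells Y \<Longrightarrow> v y \<in> carr B \<and> bd B Src n (v y) = \<phi> (csrc Y y) \<and>
                bd B Tgt n (v y) = \<phi> (ctgt Y y)"
    and "feq n \<Omega> A Y x y"
  shows "cterm_eval B \<phi> v x \<in> carr B \<and> cterm_eval B \<phi> v y \<in> carr B \<and>
         cterm_eval B \<phi> v x = cterm_eval B \<phi> v y"
  using assms(6)
proof -
  interpret A: omega_algebra \<Omega> A by fact
  interpret n_algebra \<Omega> B "Suc n" by fact
  have z: "\<phi> (zero A) = zero B"
    using A omega_algebra_axioms hom by (rule n_hom_zero)
  have h: "\<And>a. a \<in> carr A \<Longrightarrow> \<phi> a \<in> carr B"
    "\<And>a b. \<lbrakk>a \<in> carr A; b \<in> carr A\<rbrakk> \<Longrightarrow> \<phi> (add A a b) = add B (\<phi> a) (\<phi> b)"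
    "\<And>a r. a \<in> carr A \<Longrightarrow> \<phi> (scl A r a) = scl B r (\<phi> a)"
    "\<And>a b. \<lbrakk>a \<in> carr A; b \<in> carr A\<rbrakk> \<Longrightarrow> \<phi> (mul A a b) = mul B (\<phi> a) (\<phi> b)"
    "\<phi> (one A) = one B"
    "\<And>a \<tau>. \<lbrakk>\<tau> \<in> \<Omega>; a \<in> carr A\<rbrakk> \<Longrightarrow> \<phi> (opr A \<tau> a) = opr B \<tau> (\<phi> a)"
    "\<And>a d k. \<lbrakk>k < n; a \<in> carr A\<rbrakk> \<Longrightarrow> \<phi> (bd A d k a) = bd B d k (\<phi> a)"
    "\<And>a b k. \<lbrakk>k < n; a \<in> carr A; b \<in> carr A; bd A Tgt k a = bd A Src k b\<rbrakk> \<Longrightarrow>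
        \<phi> (cmp A k a b) = cmp B k (\<phi> a) (\<phi> b)"
    using hom by (auto simp: n_hom_def)
  have hc: "bd B Tgt k (\<phi> a) = bd B Src k (\<phi> b)"
    if "k < n" "a \<in> carr A" "b \<in> carr A" "bd A Tgt k a = bd A Src k b" for k a b
    using h(7)[of k a Tgt] h(7)[of k b Src] that by simp
  have vc: "\<phi> (csrc Y y) \<in> carr B" "\<phi> (ctgt Y y) \<in> carr B" if "y \<in> cells Y" for y
    using v[OF that] bd_closed[of n "v y" Src] bd_closed[of n "v y" Tgt] by simp_all
  note closed = zero_closed one_closed add_closed scl_closed mul_closed opr_closed bd_closed
    cmp_closed
  note add_commB = add_comm and interchangeB = interchange
  from assms(6) show ?thesis
  proof induction
    case (add_comm x y)
    then show ?case by (simp add: closed add_commB)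
  next
    case (interchange j k x y x' y')
    let ?e = "cterm_eval B \<phi> v"
    have k: "j < k" "k < Suc n" "j < Suc n" using interchange(1,2) by simp_all
    have e: "?e x \<in> carr B" "?e y \<in> carr B" "?e x' \<in> carr B" "?e y' \<in> carr B"
      using interchange.IH(1-4) by simp_all
    have c: "bd B Tgt k (?e x) = bd B Src k (?e y)" "bd B Tgt k (?e x') = bd B Src k (?e y')"
      "bd B Tgt j (?e x) = bd B Src j (?e x')"
      using interchange.IH(5-7) by simp_all
    have "bd B Tgt j (cmp B k (?e x) (?e y)) = bd B Src j (cmp B k (?e x') (?e y'))"
      using bd_cmp_lower[OF k(1,2) e(1,2) c(1)] bd_cmp_lower[OF k(1,2) e(3,4) c(2)] c(3)
      by (simp only:)
    then have "cmp B j (cmp B k (?e x) (?e y)) (cmp B k (?e x') (?e y')) \<in> carr B"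
      by (intro cmp_closed k e c)
    moreover note interchangeB[OF k(1,2) e c]
    ultimately show ?case by simp
  qed (simp_all add: less_Suc_eq_le z h id v vc hc closed
      add_assoc add_zero add_inv scl_add add_scl scl_scl scl_one mul_assoc one_mul mul_one
      add_mul mul_add scl_mul mul_scl opr_add opr_scl bd_add bd_scl bd_mul bd_one bd_opr
      bd_bd_less bd_bd_ge src_cmp tgt_cmp bd_cmp cmp_unit_left cmp_unit_right cmp_assoc
      cmp_add cmp_scl cmp_mul cmp_opr)
qed

primrec subterms_wf ::
    "nat \<Rightarrow> 'o set \<Rightarrow> ('a, 'o, 'k::field) n_alg \<Rightarrow> ('y, 'a) cell_ext
      \<Rightarrow> ('a, 'y, 'o, 'k) cterm \<Rightarrow> bool" where
  "subterms_wf n \<Omega> A Y (Inc a) \<longleftrightarrow> a \<in> carr A"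
| "subterms_wf n \<Omega> A Y (Gen y) \<longleftrightarrow> y \<in> cells Y"
| "subterms_wf n \<Omega> A Y (Add x y) \<longleftrightarrow> feq n \<Omega> A Y x x \<and> feq n \<Omega> A Y y y \<and>
     subterms_wf n \<Omega> A Y x \<and> subterms_wf n \<Omega> A Y y"
| "subterms_wf n \<Omega> A Y (Scl r x) \<longleftrightarrow> feq n \<Omega> A Y x x \<and> subterms_wf n \<Omega> A Y x"
| "subterms_wf n \<Omega> A Y (Mul x y) \<longleftrightarrow> feq n \<Omega> A Y x x \<and> feq n \<Omega> A Y y y \<and>
     subterms_wf n \<Omega> A Y x \<and> subterms_wf n \<Omega> A Y y"
| "subterms_wf n \<Omega> A Y (Opr \<tau> x) \<longleftrightarrow> \<tau> \<in> \<Omega> \<and> feq n \<Omega> A Y x x \<and> subterms_wf n \<Omega> A Y x"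
| "subterms_wf n \<Omega> A Y (Bd d k x) \<longleftrightarrow> k \<le> n \<and> feq n \<Omega> A Y x x \<and> subterms_wf n \<Omega> A Y x"
| "subterms_wf n \<Omega> A Y (Cmp k x y) \<longleftrightarrow> k \<le> n \<and> feq n \<Omega> A Y x x \<and> feq n \<Omega> A Y y y \<and>
     feq n \<Omega> A Y (Bd Tgt k x) (Bd Src k y) \<and> subterms_wf n \<Omega> A Y x \<and> subterms_wf n \<Omega> A Y y"

lemma subterms_wf_feq:
  assumes "n_algebra \<Omega> A n" "cellular_extension n A Y" "feq n \<Omega> A Y x y"
  shows "feq n \<Omega> A Y x x \<and> feq n \<Omega> A Y y y \<and> subterms_wf n \<Omega> A Y x \<and> subterms_wf n \<Omega> A Y y"
  using assms(3)
proof -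
  interpret n_algebra \<Omega> A n by fact
  note closed = zero_closed one_closed add_closed scl_closed mul_closed opr_closed bd_closed
    cmp_closed
  note cong = feq.inc_wf feq.gen_wf feq.add_cong feq.scl_cong
    feq.mul_cong feq.opr_cong feq.bd_cong feq.cmp_cong
  note C = feq_comp_add feq_comp_mul feq_comp_scl feq_comp_opr feq_comp_bd feq_comp_unit
    feq_comp_cmp
  from assms(3) show ?thesis
  proof induction
    case (cmp_cong k x x' y y')
    note [trans] = feq.trans
    have "feq n \<Omega> A Y (Bd Tgt k x') (Bd Tgt k x)"
      using cmp_cong(1,2) by (intro feq.bd_cong feq.sym[of _ _ _ _ x x'])
    also have "feq n \<Omega> A Y \<dots> (Bd Src k y)" by fact
    also have "feq n \<Omega> A Y \<dots> (Bd Src k y')"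
      using cmp_cong(1,3) by (intro feq.bd_cong)
    finally show ?case using cmp_cong by (simp add: cong)
  next
    case (inc_cmp k a b)
    have "feq n \<Omega> A Y (Bd Tgt k (Inc a)) (Inc (bd A Src k b))"
      unfolding inc_cmp(4)[symmetric] using inc_cmp by (intro feq.inc_bd)
    moreover have "feq n \<Omega> A Y (Inc (bd A Src k b)) (Bd Src k (Inc b))"
      using inc_cmp by (intro feq.sym[OF feq.inc_bd])
    ultimately have "feq n \<Omega> A Y (Bd Tgt k (Inc a)) (Bd Src k (Inc b))"
      by (rule feq.trans)
    then show ?case using inc_cmp by (simp add: closed cong)
  next
    case (interchange j k x y x' y')
    then show ?case
      using feq_comp_interchange[where j=j and k=k and x=x and y=y and x'=x' and y'=y']
      by (simp add: cong)
  qed (use assms(2) in \<open>simp_all add: closed cong C cellular_extension_def\<close>)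
qed

theorem free_ext_universal:
  assumes A: "n_algebra \<Omega> A n" and Y: "cellular_extension n A Y"
    and B: "n_algebra \<Omega> B (Suc n)"
    and hom: "n_hom n \<Omega> A B \<phi>" and id: "\<And>a d. a \<in> carr A \<Longrightarrow> bd B d n (\<phi> a) = \<phi> a"
    and v: "\<And>y. y \<in> cells Y \<Longrightarrow> v y \<in> carr B \<and> bd B Src n (v y) = \<phi> (csrc Y y) \<and>
                bd B Tgt n (v y) = \<phi> (ctgt Y y)"
  shows "\<exists>\<psi>. (n_hom (Suc n) \<Omega> (free_ext n \<Omega> A Y) B \<psi> \<and>
              (\<forall>a\<in>carr A. \<psi> (inc n \<Omega> A Y a) = \<phi> a) \<and> (\<forall>y\<in>cells Y. \<psi> (gen n \<Omega> A Y y) = v y)) \<and>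
         (\<forall>\<chi>. n_hom (Suc n) \<Omega> (free_ext n \<Omega> A Y) B \<chi> \<and>
              (\<forall>a\<in>carr A. \<chi> (inc n \<Omega> A Y a) = \<phi> a) \<and> (\<forall>y\<in>cells Y. \<chi> (gen n \<Omega> A Y y) = v y)
            \<longrightarrow> (\<forall>P\<in>carr (free_ext n \<Omega> A Y). \<chi> P = \<psi> P))"
proof -
  let ?E = "feq n \<Omega> A Y" and ?c = "cls n \<Omega> A Y" and ?F = "free_ext n \<Omega> A Y"
  let ?e = "cterm_eval B \<phi> v"
  interpret A: n_algebra \<Omega> A n by fact
  interpret n_algebra \<Omega> B "Suc n" by fact
  note S = free_ext_simps(2-)[where n=n and \<Omega>=\<Omega> and A=A and Y=Y]
  have ev: "?e x \<in> carr B" "?e x = ?e y" if "?E x y" for x y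
    using cterm_eval_feq[OF A.omega_algebra_axioms B hom id v that] by auto
  define \<psi> where "\<psi> P = ?e (SOME x. x \<in> P)" for P
  have psi: "\<psi> (?c x) = ?e x" if "?E x x" for x
  proof -
    have "(SOME y. y \<in> ?c x) \<in> ?c x"
      by (rule someI[of _ x]) (simp add: cls_def that)
    then have "?E x (SOME y. y \<in> ?c x)" by (simp only: cls_def mem_Collect_eq)
    then show ?thesis unfolding \<psi>_def by (rule ev(2)[symmetric])
  qed
  have ev1: "?e x \<in> carr B" if "?E x x" for x
    using that by (rule ev(1))
  note wf = feq.inc_wf feq.gen_wf feq.add_cong feq.scl_cong feq.mul_cong feq.opr_cong feq.bd_cong
    feq.cmp_cong
  have one: "\<phi> (one A) = one B" using hom by (simp add: n_hom_def)
  have all: "(\<forall>a\<in>carr ?F. Q a) \<longleftrightarrow> (\<forall>x. ?E x x \<longrightarrow> Q (?c x))" for Q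
    by (auto simp: free_ext_simps(1))
  have hom_psi: "n_hom (Suc n) \<Omega> ?F B \<psi>"
    unfolding n_hom_def all
    by (simp add: S wf psi ev1 one less_Suc_eq_le A.one_closed
        cls_eq_iff[where n=n and \<Omega>=\<Omega> and A=A and Y=Y])
  have psi_inc: "\<psi> (?c (Inc a)) = \<phi> a" if "a \<in> carr A" for a
    using that by (simp add: psi wf)
  have psi_gen: "\<psi> (?c (Gen y)) = v y" if "y \<in> cells Y" for y
    using that by (simp add: psi wf)
  have uniq: "\<chi> P = \<psi> P"
    if chi: "n_hom (Suc n) \<Omega> ?F B \<chi>" "\<forall>a\<in>carr A. \<chi> (?c (Inc a)) = \<phi> a"
      "\<forall>y\<in>cells Y. \<chi> (?c (Gen y)) = v y" and P: "P \<in> carr ?F" for \<chi> P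
  proof -
    obtain x where x: "?E x x" "P = ?c x" using P by (auto simp: free_ext_simps(1))
    have car: "?c x \<in> carr ?F" if "?E x x" for x
      using that by (auto simp: free_ext_simps(1))
    have h: "\<And>a b. \<lbrakk>a \<in> carr ?F; b \<in> carr ?F\<rbrakk> \<Longrightarrow> \<chi> (add ?F a b) = add B (\<chi> a) (\<chi> b)"
      "\<And>a r. a \<in> carr ?F \<Longrightarrow> \<chi> (scl ?F r a) = scl B r (\<chi> a)"
      "\<And>a b. \<lbrakk>a \<in> carr ?F; b \<in> carr ?F\<rbrakk> \<Longrightarrow> \<chi> (mul ?F a b) = mul B (\<chi> a) (\<chi> b)"
      "\<And>a \<tau>. \<lbrakk>\<tau> \<in> \<Omega>; a \<in> carr ?F\<rbrakk> \<Longrightarrow> \<chi> (opr ?F \<tau> a) = opr B \<tau> (\<chi> a)"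
      "\<And>a d k. \<lbrakk>k \<le> n; a \<in> carr ?F\<rbrakk> \<Longrightarrow> \<chi> (bd ?F d k a) = bd B d k (\<chi> a)"
      "\<And>a b k. \<lbrakk>k \<le> n; a \<in> carr ?F; b \<in> carr ?F; bd ?F Tgt k a = bd ?F Src k b\<rbrakk> \<Longrightarrow>
          \<chi> (cmp ?F k a b) = cmp B k (\<chi> a) (\<chi> b)"
      using chi(1) by (auto simp: n_hom_def less_Suc_eq_le)
    have "subterms_wf n \<Omega> A Y x" using subterms_wf_feq[OF A Y x(1)] by simp
    then have "\<chi> (?c x) = ?e x"
    proof (induction x)
      case (Add x y)
      then show ?case using h(1)[of "?c x" "?c y"] by (simp add: car S)
    next
      case (Scl r x)
      then show ?case using h(2)[of "?c x" r] by (simp add: car S)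
    next
      case (Mul x y)
      then show ?case using h(3)[of "?c x" "?c y"] by (simp add: car S)
    next
      case (Opr \<tau> x)
      then show ?case using h(4)[of \<tau> "?c x"] by (simp add: car S)
    next
      case (Bd d k x)
      then show ?case using h(5)[of k "?c x" d] by (simp add: car S)
    next
      case (Cmp k x y)
      then show ?case using h(6)[of k "?c x" "?c y"]
        by (simp add: car S cls_eqI)
    qed (simp_all add: chi)
    then show ?thesis using x psi by simp
  qed
  show ?thesis
    by (intro exI[of _ \<psi>] conjI ballI allI impI hom_psi psi_inc psi_gen uniq)
      (simp_all only:)
qed

section \<open>Monomials and polynomials\<close>

datatype ('z, 'o) letter = Var 'z | Brk 'o "('z, 'o) letter list"

type_synonym ('z, 'o) word = "('z, 'o) letter list"

fun omega_words :: "'o set \<Rightarrow> 'z set \<Rightarrow> nat \<Rightarrow> ('z, 'o) word set" where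
  "omega_words \<Omega> Z 0 = lists (Var ` Z)"
| "omega_words \<Omega> Z (Suc n) = lists (Var ` Z \<union> {Brk \<tau> u |\<tau> u. \<tau> \<in> \<Omega> \<and> u \<in> omega_words \<Omega> Z n})"

definition omega_monoid :: "'o set \<Rightarrow> 'z set \<Rightarrow> ('z, 'o) word set" where
  "omega_monoid \<Omega> Z = (\<Union>n. omega_words \<Omega> Z n)"

text \<open>Words form a monoid under concatenation, so that \<open>'l list \<Rightarrow>\<^sub>0 'k\<close> is its monoid algebra.\<close>

instantiation list :: (type) monoid_add
begin

definition zero_list :: "'a list" where "zero_list = []"

definition plus_list :: "'a list \<Rightarrow> 'a list \<Rightarrow> 'a list" where "plus_list = (@)"

instance by standard (simp_all add: zero_list_def plus_list_def)

end

type_synonym ('z, 'o, 'k) poly = "('z, 'o) word \<Rightarrow>\<^sub>0 'k"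

definition poly_op :: "'o \<Rightarrow> ('z, 'o, 'k::field) poly \<Rightarrow> ('z, 'o, 'k) poly" where
  "poly_op \<tau> p =
     (\<Sum>u\<in>Poly_Mapping.keys p. Poly_Mapping.single [Brk \<tau> u] (Poly_Mapping.lookup p u))"

definition poly_alg :: "'o set \<Rightarrow> 'z set \<Rightarrow> (('z, 'o, 'k::field) poly, 'o, 'k) n_alg" where
  "poly_alg \<Omega> Z =
    \<lparr> carr = {p. Poly_Mapping.keys p \<subseteq> omega_monoid \<Omega> Z},
      add = (+),
      zero = 0,
      scl = (\<lambda>r. Poly_Mapping.map ((*) r)),
      mul = (*),
      one = 1,
      opr = poly_op,
      bd = (\<lambda>_ _ p. p),
      cmp = (\<lambda>_ p _. p) \<rparr>"

lemma omega_words_Suc_mono: "omega_words \<Omega> Z n \<subseteq> omega_words \<Omega> Z (Suc n)"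
proof (induction n)
  case (Suc n)
  then show ?case by (auto simp: subset_iff in_lists_conv_set)
qed (auto simp: in_lists_conv_set)

lemma omega_words_mono: "m \<le> n \<Longrightarrow> omega_words \<Omega> Z m \<subseteq> omega_words \<Omega> Z n"
  using lift_Suc_mono_le[of "omega_words \<Omega> Z"] omega_words_Suc_mono by blast

lemma omega_monoid_Nil: "[] \<in> omega_monoid \<Omega> Z"
  unfolding omega_monoid_def by (rule UN_I[of 0]) auto

lemma omega_monoid_append:
  assumes "u \<in> omega_monoid \<Omega> Z" "v \<in> omega_monoid \<Omega> Z"
  shows "u @ v \<in> omega_monoid \<Omega> Z"
proof -
  obtain m n where "u \<in> omega_words \<Omega> Z m" "v \<in> omega_words \<Omega> Z n"
    using assms by (auto simp: omega_monoid_def)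
  then have "u \<in> omega_words \<Omega> Z (m + n)" "v \<in> omega_words \<Omega> Z (m + n)"
    using omega_words_mono[of m "m + n" \<Omega> Z] omega_words_mono[of n "m + n" \<Omega> Z] by auto
  then have "u @ v \<in> omega_words \<Omega> Z (m + n)"
    by (cases "m + n") (auto simp: in_lists_conv_set)
  then show ?thesis by (auto simp: omega_monoid_def)
qed

lemma omega_monoid_Brk:
  assumes "\<tau> \<in> \<Omega>" "u \<in> omega_monoid \<Omega> Z"
  shows "[Brk \<tau> u] \<in> omega_monoid \<Omega> Z"
proof -
  obtain n where "u \<in> omega_words \<Omega> Z n" using assms by (auto simp: omega_monoid_def)
  then have "[Brk \<tau> u] \<in> omega_words \<Omega> Z (Suc n)" using assms by auto
  then show ?thesis unfolding omega_monoid_def by blast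
qed

lemma lookup_scale: "Poly_Mapping.lookup (Poly_Mapping.map ((*) r) p) u = r * Poly_Mapping.lookup p u"
  for p :: "'a \<Rightarrow>\<^sub>0 'k::field"
  by (simp add: map.rep_eq when_def)

lemma lookup_poly_op:
  "Poly_Mapping.lookup (poly_op \<tau> p) w =
     (case w of [Brk \<sigma> u] \<Rightarrow> if \<sigma> = \<tau> then Poly_Mapping.lookup p u else 0 | _ \<Rightarrow> 0)"
proof -
  have "Poly_Mapping.lookup (poly_op \<tau> p) w =
      (\<Sum>u\<in>Poly_Mapping.keys p. if [Brk \<tau> u] = w then Poly_Mapping.lookup p u else 0)"
    by (simp add: poly_op_def lookup_sum lookup_single when_def)
  also have "\<dots> =
      (case w of [Brk \<sigma> u] \<Rightarrow> if \<sigma> = \<tau> then Poly_Mapping.lookup p u else 0 | _ \<Rightarrow> 0)"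
    by (auto split: list.splits letter.splits simp: in_keys_iff cong: if_cong)
  finally show ?thesis .
qed

lemma omega_algebra_poly_alg:
  fixes \<Omega> :: "'o set" and Z :: "'z set"
  shows "omega_algebra \<Omega> (poly_alg \<Omega> Z :: (('z, 'o, 'k::field) poly, 'o, 'k) n_alg)"
proof -
  have scl0: "Poly_Mapping.map ((*) r) p = Poly_Mapping.single 0 r * p"
    for r :: 'k and p :: "('z, 'o, 'k) poly"
    by (rule mult_map_scale_conv_mult)
  have central: "p * Poly_Mapping.single 0 r = Poly_Mapping.single 0 r * p"
    for r :: 'k and p :: "('z, 'o, 'k) poly"
    proof -
      have p: "p = (\<Sum>u\<in>Poly_Mapping.keys p. Poly_Mapping.single u (Poly_Mapping.lookup p u))"
        by (rule poly_mapping_eqI) (simp add: lookup_sum lookup_single when_def in_keys_iff)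
      show ?thesis
        by (subst (1 2) p) (simp only: sum_distrib_left sum_distrib_right mult_single
            add_0_left add_0_right mult.commute)
    qed
  have op: "poly_op \<tau> (p + p') = poly_op \<tau> p + poly_op \<tau> p'" for \<tau> and p p' :: "('z, 'o, 'k) poly"
    by (rule poly_mapping_eqI)
      (simp add: lookup_poly_op lookup_add split: list.split letter.split)
  have op_scl: "poly_op \<tau> (Poly_Mapping.map ((*) r) p) = Poly_Mapping.map ((*) r) (poly_op \<tau> p)"
    for \<tau> r and p :: "('z, 'o, 'k) poly"
    by (rule poly_mapping_eqI)
      (simp add: lookup_poly_op lookup_scale split: list.split letter.split)
  have keys_op: "Poly_Mapping.keys (poly_op \<tau> p) \<subseteq> omega_monoid \<Omega> Z"
    if "\<tau> \<in> \<Omega>" "Poly_Mapping.keys p \<subseteq> omega_monoid \<Omega> Z" for \<tau> and p :: "('z, 'o, 'k) poly"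
    using that
    by (auto simp: in_keys_iff lookup_poly_op subset_iff split: list.splits letter.splits if_splits
        intro: omega_monoid_Brk)
  have keys_scl': "Poly_Mapping.keys (Poly_Mapping.map ((*) r) p) \<subseteq> omega_monoid \<Omega> Z"
    if "Poly_Mapping.keys p \<subseteq> omega_monoid \<Omega> Z" for r and p :: "('z, 'o, 'k) poly"
    using that by (auto simp: in_keys_iff lookup_scale subset_iff)
  have keys_mult': "Poly_Mapping.keys (p * p') \<subseteq> omega_monoid \<Omega> Z"
    if "Poly_Mapping.keys p \<subseteq> omega_monoid \<Omega> Z" "Poly_Mapping.keys p' \<subseteq> omega_monoid \<Omega> Z"
    for p p' :: "('z, 'o, 'k) poly"
    using keys_mult[of p p'] that omega_monoid_append by (fastforce simp: plus_list_def)
  have keys_add': "Poly_Mapping.keys (p + p') \<subseteq> omega_monoid \<Omega> Z"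
    if "Poly_Mapping.keys p \<subseteq> omega_monoid \<Omega> Z" "Poly_Mapping.keys p' \<subseteq> omega_monoid \<Omega> Z"
    for p p' :: "('z, 'o, 'k) poly"
    using Poly_Mapping.keys_add[of p p'] that by blast
  have pm: "p = p' \<longleftrightarrow> (\<forall>u. Poly_Mapping.lookup p u = Poly_Mapping.lookup p' u)"
    for p p' :: "('z, 'o, 'k) poly"
    by (metis poly_mapping_eqI)
  have scl_mul: "Poly_Mapping.map ((*) r) p * p' = Poly_Mapping.map ((*) r) (p * p')"
      "p * Poly_Mapping.map ((*) r) p' = Poly_Mapping.map ((*) r) (p * p')"
    for r and p p' :: "('z, 'o, 'k) poly"
    unfolding scl0 by (simp_all only: mult.assoc[symmetric] central)
  show ?thesis
  proof (unfold_locales; unfold poly_alg_def n_alg.simps mem_Collect_eq)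
    show "Poly_Mapping.keys (0 :: ('z, 'o, 'k) poly) \<subseteq> omega_monoid \<Omega> Z" by simp
    show "Poly_Mapping.keys (1 :: ('z, 'o, 'k) poly) \<subseteq> omega_monoid \<Omega> Z"
      by (simp add: zero_list_def omega_monoid_Nil)
  qed (simp_all add: keys_add' keys_mult' keys_scl' keys_op op op_scl scl_mul ring_distribs mult.assoc
      pm lookup_add lookup_scale add.assoc add.commute)
qed

lemma n_algebra_poly_alg: "n_algebra \<Omega> (poly_alg \<Omega> Z) 0"
  by (simp add: n_algebra_def n_algebra_axioms_def omega_algebra_poly_alg)

abbreviation mon :: "('z, 'o) word \<Rightarrow> ('z, 'o, 'k::field) poly" where
  "mon u \<equiv> Poly_Mapping.single u 1"

text \<open>Elements of \<open>(Z \<squnion> {\<box>})\<^sup>\<Omega>\<close> are words over \<open>'z option\<close>, with \<open>None\<close> for the hole.\<close>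

primrec holes_letter :: "('z option, 'o) letter \<Rightarrow> nat" where
  "holes_letter (Var l) = (if l = None then 1 else 0)"
| "holes_letter (Brk \<tau> q) = sum_list (map holes_letter q)"

definition contexts :: "'o set \<Rightarrow> 'z set \<Rightarrow> ('z option, 'o) word set" where
  "contexts \<Omega> Z =
     {q \<in> omega_monoid \<Omega> (insert None (Some ` Z)). sum_list (map holes_letter q) = 1}"

primrec fill_letter :: "('z, 'o) word \<Rightarrow> ('z option, 'o) letter \<Rightarrow> ('z, 'o) word" where
  "fill_letter w (Var l) = (case l of None \<Rightarrow> w | Some z \<Rightarrow> [Var z])"
| "fill_letter w (Brk \<tau> q) = [Brk \<tau> (concat (map (fill_letter w) q))]"

definition fill :: "('z option, 'o) word \<Rightarrow> ('z, 'o) word \<Rightarrow> ('z, 'o) word" where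
  "fill q w = concat (map (fill_letter w) q)"

primrec eval_letter :: "('a, 'o, 'k) n_alg \<Rightarrow> ('l \<Rightarrow> 'a) \<Rightarrow> ('l, 'o) letter \<Rightarrow> 'a" where
  "eval_letter A \<phi> (Var l) = \<phi> l"
| "eval_letter A \<phi> (Brk \<tau> w) = opr A \<tau> (List.foldr (mul A) (map (eval_letter A \<phi>) w) (one A))"

definition eval_word :: "('a, 'o, 'k) n_alg \<Rightarrow> ('l \<Rightarrow> 'a) \<Rightarrow> ('l, 'o) word \<Rightarrow> 'a" where
  "eval_word A \<phi> w = List.foldr (mul A) (map (eval_letter A \<phi>) w) (one A)"

text \<open>The element \<open>0 \<notin> \<Omega>\<close> is rendered by \<open>None\<close>.\<close>

definition brk :: "'o option \<Rightarrow> ('z, 'o) word \<Rightarrow> ('z, 'o) word" where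
  "brk \<tau> u = (case \<tau> of None \<Rightarrow> u | Some \<tau>' \<Rightarrow> [Brk \<tau>' u])"

definition opr0 :: "('a, 'o, 'k) n_alg \<Rightarrow> 'o option \<Rightarrow> 'a \<Rightarrow> 'a" where
  "opr0 A \<tau> a = (case \<tau> of None \<Rightarrow> a | Some \<tau>' \<Rightarrow> opr A \<tau>' a)"


section \<open>Polygraphs and rewriting\<close>

record (overloaded) ('z, 'o, 'x, 'k) polygraph =
  vars :: "'z set"
  rules :: "('x, ('z, 'o, 'k) poly) cell_ext"

type_synonym ('z, 'o, 'x, 'k) cell1 = "(('z, 'o, 'k) poly, 'x, 'o, 'k) cterm set"

type_synonym ('z, 'o, 'x, 'y, 'k) cell2 = "(('z, 'o, 'x, 'k) cell1, 'y, 'o, 'k) cterm set"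

definition alg0 ::
    "'o set \<Rightarrow> ('z, 'o, 'x, 'k::field) polygraph \<Rightarrow> (('z, 'o, 'k) poly, 'o, 'k) n_alg" where
  "alg0 \<Omega> X = poly_alg \<Omega> (vars X)"

definition alg1 ::
    "'o set \<Rightarrow> ('z, 'o, 'x, 'k::field) polygraph \<Rightarrow> (('z, 'o, 'x, 'k) cell1, 'o, 'k) n_alg" where
  "alg1 \<Omega> X = free_ext 0 \<Omega> (alg0 \<Omega> X) (rules X)"

definition alg2 ::
    "'o set \<Rightarrow> ('z, 'o, 'x, 'k::field) polygraph \<Rightarrow> ('y, ('z, 'o, 'x, 'k) cell1) cell_ext
      \<Rightarrow> (('z, 'o, 'x, 'y, 'k) cell2, 'o, 'k) n_alg" where
  "alg2 \<Omega> X Y = free_ext 1 \<Omega> (alg1 \<Omega> X) Y"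

text \<open>
  \<open>id1 \<Omega> X c\<close> is the 0-cell \<open>c\<close> viewed as a 1-cell, \<open>id2 \<Omega> X Y f\<close> the 1-cell \<open>f\<close> viewed
  as a 2-cell.
\<close>

definition id1 ::
    "'o set \<Rightarrow> ('z, 'o, 'x, 'k::field) polygraph \<Rightarrow> ('z, 'o, 'k) poly \<Rightarrow> ('z, 'o, 'x, 'k) cell1" where
  "id1 \<Omega> X c = inc 0 \<Omega> (alg0 \<Omega> X) (rules X) c"

definition rule_cell ::
    "'o set \<Rightarrow> ('z, 'o, 'x, 'k::field) polygraph \<Rightarrow> 'x \<Rightarrow> ('z, 'o, 'x, 'k) cell1" where
  "rule_cell \<Omega> X \<alpha> = gen 0 \<Omega> (alg0 \<Omega> X) (rules X) \<alpha>"

definition id2 ::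
    "'o set \<Rightarrow> ('z, 'o, 'x, 'k::field) polygraph \<Rightarrow> ('y, ('z, 'o, 'x, 'k) cell1) cell_ext
      \<Rightarrow> ('z, 'o, 'x, 'k) cell1 \<Rightarrow> ('z, 'o, 'x, 'y, 'k) cell2" where
  "id2 \<Omega> X Y f = inc 1 \<Omega> (alg1 \<Omega> X) Y f"

lemma n_algebra_alg1: "n_algebra \<Omega> (alg1 \<Omega> X) 1"
  using n_algebra_free_ext[OF omega_algebra_poly_alg]
  by (simp add: alg0_def alg1_def)

lemma n_algebra_alg2: "n_algebra \<Omega> (alg2 \<Omega> X Y) 2"
  using n_algebra_free_ext[OF n_algebra.axioms(1)[OF n_algebra_alg1], where n=1]
  by (simp add: alg2_def numeral_2_eq_2)

definition left_monomial :: "'o set \<Rightarrow> ('z, 'o, 'x, 'k::field) polygraph \<Rightarrow> bool" where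
  "left_monomial \<Omega> X \<longleftrightarrow>
     (\<forall>\<alpha>\<in>cells (rules X). \<exists>u\<in>omega_monoid \<Omega> (vars X).
        csrc (rules X) \<alpha> = mon u \<and> u \<notin> Poly_Mapping.keys (ctgt (rules X) \<alpha>))"

definition omega_1_polygraph :: "'o set \<Rightarrow> ('z, 'o, 'x, 'k::field) polygraph \<Rightarrow> bool" where
  "omega_1_polygraph \<Omega> X \<longleftrightarrow> cellular_extension 0 (alg0 \<Omega> X) (rules X) \<and> left_monomial \<Omega> X"

definition plug ::
    "'o set \<Rightarrow> ('z, 'o, 'x, 'k::field) polygraph \<Rightarrow> ('z option, 'o) word \<Rightarrow> ('z, 'o, 'x, 'k) cell1
      \<Rightarrow> ('z, 'o, 'x, 'k) cell1" where
  "plug \<Omega> X q f =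
     eval_word (alg1 \<Omega> X) (\<lambda>l. case l of None \<Rightarrow> f | Some z \<Rightarrow> id1 \<Omega> X (mon [Var z])) q"

definition monomials1 :: "'o set \<Rightarrow> ('z, 'o, 'x, 'k::field) polygraph \<Rightarrow> ('z, 'o, 'x, 'k) cell1 set"
  where
  "monomials1 \<Omega> X =
     {plug \<Omega> X q (rule_cell \<Omega> X \<alpha>) |q \<alpha>. q \<in> contexts \<Omega> (vars X) \<and> \<alpha> \<in> cells (rules X)}"

definition has_source ::
    "'o set \<Rightarrow> ('z, 'o, 'x, 'k::field) polygraph \<Rightarrow> ('z, 'o, 'x, 'k) cell1 \<Rightarrow> ('z, 'o) word \<Rightarrow> bool"
  where
  "has_source \<Omega> X f u \<longleftrightarrow>
     u \<in> omega_monoid \<Omega> (vars X) \<and> bd (alg1 \<Omega> X) Src 0 f = id1 \<Omega> X (mon u)"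

definition lin ::
    "'o set \<Rightarrow> ('z, 'o, 'x, 'k::field) polygraph \<Rightarrow> 'k \<Rightarrow> ('z, 'o, 'x, 'k) cell1
      \<Rightarrow> ('z, 'o, 'k) poly \<Rightarrow> ('z, 'o, 'x, 'k) cell1" where
  "lin \<Omega> X r f c = add (alg1 \<Omega> X) (scl (alg1 \<Omega> X) r f) (id1 \<Omega> X c)"

definition rewriting_step ::
    "'o set \<Rightarrow> ('z, 'o, 'x, 'k::field) polygraph \<Rightarrow> ('z, 'o, 'x, 'k) cell1 \<Rightarrow> bool" where
  "rewriting_step \<Omega> X F \<longleftrightarrow>
     (\<exists>r f u c. r \<noteq> 0 \<and> f \<in> monomials1 \<Omega> X \<and> has_source \<Omega> X f u \<and> c \<in> carr (alg0 \<Omega> X) \<and>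
        u \<notin> Poly_Mapping.keys c \<and> F = lin \<Omega> X r f c)"

inductive positive_cell ::
    "'o set \<Rightarrow> ('z, 'o, 'x, 'k::field) polygraph \<Rightarrow> ('z, 'o, 'x, 'k) cell1 \<Rightarrow> bool"
  for \<Omega> X where
  empty: "c \<in> carr (alg0 \<Omega> X) \<Longrightarrow> positive_cell \<Omega> X (id1 \<Omega> X c)"
| snoc: "\<lbrakk>positive_cell \<Omega> X f; rewriting_step \<Omega> X g; bd (alg1 \<Omega> X) Tgt 0 f = bd (alg1 \<Omega> X) Src 0 g\<rbrakk>
    \<Longrightarrow> positive_cell \<Omega> X (cmp (alg1 \<Omega> X) 0 f g)"

definition terminating :: "'o set \<Rightarrow> ('z, 'o, 'x, 'k::field) polygraph \<Rightarrow> bool" where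
  "terminating \<Omega> X \<longleftrightarrow>
     \<not> (\<exists>f :: nat \<Rightarrow> ('z, 'o, 'x, 'k) cell1. \<forall>i. rewriting_step \<Omega> X (f i) \<and>
          bd (alg1 \<Omega> X) Tgt 0 (f i) = bd (alg1 \<Omega> X) Src 0 (f (Suc i)))"


section \<open>Branchings and confluence\<close>

definition branching ::
    "'o set \<Rightarrow> ('z, 'o, 'x, 'k::field) polygraph \<Rightarrow> ('z, 'o, 'x, 'k) cell1
      \<Rightarrow> ('z, 'o, 'x, 'k) cell1 \<Rightarrow> bool" where
  "branching \<Omega> X f g \<longleftrightarrow>
     positive_cell \<Omega> X f \<and> positive_cell \<Omega> X g \<and> bd (alg1 \<Omega> X) Src 0 f = bd (alg1 \<Omega> X) Src 0 g"

definition confluent_branching ::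
    "'o set \<Rightarrow> ('z, 'o, 'x, 'k::field) polygraph \<Rightarrow> ('y, ('z, 'o, 'x, 'k) cell1) cell_ext
      \<Rightarrow> ('z, 'o, 'x, 'k) cell1 \<Rightarrow> ('z, 'o, 'x, 'k) cell1 \<Rightarrow> bool" where
  "confluent_branching \<Omega> X Y f g \<longleftrightarrow>
     (\<exists>h k F. positive_cell \<Omega> X h \<and> positive_cell \<Omega> X k \<and>
        bd (alg1 \<Omega> X) Tgt 0 f = bd (alg1 \<Omega> X) Src 0 h \<and>
        bd (alg1 \<Omega> X) Tgt 0 g = bd (alg1 \<Omega> X) Src 0 k \<and>
        bd (alg1 \<Omega> X) Tgt 0 h = bd (alg1 \<Omega> X) Tgt 0 k \<and>
        F \<in> carr (alg2 \<Omega> X Y) \<and>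
        bd (alg2 \<Omega> X Y) Src 1 F = id2 \<Omega> X Y (cmp (alg1 \<Omega> X) 0 f h) \<and>
        bd (alg2 \<Omega> X Y) Tgt 1 F = id2 \<Omega> X Y (cmp (alg1 \<Omega> X) 0 g k))"

definition confluent ::
    "'o set \<Rightarrow> ('z, 'o, 'x, 'k::field) polygraph \<Rightarrow> ('y, ('z, 'o, 'x, 'k) cell1) cell_ext \<Rightarrow> bool"
  where
  "confluent \<Omega> X Y \<longleftrightarrow> (\<forall>f g. branching \<Omega> X f g \<longrightarrow> confluent_branching \<Omega> X Y f g)"

definition aspherical_branching ::
    "'o set \<Rightarrow> ('z, 'o, 'x, 'k::field) polygraph \<Rightarrow> ('z, 'o, 'x, 'k) cell1
      \<Rightarrow> ('z, 'o, 'x, 'k) cell1 \<Rightarrow> bool" where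
  "aspherical_branching \<Omega> X F G \<longleftrightarrow> rewriting_step \<Omega> X F \<and> G = F"

definition additive_branching ::
    "'o set \<Rightarrow> ('z, 'o, 'x, 'k::field) polygraph \<Rightarrow> ('z, 'o, 'x, 'k) cell1
      \<Rightarrow> ('z, 'o, 'x, 'k) cell1 \<Rightarrow> bool" where
  "additive_branching \<Omega> X F G \<longleftrightarrow>
     (\<exists>r r' f g u v c. f \<in> monomials1 \<Omega> X \<and> has_source \<Omega> X f u \<and>
        g \<in> monomials1 \<Omega> X \<and> has_source \<Omega> X g v \<and> r \<noteq> 0 \<and> r' \<noteq> 0 \<and> u \<noteq> v \<and>
        c \<in> carr (alg0 \<Omega> X) \<and> u \<notin> Poly_Mapping.keys c \<and> v \<notin> Poly_Mapping.keys c \<and>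
        F = lin \<Omega> X r f (Poly_Mapping.single v r' + c) \<and>
        G = lin \<Omega> X r' g (Poly_Mapping.single u r + c))"

definition peiffer_branching ::
    "'o set \<Rightarrow> ('z, 'o, 'x, 'k::field) polygraph \<Rightarrow> ('z, 'o, 'x, 'k) cell1
      \<Rightarrow> ('z, 'o, 'x, 'k) cell1 \<Rightarrow> bool" where
  "peiffer_branching \<Omega> X F G \<longleftrightarrow>
     (\<exists>r f g u v q \<tau> c. f \<in> monomials1 \<Omega> X \<and> has_source \<Omega> X f u \<and>
        g \<in> monomials1 \<Omega> X \<and> has_source \<Omega> X g v \<and> q \<in> contexts \<Omega> (vars X) \<and>
        set_option \<tau> \<subseteq> \<Omega> \<and> r \<noteq> 0 \<and> c \<in> carr (alg0 \<Omega> X) \<and> fill q (brk \<tau> (u @ v)) \<notin> Poly_Mapping.keys c \<and>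
        F = lin \<Omega> X r
              (plug \<Omega> X q (opr0 (alg1 \<Omega> X) \<tau> (mul (alg1 \<Omega> X) f (id1 \<Omega> X (mon v))))) c \<and>
        G = lin \<Omega> X r
              (plug \<Omega> X q (opr0 (alg1 \<Omega> X) \<tau> (mul (alg1 \<Omega> X) (id1 \<Omega> X (mon u)) g))) c)"

text \<open>
  Branchings are considered up to exchange of their two components: the aspherical and additive
  types are stable under this exchange, but the Peiffer type is not, whence the two
  Peiffer conditions below.
\<close>

definition overlapping_branching ::
    "'o set \<Rightarrow> ('z, 'o, 'x, 'k::field) polygraph \<Rightarrow> 'k \<Rightarrow> ('z, 'o, 'k) poly
      \<Rightarrow> ('z, 'o, 'x, 'k) cell1 \<Rightarrow> ('z, 'o, 'x, 'k) cell1 \<Rightarrow> bool" where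
  "overlapping_branching \<Omega> X r c F G \<longleftrightarrow>
     (\<exists>f g u. f \<in> monomials1 \<Omega> X \<and> has_source \<Omega> X f u \<and>
        g \<in> monomials1 \<Omega> X \<and> has_source \<Omega> X g u \<and>
        \<not> aspherical_branching \<Omega> X f g \<and> \<not> additive_branching \<Omega> X f g \<and>
        \<not> peiffer_branching \<Omega> X f g \<and> \<not> peiffer_branching \<Omega> X g f \<and>
        r \<noteq> 0 \<and> c \<in> carr (alg0 \<Omega> X) \<and> u \<notin> Poly_Mapping.keys c \<and>
        F = lin \<Omega> X r f c \<and> G = lin \<Omega> X r g c)"

definition critical_branching ::
    "'o set \<Rightarrow> ('z, 'o, 'x, 'k::field) polygraph \<Rightarrow> ('z, 'o, 'x, 'k) cell1
      \<Rightarrow> ('z, 'o, 'x, 'k) cell1 \<Rightarrow> bool" where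
  "critical_branching \<Omega> X f g \<longleftrightarrow>
     overlapping_branching \<Omega> X 1 0 f g \<and>
     \<not> (\<exists>q f' g'. q \<in> contexts \<Omega> (vars X) \<and> q \<noteq> [Var None] \<and>
          f' \<in> monomials1 \<Omega> X \<and> g' \<in> monomials1 \<Omega> X \<and>
          f = plug \<Omega> X q f' \<and> g = plug \<Omega> X q g')"

definition critically_confluent ::
    "'o set \<Rightarrow> ('z, 'o, 'x, 'k::field) polygraph \<Rightarrow> ('y, ('z, 'o, 'x, 'k) cell1) cell_ext \<Rightarrow> bool"
  where
  "critically_confluent \<Omega> X Y \<longleftrightarrow>
     (\<forall>f g. critical_branching \<Omega> X f g \<longrightarrow> confluent_branching \<Omega> X Y f g)"

end

theory Submission
  imports Defs "HOL-Library.Multiset"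
begin

text \<open>
  Confluence is proved by the usual well-founded induction of Newman's lemma, with a 2-cell pasted
  at each step. The difficulty is that positive 1-cells are not closed under linear operations: if
  \<open>h\<close> is positive then \<open>r h + c\<close> need not be, because a monomial rewritten by \<open>h\<close> may also occur
  in \<open>c\<close>. So a critical branching closed by positive cells does not at once
  close its images under \<open>f \<mapsto> r f + c\<close>. Three ideas deal with this.

  Since composition is compatible with the linear structure, every 1-cell is invertible, and
  applying two cells to two summands commutes up to equality (\<open>affine_comp\<close>). In particular
  \<open>r f + c\<close>, for \<open>f\<close> a monomial 1-cell and arbitrary \<open>c\<close>, always fits into a commuting triangle with
  two positive cells of length at most one (\<open>joinable_affine\<close>). Such triangles can be pasted
  whenever confluence is known at the polynomial in the middle (\<open>joinable_comp\<close>).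

  Termination makes the following relation on monomials well-founded: \<open>v\<close> is below \<open>u\<close> if \<open>v\<close>
  occurs in the target of a monomial 1-cell with source \<open>u\<close> (\<open>wf_below\<close>). Hence polynomials are
  well-founded under the multiset extension of this order to their supports, and
  this is the order of the induction. It controls polynomials which are
  not reached by rewriting, such as those visited by a zigzag.

  Branchings of monomial 1-cells \<open>f: W \<rightarrow> a\<close>, \<open>g: W \<rightarrow> b\<close> are closed not by positive cells but by
  a zigzag \<open>e: a \<rightarrow> b\<close> made of cells whose sources lie below \<open>W\<close>, with a 2-cell
  from \<open>f \<star> e\<close> to \<open>g\<close>. This property survives contexts, scaling and addition of a polynomial.
  A critical branching has it because positive cells out of \<open>a\<close> and \<open>b\<close> are such zigzags; a Peiffer
  branching has it by the exchange law (\<open>resolved_product\<close>); every other one with \<open>f \<noteq> g\<close> is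
  the image of a smaller one under a proper context (\<open>monomials_resolved\<close>).
  When confluence is known below, the zigzag \<open>r e + c\<close> is again replaced by positive cells (\<open>zigzag_joinable\<close>), which gives local confluence; additive
  branchings are treated directly with the commutation identity (\<open>local_confluence\<close>).
\<close>

section \<open>Words and contexts\<close>

lemma Cons_omega_words:
  "x # w \<in> omega_words \<Omega> Z n \<longleftrightarrow> [x] \<in> omega_words \<Omega> Z n \<and> w \<in> omega_words \<Omega> Z n"
  by (cases n) auto

lemma Cons_omega_monoid:
  "x # w \<in> omega_monoid \<Omega> Z \<longleftrightarrow> [x] \<in> omega_monoid \<Omega> Z \<and> w \<in> omega_monoid \<Omega> Z"
  using Cons_omega_words[of x w] omega_monoid_append[of "[x]" \<Omega> Z w]
  by (auto simp: omega_monoid_def)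

lemma append_omega_monoid:
  "u @ v \<in> omega_monoid \<Omega> Z \<longleftrightarrow> u \<in> omega_monoid \<Omega> Z \<and> v \<in> omega_monoid \<Omega> Z"
proof (induction u)
  case (Cons x u)
  then show ?case by (simp add: Cons_omega_monoid[of x "u @ v"] Cons_omega_monoid[of x u])
qed (simp add: omega_monoid_Nil)

lemma Var_omega_words: "[Var z] \<in> omega_words \<Omega> Z n \<longleftrightarrow> z \<in> Z"
  by (cases n) auto

lemma Var_omega_monoid: "[Var z] \<in> omega_monoid \<Omega> Z \<longleftrightarrow> z \<in> Z"
  by (simp add: omega_monoid_def Var_omega_words)

lemma Brk_omega_monoid:
  "[Brk \<tau> u] \<in> omega_monoid \<Omega> Z \<longleftrightarrow> \<tau> \<in> \<Omega> \<and> u \<in> omega_monoid \<Omega> Z"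
proof
  assume "[Brk \<tau> u] \<in> omega_monoid \<Omega> Z"
  then obtain n where n: "[Brk \<tau> u] \<in> omega_words \<Omega> Z n" by (auto simp: omega_monoid_def)
  then have "\<tau> \<in> \<Omega> \<and> u \<in> omega_words \<Omega> Z (n - 1)" by (cases n) auto
  then show "\<tau> \<in> \<Omega> \<and> u \<in> omega_monoid \<Omega> Z" unfolding omega_monoid_def by blast
qed (simp add: omega_monoid_Brk)

abbreviation weight :: "('z, 'o) word \<Rightarrow> nat" where
  "weight \<equiv> size_list size"

lemma weight_append: "weight (u @ v) = weight u + weight v"
  by (induction u) auto

lemma omega_monoid_induct [consumes 1, case_names Nil Var Brk]:
  assumes "w \<in> omega_monoid \<Omega> Z"
    and "P []"
    and "\<And>z w. \<lbrakk>z \<in> Z; w \<in> omega_monoid \<Omega> Z; P w\<rbrakk> \<Longrightarrow> P (Var z # w)"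
    and "\<And>\<tau> u w. \<lbrakk>\<tau> \<in> \<Omega>; u \<in> omega_monoid \<Omega> Z; w \<in> omega_monoid \<Omega> Z; P u; P w\<rbrakk>
          \<Longrightarrow> P (Brk \<tau> u # w)"
  shows "P w"
  using assms(1)
proof (induction "weight w" arbitrary: w rule: less_induct)
  case less
  show ?case
  proof (cases w)
    case (Cons x v)
    then have x: "[x] \<in> omega_monoid \<Omega> Z" and v: "v \<in> omega_monoid \<Omega> Z"
      using less.prems by (simp_all add: Cons_omega_monoid[of x v])
    have Pv: "P v" using less.hyps[of v] v Cons by simp
    show ?thesis
    proof (cases x)
      case (Var z)
      then show ?thesis using assms(3)[of z v] x v Pv Cons by (simp add: Var_omega_monoid)
    next
      case (Brk \<tau> u)
      then show ?thesis
        using assms(4)[of \<tau> u v] x v Pv Cons less.hyps[of u] by (simp add: Brk_omega_monoid)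
    qed
  qed (simp add: assms(2))
qed

definition emb :: "('z, 'o) word \<Rightarrow> ('z option, 'o) word" where
  "emb = map (map_letter Some id)"

lemma emb_simps [simp]:
  "emb [] = []" "emb (Var z # w) = Var (Some z) # emb w"
  "emb (Brk \<tau> u # w) = Brk \<tau> (emb u) # emb w" "emb (u @ v) = emb u @ emb v"
  by (simp_all add: emb_def)

lemma holes_emb:
  "w \<in> omega_monoid \<Omega> Z \<Longrightarrow>
     emb w \<in> omega_monoid \<Omega> (insert None (Some ` Z)) \<and> sum_list (map holes_letter (emb w)) = 0"
  by (induction rule: omega_monoid_induct)
    (auto simp: omega_monoid_Nil Cons_omega_monoid[of _ "emb _"] Var_omega_monoid Brk_omega_monoid)

lemma no_holes_emb:
  assumes "q \<in> omega_monoid \<Omega> (insert None (Some ` Z))" "sum_list (map holes_letter q) = 0"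
  shows "\<exists>w\<in>omega_monoid \<Omega> Z. q = emb w"
  using assms
proof (induction rule: omega_monoid_induct)
  case (Var l q)
  then obtain w z where "w \<in> omega_monoid \<Omega> Z" "q = emb w" "l = Some z" "z \<in> Z" by auto
  then show ?case
    by (intro bexI[of _ "Var z # w"]) (auto simp: Cons_omega_monoid[of _ w] Var_omega_monoid)
next
  case (Brk \<tau> p q)
  then obtain w u where "w \<in> omega_monoid \<Omega> Z" "q = emb w" "u \<in> omega_monoid \<Omega> Z" "p = emb u"
    by auto
  then show ?case using Brk(1)
    by (intro bexI[of _ "Brk \<tau> u # w"]) (auto simp: Cons_omega_monoid[of _ w] Brk_omega_monoid)
qed (auto intro: bexI[of _ "[]"] simp: omega_monoid_Nil)

lemma contexts_hole: "[Var None] \<in> contexts \<Omega> Z"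
  by (simp add: contexts_def Var_omega_monoid)

lemma contexts_Brk: "\<lbrakk>\<tau> \<in> \<Omega>; q \<in> contexts \<Omega> Z\<rbrakk> \<Longrightarrow> [Brk \<tau> q] \<in> contexts \<Omega> Z"
  by (simp add: contexts_def Brk_omega_monoid)

lemma contexts_left: "\<lbrakk>l \<in> omega_monoid \<Omega> Z; q \<in> contexts \<Omega> Z\<rbrakk> \<Longrightarrow> emb l @ q \<in> contexts \<Omega> Z"
  using holes_emb[of l \<Omega> Z] by (simp add: contexts_def append_omega_monoid)

lemma contexts_right: "\<lbrakk>q \<in> contexts \<Omega> Z; r \<in> omega_monoid \<Omega> Z\<rbrakk> \<Longrightarrow> q @ emb r \<in> contexts \<Omega> Z"
  using holes_emb[of r \<Omega> Z] by (simp add: contexts_def append_omega_monoid)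

text \<open>
  A one-hole context is built from the bare hole by bracketing and by one-sided multiplication
  with hole-free words. Every fact below on the action of contexts is proved along this
  decomposition, so that only the operators and the multiplication by a word matter.
\<close>

lemma contexts_induct [consumes 1, case_names hole Brk left right]:
  assumes q: "q \<in> contexts \<Omega> Z"
    and hole: "P [Var None]"
    and Brk: "\<And>\<tau> q. \<lbrakk>\<tau> \<in> \<Omega>; q \<in> contexts \<Omega> Z; P q\<rbrakk> \<Longrightarrow> P [Brk \<tau> q]"
    and left: "\<And>l q. \<lbrakk>l \<in> omega_monoid \<Omega> Z; q \<in> contexts \<Omega> Z; P q\<rbrakk> \<Longrightarrow> P (emb l @ q)"
    and right: "\<And>q r. \<lbrakk>q \<in> contexts \<Omega> Z; r \<in> omega_monoid \<Omega> Z; P q\<rbrakk> \<Longrightarrow> P (q @ emb r)"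
  shows "P q"
proof -
  have "q \<in> omega_monoid \<Omega> (insert None (Some ` Z))" "sum_list (map holes_letter q) = 1"
    using q by (simp_all add: contexts_def)
  then show ?thesis
  proof (induction rule: omega_monoid_induct)
    case (Var l q)
    show ?case
    proof (cases l)
      case None
      then obtain r where "r \<in> omega_monoid \<Omega> Z" "q = emb r"
        using Var no_holes_emb[of q \<Omega> Z] by auto
      then show ?thesis using None right[OF contexts_hole _ hole, of r] by simp
    next
      case (Some z)
      then have "P q" "q \<in> contexts \<Omega> Z" "[Var z] \<in> omega_monoid \<Omega> Z"
        using Var by (auto simp: contexts_def Var_omega_monoid)
      then show ?thesis using Some left[of "[Var z]" q] by simp
    qed
  next
    case (Brk \<tau> p q)
    show ?case
    proof (cases "sum_list (map holes_letter p) = 0")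
      case True
      then obtain u where "u \<in> omega_monoid \<Omega> Z" "p = emb u"
        using Brk no_holes_emb[of p \<Omega> Z] by auto
      moreover have "sum_list (map holes_letter q) = 1"
        using True Brk(6) by (simp only: list.map holes_letter.simps sum_list.Cons)
      ultimately show ?thesis
        using Brk(1,3,5) left[of "[Brk \<tau> u]" q] by (simp add: contexts_def Brk_omega_monoid)
    next
      case False
      moreover have "sum_list (map holes_letter p) + sum_list (map holes_letter q) = 1"
        using Brk(6) by (simp only: list.map holes_letter.simps sum_list.Cons)
      ultimately have one: "sum_list (map holes_letter p) = 1" "sum_list (map holes_letter q) = 0"
        by linarith+
      obtain r where "r \<in> omega_monoid \<Omega> Z" "q = emb r"
        using one(2) Brk no_holes_emb[of q \<Omega> Z] by auto
      moreover have p: "p \<in> contexts \<Omega> Z" using Brk(2) one by (simp add: contexts_def)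
      moreover have "P [Brk \<tau> p]" using Brk(1,4) p one assms(3) by simp
      ultimately show ?thesis
        using Brk(1) right[of "[Brk \<tau> p]" r] contexts_Brk[of \<tau> \<Omega> p Z] by simp
    qed
  qed simp
qed

lemma fill_append: "fill (p @ q) w = fill p w @ fill q w"
  by (simp add: fill_def)

lemma fill_Brk: "fill [Brk \<tau> q] w = [Brk \<tau> (fill q w)]"
  by (simp add: fill_def)

lemma fill_hole: "fill [Var None] w = w"
  by (simp add: fill_def)

lemma fill_emb: "u \<in> omega_monoid \<Omega> Z \<Longrightarrow> fill (emb u) w = u"
  by (induction rule: omega_monoid_induct) (auto simp: fill_def)

lemma fill_closed:
  "\<lbrakk>q \<in> contexts \<Omega> Z; w \<in> omega_monoid \<Omega> Z\<rbrakk> \<Longrightarrow> fill q w \<in> omega_monoid \<Omega> Z"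
  by (induction rule: contexts_induct)
    (auto simp: fill_hole fill_Brk fill_append fill_emb append_omega_monoid Brk_omega_monoid)

lemma fill_inject: "q \<in> contexts \<Omega> Z \<Longrightarrow> fill q v = fill q w \<longleftrightarrow> v = w"
  by (induction rule: contexts_induct) (auto simp: fill_hole fill_Brk fill_append fill_emb)

lemma weight_fill:
  "q \<in> contexts \<Omega> Z \<Longrightarrow> q = [Var None] \<or> weight w < weight (fill q w)"
proof (induction rule: contexts_induct)
  case (left l q)
  then show ?case by (cases l) (auto simp: fill_append fill_emb weight_append fill_hole)
next
  case (right q r)
  then show ?case by (cases r) (auto simp: fill_append fill_emb weight_append fill_hole)
qed (auto simp: fill_Brk fill_hole)

lemma contexts_brk:
  assumes "q \<in> contexts \<Omega> Z" "set_option \<tau> \<subseteq> \<Omega>"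
  shows "brk \<tau> q \<in> contexts \<Omega> Z"
  using assms by (cases \<tau>) (auto simp: brk_def contexts_Brk)


section \<open>The codiscrete 1-algebra\<close>

text \<open>There is exactly one 1-cell between any two 0-cells, namely their pair.\<close>

definition codiscrete :: "('a, 'o, 'k) n_alg \<Rightarrow> ('a \<times> 'a, 'o, 'k) n_alg" where
  "codiscrete A =
    \<lparr> carr = carr A \<times> carr A,
      add = (\<lambda>(a, b) (a', b'). (add A a a', add A b b')),
      zero = (zero A, zero A),
      scl = (\<lambda>r (a, b). (scl A r a, scl A r b)),
      mul = (\<lambda>(a, b) (a', b'). (mul A a a', mul A b b')),
      one = (one A, one A),
      opr = (\<lambda>\<tau> (a, b). (opr A \<tau> a, opr A \<tau> b)),
      bd = (\<lambda>d k (a, b). case d of Src \<Rightarrow> (a, a) | Tgt \<Rightarrow> (b, b)),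
      cmp = (\<lambda>k (a, b) (a', b'). (a, b')) \<rparr>"

lemma n_algebra_codiscrete:
  assumes "omega_algebra \<Omega> A"
  shows "n_algebra \<Omega> (codiscrete A) 1"
proof -
  interpret omega_algebra \<Omega> A by fact
  show ?thesis
    by (unfold_locales; auto simp: codiscrete_def zero_closed one_closed add_closed scl_closed
        mul_closed opr_closed add_assoc add_zero add_inv scl_add add_scl scl_scl
        scl_one mul_assoc one_mul mul_one add_mul mul_add scl_mul mul_scl opr_add opr_scl
        split: side.splits intro: add_comm)
qed

text \<open>
  Different 0-cells stay different as identity 1-cells: otherwise their images under the
  morphism to the codiscrete 1-algebra, which forgets everything but source and target,
  would agree. So a 1-cell has a well-defined source and target among the polynomials.
\<close>

lemma inc_inject:
  assumes A: "omega_algebra \<Omega> A" and Y: "cellular_extension 0 A Y"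
    and ab: "a \<in> carr A" "inc 0 \<Omega> A Y a = inc 0 \<Omega> A Y b"
  shows "a = b"
proof -
  interpret omega_algebra \<Omega> A by fact
  have "feq 0 \<Omega> A Y (Inc a) (Inc b)"
    using ab cls_eq_iff[OF feq.inc_wf[OF ab(1)]] by blast
  moreover have "n_hom 0 \<Omega> A (codiscrete A) (\<lambda>a. (a, a))"
    by (auto simp: n_hom_def codiscrete_def)
  moreover have "n_algebra \<Omega> (codiscrete A) (Suc 0)"
    using n_algebra_codiscrete[OF A] by simp
  ultimately have "cterm_eval (codiscrete A) (\<lambda>a. (a, a)) (\<lambda>y. (csrc Y y, ctgt Y y)) (Inc a) =
      cterm_eval (codiscrete A) (\<lambda>a. (a, a)) (\<lambda>y. (csrc Y y, ctgt Y y)) (Inc b)"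
    using Y by (intro cterm_eval_feq[OF A _ _ _ _ , THEN conjunct2, THEN conjunct2])
      (auto simp: codiscrete_def cellular_extension_def split: side.splits)
  then show ?thesis by simp
qed

section \<open>One-cells, two-cells and their boundaries\<close>

abbreviation smult :: "'k::field \<Rightarrow> ('z, 'o, 'k) poly \<Rightarrow> ('z, 'o, 'k) poly" where
  "smult r \<equiv> Poly_Mapping.map ((*) r)"

lemma smult_algebra:
  "smult r (p + q) = smult r p + smult r q" "smult (r + s) p = smult r p + smult s p"
  "smult r (smult s p) = smult (r * s) p" "smult 1 p = p" "smult 0 p = 0" "smult r 0 = 0"
  "smult r (Poly_Mapping.single u s) = Poly_Mapping.single u (r * s)"
  by (rule poly_mapping_eqI; simp add: lookup_scale lookup_add lookup_single when_def algebra_simps)+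

lemma keys_smult: "Poly_Mapping.keys (smult r p) \<subseteq> Poly_Mapping.keys p"
  by (auto simp: in_keys_iff lookup_scale)

lemma single_mult_mon: "Poly_Mapping.single u r * mon v = (Poly_Mapping.single (u @ v) r)"
  "mon v * Poly_Mapping.single u r = Poly_Mapping.single (v @ u) r"
  by (simp_all add: mult_single plus_list_def)

lemma keys_mult_mon: "Poly_Mapping.keys (p * mon v) \<subseteq> (\<lambda>u. u @ v) ` Poly_Mapping.keys p"
  "Poly_Mapping.keys (mon v * p) \<subseteq> (\<lambda>u. v @ u) ` Poly_Mapping.keys p"
  using keys_mult[of p "mon v"] keys_mult[of "mon v" p] by (auto simp: plus_list_def split: if_splits)

lemma poly_op_single: "poly_op \<tau> (Poly_Mapping.single u r) = Poly_Mapping.single [Brk \<tau> u] r"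
  by (rule poly_mapping_eqI)
    (auto simp: lookup_poly_op lookup_single when_def split: list.splits letter.splits)

lemma keys_poly_op: "Poly_Mapping.keys (poly_op \<tau> p) \<subseteq> (\<lambda>u. [Brk \<tau> u]) ` Poly_Mapping.keys p"
  by (auto simp: in_keys_iff lookup_poly_op split: list.splits letter.splits if_splits)

lemma poly_split: "p = Poly_Mapping.single u (Poly_Mapping.lookup p u) +
    (p - Poly_Mapping.single u (Poly_Mapping.lookup p u))"
  for p :: "'a \<Rightarrow>\<^sub>0 'k::field"
  by (rule poly_mapping_eqI) (simp add: lookup_add lookup_minus)

lemma keys_diff_single:
  "Poly_Mapping.keys (p - Poly_Mapping.single u (Poly_Mapping.lookup p u)) =
     Poly_Mapping.keys p - {u}"
  for p :: "'a \<Rightarrow>\<^sub>0 'k::field"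
  by (auto simp: in_keys_iff lookup_minus lookup_single when_def split: if_splits)

locale rewriting_system =
  fixes \<Omega> :: "'o set"
    and X :: "('z, 'o, 'x, 'k::field) polygraph"
    and Y :: "('y, ('z, 'o, 'x, 'k) cell1) cell_ext"
  assumes polygraph: "omega_1_polygraph \<Omega> X"
begin

abbreviation A1 where "A1 \<equiv> alg1 \<Omega> X"
abbreviation A2 where "A2 \<equiv> alg2 \<Omega> X Y"
abbreviation words where "words \<equiv> omega_monoid \<Omega> (vars X)"
abbreviation ctx where "ctx \<equiv> contexts \<Omega> (vars X)"

abbreviation plus1 (infixl \<open>\<oplus>\<close> 65) where "f \<oplus> g \<equiv> add A1 f g"
abbreviation times1 (infixl \<open>\<otimes>\<close> 70) where "f \<otimes> g \<equiv> mul A1 f g"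
abbreviation scale1 (infixr \<open>\<bullet>\<close> 75) where "r \<bullet> f \<equiv> scl A1 r f"
abbreviation comp1 (infixl \<open>\<star>\<close> 60) where "f \<star> g \<equiv> cmp A1 0 f g"
abbreviation iota (\<open>\<iota>\<close>) where "\<iota> p \<equiv> id1 \<Omega> X p"
abbreviation affine where "affine r f c \<equiv> lin \<Omega> X r f c"
abbreviation two where "two f \<equiv> id2 \<Omega> X Y f"

definition polys :: "('z, 'o, 'k) poly set" where "polys = {p. Poly_Mapping.keys p \<subseteq> words}"

sublocale A1: n_algebra \<Omega> A1 1
  by (rule n_algebra_alg1)

sublocale A2: n_algebra \<Omega> A2 2
  by (rule n_algebra_alg2)

lemma carr0: "carr (alg0 \<Omega> X) = polys"
  by (simp add: alg0_def poly_alg_def polys_def)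

lemma polys_closed:
  "0 \<in> polys" "1 \<in> polys" "\<lbrakk>p \<in> polys; q \<in> polys\<rbrakk> \<Longrightarrow> p + q \<in> polys"
  "p \<in> polys \<Longrightarrow> smult r p \<in> polys" "\<lbrakk>p \<in> polys; q \<in> polys\<rbrakk> \<Longrightarrow> p * q \<in> polys"
  "\<lbrakk>\<tau> \<in> \<Omega>; p \<in> polys\<rbrakk> \<Longrightarrow> poly_op \<tau> p \<in> polys"
  "u \<in> words \<Longrightarrow> Poly_Mapping.single u r \<in> polys"
proof -
  interpret A0: omega_algebra \<Omega> "poly_alg \<Omega> (vars X) :: (('z, 'o, 'k) poly, 'o, 'k) n_alg"
    by (rule omega_algebra_poly_alg)
  have A: "carr (poly_alg \<Omega> (vars X)) = polys" using carr0 by (simp add: alg0_def)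
  have ops: "add (poly_alg \<Omega> (vars X)) = (+)" "mul (poly_alg \<Omega> (vars X)) = (*)"
    "\<And>r p. scl (poly_alg \<Omega> (vars X)) r p = smult r p" "opr (poly_alg \<Omega> (vars X)) = poly_op"
    "zero (poly_alg \<Omega> (vars X)) = 0" "one (poly_alg \<Omega> (vars X)) = 1"
    by (simp_all add: poly_alg_def)
  show "0 \<in> polys" "1 \<in> polys"
    using A0.zero_closed A0.one_closed by (simp_all only: A ops)
  show "\<lbrakk>p \<in> polys; q \<in> polys\<rbrakk> \<Longrightarrow> p + q \<in> polys"
    using A0.add_closed[of p q] by (simp only: A ops)
  show "p \<in> polys \<Longrightarrow> smult r p \<in> polys"
    using A0.scl_closed[of p r] by (simp only: A ops)
  show "\<lbrakk>p \<in> polys; q \<in> polys\<rbrakk> \<Longrightarrow> p * q \<in> polys"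
    using A0.mul_closed[of p q] by (simp only: A ops)
  show "\<lbrakk>\<tau> \<in> \<Omega>; p \<in> polys\<rbrakk> \<Longrightarrow> poly_op \<tau> p \<in> polys"
    using A0.opr_closed[of \<tau> p] by (simp only: A ops)
qed (simp add: polys_def)

lemma
  shows iota_closed: "p \<in> polys \<Longrightarrow> \<iota> p \<in> carr A1"
    and iota_add: "\<lbrakk>p \<in> polys; q \<in> polys\<rbrakk> \<Longrightarrow> \<iota> (p + q) = \<iota> p \<oplus> \<iota> q"
    and iota_scl: "p \<in> polys \<Longrightarrow> \<iota> (smult r p) = r \<bullet> \<iota> p"
    and iota_mul: "\<lbrakk>p \<in> polys; q \<in> polys\<rbrakk> \<Longrightarrow> \<iota> (p * q) = \<iota> p \<otimes> \<iota> q"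
    and iota_opr: "\<lbrakk>\<tau> \<in> \<Omega>; p \<in> polys\<rbrakk> \<Longrightarrow> \<iota> (poly_op \<tau> p) = opr A1 \<tau> (\<iota> p)"
    and iota_one: "\<iota> 1 = one A1"
    and iota_zero: "\<iota> 0 = zero A1"
    and iota_bd: "p \<in> polys \<Longrightarrow> bd A1 d 0 (\<iota> p) = \<iota> p"
proof -
  let ?A = "alg0 \<Omega> X"
  have A: "add ?A = (+)" "mul ?A = (*)" "\<And>r p. scl ?A r p = smult r p" "opr ?A = poly_op"
    "zero ?A = 0" "one ?A = 1"
    by (simp_all add: alg0_def poly_alg_def)
  note S = free_ext_simps[where n=0 and \<Omega>=\<Omega> and A="?A" and Y="rules X"]
  note wf = feq.inc_wf[where n=0 and \<Omega>=\<Omega> and A="?A" and Y="rules X"]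
  note D = id1_def alg1_def
  show "p \<in> polys \<Longrightarrow> \<iota> p \<in> carr A1"
    unfolding D S carr0[symmetric] using wf by blast
  show "\<iota> 1 = one A1" "\<iota> 0 = zero A1"
    unfolding D S A by simp_all
  show "\<lbrakk>p \<in> polys; q \<in> polys\<rbrakk> \<Longrightarrow> \<iota> (p + q) = \<iota> p \<oplus> \<iota> q"
    unfolding D carr0[symmetric] A[symmetric]
    by (simp only: S wf) (intro cls_eqI feq.sym[OF feq.inc_add])
  show "p \<in> polys \<Longrightarrow> \<iota> (smult r p) = r \<bullet> \<iota> p"
    unfolding D carr0[symmetric] A[symmetric]
    by (simp only: S wf) (intro cls_eqI feq.sym[OF feq.inc_scl])
  show "\<lbrakk>p \<in> polys; q \<in> polys\<rbrakk> \<Longrightarrow> \<iota> (p * q) = \<iota> p \<otimes> \<iota> q"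
    unfolding D carr0[symmetric] A[symmetric]
    by (simp only: S wf) (intro cls_eqI feq.sym[OF feq.inc_mul])
  show "\<lbrakk>\<tau> \<in> \<Omega>; p \<in> polys\<rbrakk> \<Longrightarrow> \<iota> (poly_op \<tau> p) = opr A1 \<tau> (\<iota> p)"
    unfolding D carr0[symmetric] A[symmetric]
    by (simp only: S wf) (intro cls_eqI feq.sym[OF feq.inc_opr])
  show "p \<in> polys \<Longrightarrow> bd A1 d 0 (\<iota> p) = \<iota> p"
    unfolding D carr0[symmetric]
    by (simp only: S wf) (intro cls_eqI feq.inc_id)
qed

lemma iota_inject: "\<lbrakk>p \<in> polys; \<iota> p = \<iota> q\<rbrakk> \<Longrightarrow> p = q"
  using inc_inject[of \<Omega> "alg0 \<Omega> X" "rules X" p q] polygraph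
    omega_algebra_poly_alg[of \<Omega> "vars X"]
  by (simp add: id1_def carr0 omega_1_polygraph_def) (simp add: alg0_def)

lemma
  shows two_closed: "f \<in> carr A1 \<Longrightarrow> two f \<in> carr A2"
    and two_add: "\<lbrakk>f \<in> carr A1; g \<in> carr A1\<rbrakk> \<Longrightarrow> two (f \<oplus> g) = add A2 (two f) (two g)"
    and two_scl: "f \<in> carr A1 \<Longrightarrow> two (r \<bullet> f) = scl A2 r (two f)"
    and two_mul: "\<lbrakk>f \<in> carr A1; g \<in> carr A1\<rbrakk> \<Longrightarrow> two (f \<otimes> g) = mul A2 (two f) (two g)"
    and two_opr: "\<lbrakk>\<tau> \<in> \<Omega>; f \<in> carr A1\<rbrakk> \<Longrightarrow> two (opr A1 \<tau> f) = opr A2 \<tau> (two f)"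
    and two_bd0: "f \<in> carr A1 \<Longrightarrow> bd A2 d 0 (two f) = two (bd A1 d 0 f)"
    and two_bd1: "f \<in> carr A1 \<Longrightarrow> bd A2 d 1 (two f) = two f"
    and two_cmp: "\<lbrakk>f \<in> carr A1; g \<in> carr A1; bd A1 Tgt 0 f = bd A1 Src 0 g\<rbrakk>
      \<Longrightarrow> two (f \<star> g) = cmp A2 0 (two f) (two g)"
proof -
  note S = free_ext_simps[where n=1 and \<Omega>=\<Omega> and A=A1 and Y=Y]
  note wf = feq.inc_wf[where n=1 and \<Omega>=\<Omega> and A=A1 and Y=Y]
  note D = id2_def alg2_def
  have n: "(0::nat) \<le> 1" "(1::nat) \<le> 1" "(0::nat) < 1" by simp_all
  show "f \<in> carr A1 \<Longrightarrow> two f \<in> carr A2"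
    unfolding D S using wf by blast
  show "\<lbrakk>f \<in> carr A1; g \<in> carr A1\<rbrakk> \<Longrightarrow> two (f \<oplus> g) = add A2 (two f) (two g)"
    unfolding D by (simp only: S wf) (intro cls_eqI feq.sym[OF feq.inc_add])
  show "f \<in> carr A1 \<Longrightarrow> two (r \<bullet> f) = scl A2 r (two f)"
    unfolding D by (simp only: S wf) (intro cls_eqI feq.sym[OF feq.inc_scl])
  show "\<lbrakk>f \<in> carr A1; g \<in> carr A1\<rbrakk> \<Longrightarrow> two (f \<otimes> g) = mul A2 (two f) (two g)"
    unfolding D by (simp only: S wf) (intro cls_eqI feq.sym[OF feq.inc_mul])
  show "\<lbrakk>\<tau> \<in> \<Omega>; f \<in> carr A1\<rbrakk> \<Longrightarrow> two (opr A1 \<tau> f) = opr A2 \<tau> (two f)"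
    unfolding D by (simp only: S wf) (intro cls_eqI feq.sym[OF feq.inc_opr])
  show "f \<in> carr A1 \<Longrightarrow> bd A2 d 0 (two f) = two (bd A1 d 0 f)"
    unfolding D by (simp only: S wf n) (intro cls_eqI feq.inc_bd n)
  show "f \<in> carr A1 \<Longrightarrow> bd A2 d 1 (two f) = two f"
    unfolding D by (simp only: S wf n) (intro cls_eqI feq.inc_id)
  assume fg: "f \<in> carr A1" "g \<in> carr A1" "bd A1 Tgt 0 f = bd A1 Src 0 g"
  have ends: "feq 1 \<Omega> A1 Y (Bd Tgt 0 (Inc f)) (Inc (bd A1 Tgt 0 f))"
    "feq 1 \<Omega> A1 Y (Bd Src 0 (Inc g)) (Inc (bd A1 Src 0 g))"
    by (intro feq.inc_bd n fg)+
  have "feq 1 \<Omega> A1 Y (Bd Tgt 0 (Inc f)) (Bd Src 0 (Inc g))"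
    by (rule feq.trans[OF ends(1)[unfolded fg(3)] feq.sym[OF ends(2)]])
  then show "two (f \<star> g) = cmp A2 0 (two f) (two g)"
    unfolding D using fg by (simp only: S wf n) (intro cls_eqI feq.sym[OF feq.inc_cmp] n)
qed

definition arr where
  "arr f p q \<longleftrightarrow> f \<in> carr A1 \<and> p \<in> polys \<and> q \<in> polys \<and>
     bd A1 Src 0 f = \<iota> p \<and> bd A1 Tgt 0 f = \<iota> q"

lemma arrD: "arr f p q \<Longrightarrow> f \<in> carr A1" "arr f p q \<Longrightarrow> p \<in> polys" "arr f p q \<Longrightarrow> q \<in> polys"
  "arr f p q \<Longrightarrow> bd A1 Src 0 f = \<iota> p" "arr f p q \<Longrightarrow> bd A1 Tgt 0 f = \<iota> q"
  by (simp_all add: arr_def)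

lemma arr_unique: "\<lbrakk>arr f p q; arr f p' q'\<rbrakk> \<Longrightarrow> p' = p \<and> q' = q"
  unfolding arr_def using iota_inject by metis

lemma arr_id: "p \<in> polys \<Longrightarrow> arr (\<iota> p) p p"
  by (simp add: arr_def iota_closed iota_bd)

lemma arr_add: "\<lbrakk>arr f p q; arr g p' q'\<rbrakk> \<Longrightarrow> arr (f \<oplus> g) (p + p') (q + q')"
  unfolding arr_def using polys_closed(3)
  by (simp only: A1.add_closed A1.bd_add iota_add zero_less_one)

lemma arr_scl: "arr f p q \<Longrightarrow> arr (r \<bullet> f) (smult r p) (smult r q)"
  unfolding arr_def using polys_closed(4)
  by (simp only: A1.scl_closed A1.bd_scl iota_scl zero_less_one)

lemma arr_mul: "\<lbrakk>arr f p q; arr g p' q'\<rbrakk> \<Longrightarrow> arr (f \<otimes> g) (p * p') (q * q')"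
  unfolding arr_def using polys_closed(5)
  by (simp only: A1.mul_closed A1.bd_mul iota_mul zero_less_one)

lemma arr_opr: "\<lbrakk>\<tau> \<in> \<Omega>; arr f p q\<rbrakk> \<Longrightarrow> arr (opr A1 \<tau> f) (poly_op \<tau> p) (poly_op \<tau> q)"
  unfolding arr_def using polys_closed(6)
  by (simp only: A1.opr_closed A1.bd_opr iota_opr zero_less_one)

lemma arr_comp: "\<lbrakk>arr f p q; arr g q r\<rbrakk> \<Longrightarrow> arr (f \<star> g) p r"
  unfolding arr_def by (simp only: A1.cmp_closed A1.src_cmp A1.tgt_cmp zero_less_one)

lemma arr_affine:
  "\<lbrakk>arr f p q; c \<in> polys\<rbrakk> \<Longrightarrow> arr (affine r f c) (smult r p + c) (smult r q + c)"
  unfolding lin_def by (intro arr_add arr_scl arr_id)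

lemma comp_assoc: "\<lbrakk>arr f p q; arr g q r; arr h r s\<rbrakk> \<Longrightarrow> f \<star> g \<star> h = f \<star> (g \<star> h)"
  by (rule A1.cmp_assoc) (simp_all add: arr_def)

lemma comp_units: "arr f p q \<Longrightarrow> \<iota> p \<star> f = f" "arr f p q \<Longrightarrow> f \<star> \<iota> q = f"
  using A1.cmp_unit_left[of 0 f] A1.cmp_unit_right[of 0 f] by (simp_all add: arr_def)

lemma comp_add: "\<lbrakk>arr f p q; arr g q r; arr f' p' q'; arr g' q' r'\<rbrakk>
    \<Longrightarrow> (f \<oplus> f') \<star> (g \<oplus> g') = (f \<star> g) \<oplus> (f' \<star> g')"
  by (rule A1.cmp_add) (simp_all add: arr_def)

lemma comp_mul: "\<lbrakk>arr f p q; arr g q r; arr f' p' q'; arr g' q' r'\<rbrakk>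
    \<Longrightarrow> (f \<otimes> f') \<star> (g \<otimes> g') = (f \<star> g) \<otimes> (f' \<star> g')"
  by (rule A1.cmp_mul) (simp_all add: arr_def)

lemma comp_scl: "\<lbrakk>arr f p q; arr g q r\<rbrakk> \<Longrightarrow> (s \<bullet> f) \<star> (s \<bullet> g) = s \<bullet> (f \<star> g)"
  by (rule A1.cmp_scl) (simp_all add: arr_def)

lemma comp_opr: "\<lbrakk>\<tau> \<in> \<Omega>; arr f p q; arr g q r\<rbrakk>
    \<Longrightarrow> opr A1 \<tau> f \<star> opr A1 \<tau> g = opr A1 \<tau> (f \<star> g)"
  by (rule A1.cmp_opr) (simp_all add: arr_def)

lemma comp_affine:
  assumes "arr f p q" "arr g q r" "c \<in> polys"
  shows "affine s f c \<star> affine s g c = affine s (f \<star> g) c"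
  unfolding lin_def using assms
  by (simp add: comp_add[OF arr_scl[OF assms(1)] arr_scl[OF assms(2)] arr_id arr_id] comp_scl
      comp_units(1)[OF arr_id])

lemma add_left_comm:
  "\<lbrakk>f \<in> carr A1; g \<in> carr A1; h \<in> carr A1\<rbrakk> \<Longrightarrow> f \<oplus> (g \<oplus> h) = g \<oplus> (f \<oplus> h)"
  by (metis A1.add_assoc A1.add_comm)

text \<open>
  Compositions of sums are computed summand by summand, so two cells acting on different summands
  can be applied in either order, and both composites are the sum of the cells. This
  identity gives the inverse of a 1-cell, the triangle that completes \<open>r f + c\<close>, the closure of
  additive branchings and the decomposition of a sum of two zigzags.
\<close>

lemma affine_comp:
  assumes f: "arr f x a" and g: "arr g y b" and c: "c \<in> polys"
  shows "affine r f (smult s y + c) \<star> affine s g (smult r a + c) = (r \<bullet> f) \<oplus> affine s g c"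
proof -
  note D = arrD[OF f] arrD[OF g]
  note arrs = arr_scl[OF f, of r] arr_id[OF polys_closed(4), OF D(3), of r]
    arr_scl[OF g, of s] arr_id[OF polys_closed(4), OF D(7), of s] arr_id[OF c]
  note car = arrs[THEN arrD(1)]
  have 1: "affine r f (smult s y + c) = (r \<bullet> f) \<oplus> (\<iota> (smult s y) \<oplus> \<iota> c)"
    unfolding lin_def by (subst iota_add) (use D c polys_closed in auto)
  have 2: "affine s g (smult r a + c) = \<iota> (smult r a) \<oplus> ((s \<bullet> g) \<oplus> \<iota> c)"
    unfolding lin_def iota_add[OF polys_closed(4)[OF D(3)] c]
    by (rule add_left_comm) (rule car)+
  show ?thesis
    unfolding 1 2 unfolding lin_def
    by (subst comp_add[OF arrs(1,2) arr_add[OF arrs(4,5)] arr_add[OF arrs(3,5)]],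
        subst comp_add[OF arrs(4,3,5,5)])
      (simp only: comp_units(1)[OF arrs(3)] comp_units(2)[OF arrs(1)] comp_units(1)[OF arrs(5)])
qed

lemma affine_comp_swap:
  assumes f: "arr f x a" and g: "arr g y b" and c: "c \<in> polys"
  shows "affine r f (smult s y + c) \<star> affine s g (smult r a + c) =
    affine s g (smult r x + c) \<star> affine r f (smult s b + c)"
proof -
  have "r \<bullet> f \<in> carr A1" "s \<bullet> g \<in> carr A1" "\<iota> c \<in> carr A1"
    using assms by (auto intro: A1.scl_closed iota_closed simp: arr_def)
  then show ?thesis
    unfolding affine_comp[OF f g c] affine_comp[OF g f c] unfolding lin_def
    by (rule add_left_comm)
qed

lemma affine_trivial: "f \<in> carr A1 \<Longrightarrow> affine 1 f 0 = f"
  by (simp add: lin_def A1.scl_one iota_zero A1.add_zero)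

lemma scl_zero: "f \<in> carr A1 \<Longrightarrow> 0 \<bullet> f = zero A1"
  using A1.add_scl[of f 1 "- 1"] A1.add_inv[of f] by (simp add: A1.scl_one)

lemma affine_zero: "\<lbrakk>f \<in> carr A1; c \<in> polys\<rbrakk> \<Longrightarrow> affine 0 f c = \<iota> c"
  unfolding lin_def using scl_zero A1.add_comm[of "zero A1" "\<iota> c"]
  by (simp add: A1.zero_closed iota_closed A1.add_zero)

lemma affine_same:
  assumes f: "arr f x a" and c: "c \<in> polys"
  shows "affine r f (smult s x + c) \<star> affine s f (smult r a + c) = affine (r + s) f c"
  unfolding affine_comp[OF f f c] unfolding lin_def
  using A1.add_assoc[of "r \<bullet> f" "s \<bullet> f" "\<iota> c"] A1.add_scl[of f r s] f c
  by (simp add: arr_def A1.scl_closed iota_closed)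

text \<open>
  Every 1-cell is invertible: subtract it from the sum of the identities of its source and target.
\<close>

definition inv1 where
  "inv1 f p q = affine (- 1) f (p + q)"

lemma arr_inv1: "arr f p q \<Longrightarrow> arr (inv1 f p q) q p"
proof -
  assume f: "arr f p q"
  have "smult (- 1) p + (p + q) = q" "smult (- 1) q + (p + q) = p"
    by (rule poly_mapping_eqI; simp add: lookup_add lookup_scale)+
  then show ?thesis
    unfolding inv1_def
    using arr_affine[OF f polys_closed(3)[OF arrD(2,3)[OF f]], of "- 1"] by (simp only:)
qed

lemma comp_inv1:
  assumes f: "arr f p q"
  shows "f \<star> inv1 f p q = \<iota> p" "inv1 f p q \<star> f = \<iota> q"
proof -
  note P = arrD(1-3)[OF f]
  have z: "smult (- 1) p + p = 0" "smult (- 1) q + q = 0"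
    by (rule poly_mapping_eqI; simp add: lookup_add lookup_scale)+
  have "affine 1 f (smult (- 1) p + p) \<star> affine (- 1) f (smult 1 q + p) = affine (1 + - 1) f p"
    using P by (intro affine_same[OF f])
  then show "f \<star> inv1 f p q = \<iota> p"
    using P by (simp only: z affine_trivial affine_zero smult_algebra(4) inv1_def
        add.commute[of p q] add.right_inverse)
  have "affine (- 1) f (smult 1 p + q) \<star> affine 1 f (smult (- 1) q + q) = affine (- 1 + 1) f q"
    using P by (intro affine_same[OF f])
  then show "inv1 f p q \<star> f = \<iota> q"
    using P by (simp only: z affine_trivial affine_zero smult_algebra(4) inv1_def
        add.left_inverse)
qed

text \<open>
  The boundaries are recorded along with the 2-cell, so that this relation can be composed
  without returning to the definitions.
\<close>

definition sim where
  "sim f g p q \<longleftrightarrow> arr f p q \<and> arr g p q \<and>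
     (\<exists>F\<in>carr A2. bd A2 Src 1 F = two f \<and> bd A2 Tgt 1 F = two g)"

lemma sim_arr: "sim f g p q \<Longrightarrow> arr f p q" "sim f g p q \<Longrightarrow> arr g p q"
  by (simp_all add: sim_def)

lemma sim_refl: "arr f p q \<Longrightarrow> sim f f p q"
  unfolding sim_def by (metis arrD(1) two_closed two_bd1)

lemma sim_trans: "\<lbrakk>sim f g p q; sim g h p q\<rbrakk> \<Longrightarrow> sim f h p q"
proof -
  assume a: "sim f g p q" "sim g h p q"
  obtain F G where F: "F \<in> carr A2" "bd A2 Src 1 F = two f" "bd A2 Tgt 1 F = two g"
    and G: "G \<in> carr A2" "bd A2 Src 1 G = two g" "bd A2 Tgt 1 G = two h"
    using a by (auto simp: sim_def)
  have "cmp A2 1 F G \<in> carr A2" "bd A2 Src 1 (cmp A2 1 F G) = two f"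
    "bd A2 Tgt 1 (cmp A2 1 F G) = two h"
    using F G by (simp_all add: A2.cmp_closed A2.src_cmp A2.tgt_cmp)
  then show "sim f h p q" using a unfolding sim_def by blast
qed

text \<open>
  A 2-cell \<open>F: f \<Rightarrow> g\<close> is reversed by the same formula \<open>f - F + g\<close> as a 1-cell.
\<close>

lemma sim_sym:
  assumes "sim f g p q"
  shows "sim g f p q"
proof -
  obtain F where F: "F \<in> carr A2" "bd A2 Src 1 F = two f" "bd A2 Tgt 1 F = two g"
    using assms by (auto simp: sim_def)
  have fg: "two f \<in> carr A2" "two g \<in> carr A2" "bd A2 d 1 (two f) = two f"
      "bd A2 d 1 (two g) = two g" for d
    using assms by (simp_all only: sim_def arr_def two_closed two_bd1)
  define G where "G = add A2 (add A2 (two f) (scl A2 (- 1) F)) (two g)"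
  have z: "add A2 (add A2 a (scl A2 (- 1) a)) b = b" if "a \<in> carr A2" "b \<in> carr A2" for a b
    using that by (metis A2.add_comm A2.add_inv A2.add_zero A2.zero_closed)
  have "G \<in> carr A2"
    unfolding G_def by (intro A2.add_closed A2.scl_closed fg F)
  moreover have "bd A2 Src 1 G = two g"
    unfolding G_def using F fg z[OF fg(1,2)]
    by (simp add: A2.bd_add A2.bd_scl A2.add_closed A2.scl_closed)
  moreover have "bd A2 Tgt 1 G = two f"
    unfolding G_def using F fg z[OF fg(2,1)]
    by (simp add: A2.bd_add A2.bd_scl A2.add_closed A2.scl_closed)
      (metis A2.add_assoc A2.add_comm A2.scl_closed)
  ultimately show ?thesis using assms unfolding sim_def by blast
qed

lemma sim_add:
  assumes "sim f g p q" "sim f' g' p' q'"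
  shows "sim (f \<oplus> f') (g \<oplus> g') (p + p') (q + q')"
proof -
  obtain F F' where F: "F \<in> carr A2" "bd A2 Src 1 F = two f" "bd A2 Tgt 1 F = two g"
    and F': "F' \<in> carr A2" "bd A2 Src 1 F' = two f'" "bd A2 Tgt 1 F' = two g'"
    using assms by (auto simp: sim_def)
  then show ?thesis
    using assms unfolding sim_def
    by (intro conjI arr_add bexI[of _ "add A2 F F'"])
      (auto simp: arr_def two_add A2.bd_add A2.add_closed)
qed

lemma sim_mul:
  assumes "sim f g p q" "sim f' g' p' q'"
  shows "sim (f \<otimes> f') (g \<otimes> g') (p * p') (q * q')"
proof -
  obtain F F' where F: "F \<in> carr A2" "bd A2 Src 1 F = two f" "bd A2 Tgt 1 F = two g"
    and F': "F' \<in> carr A2" "bd A2 Src 1 F' = two f'" "bd A2 Tgt 1 F' = two g'"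
    using assms by (auto simp: sim_def)
  then show ?thesis
    using assms unfolding sim_def
    by (intro conjI arr_mul bexI[of _ "mul A2 F F'"])
      (auto simp: arr_def two_mul A2.bd_mul A2.mul_closed)
qed

lemma sim_scl:
  assumes "sim f g p q"
  shows "sim (r \<bullet> f) (r \<bullet> g) (smult r p) (smult r q)"
proof -
  obtain F where F: "F \<in> carr A2" "bd A2 Src 1 F = two f" "bd A2 Tgt 1 F = two g"
    using assms by (auto simp: sim_def)
  then show ?thesis
    using assms unfolding sim_def
    by (intro conjI arr_scl bexI[of _ "scl A2 r F"])
      (auto simp: arr_def two_scl A2.bd_scl A2.scl_closed)
qed

lemma sim_opr:
  assumes "\<tau> \<in> \<Omega>" "sim f g p q"
  shows "sim (opr A1 \<tau> f) (opr A1 \<tau> g) (poly_op \<tau> p) (poly_op \<tau> q)"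
proof -
  obtain F where F: "F \<in> carr A2" "bd A2 Src 1 F = two f" "bd A2 Tgt 1 F = two g"
    using assms by (auto simp: sim_def)
  then show ?thesis
    using assms unfolding sim_def
    by (intro conjI arr_opr bexI[of _ "opr A2 \<tau> F"])
      (auto simp: arr_def two_opr A2.bd_opr A2.opr_closed)
qed

lemma sim_affine:
  "\<lbrakk>sim f g p q; c \<in> polys\<rbrakk> \<Longrightarrow> sim (affine r f c) (affine r g c) (smult r p + c) (smult r q + c)"
  unfolding lin_def by (intro sim_add sim_scl sim_refl arr_id)

lemma sim_comp:
  assumes fg: "sim f g p q" and fg': "sim f' g' q r"
  shows "sim (f \<star> f') (g \<star> g') p r"
proof -
  obtain F F' where F: "F \<in> carr A2" "bd A2 Src 1 F = two f" "bd A2 Tgt 1 F = two g"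
    and F': "F' \<in> carr A2" "bd A2 Src 1 F' = two f'" "bd A2 Tgt 1 F' = two g'"
    using assms by (auto simp: sim_def)
  have car: "f \<in> carr A1" "g \<in> carr A1" "f' \<in> carr A1" "g' \<in> carr A1"
    and b: "bd A1 Tgt 0 f = bd A1 Src 0 f'" "bd A1 Tgt 0 g = bd A1 Src 0 g'"
    using assms by (auto simp: sim_def arr_def)
  have "bd A2 Tgt 0 F = bd A2 Tgt 0 (bd A2 Src 1 F)" "bd A2 Src 0 F' = bd A2 Src 0 (bd A2 Src 1 F')"
    by (rule A2.bd_bd_less[symmetric]; simp add: F F')+
  then have t: "bd A2 Tgt 0 F = bd A2 Src 0 F'"
    using F F' car b by (simp add: two_bd0)
  have "cmp A2 0 F F' \<in> carr A2" using F F' t by (simp add: A2.cmp_closed)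
  moreover have "bd A2 Src 1 (cmp A2 0 F F') = two (f \<star> f')"
    using A2.bd_cmp[of 0 1 F F' Src] F F' t car b by (simp add: two_cmp)
  moreover have "bd A2 Tgt 1 (cmp A2 0 F F') = two (g \<star> g')"
    using A2.bd_cmp[of 0 1 F F' Tgt] F F' t car b by (simp add: two_cmp)
  ultimately show ?thesis
    using assms arr_comp unfolding sim_def by blast
qed

end

section \<open>Contexts acting on cells\<close>

lemma foldr_mul_append:
  assumes A: "omega_algebra \<Omega> A" and "set xs \<subseteq> carr A" "set ys \<subseteq> carr A"
  shows "List.foldr (mul A) xs (one A) \<in> carr A"
    and "List.foldr (mul A) (xs @ ys) (one A) =
      mul A (List.foldr (mul A) xs (one A)) (List.foldr (mul A) ys (one A))"
proof -
  interpret omega_algebra \<Omega> A by fact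
  have car: "List.foldr (mul A) zs (one A) \<in> carr A" if "set zs \<subseteq> carr A" for zs
    using that by (induction zs) (auto intro: one_closed mul_closed)
  show "List.foldr (mul A) xs (one A) \<in> carr A" using car assms by blast
  show "List.foldr (mul A) (xs @ ys) (one A) =
      mul A (List.foldr (mul A) xs (one A)) (List.foldr (mul A) ys (one A))"
    using assms(2)
  proof (induction xs)
    case Nil
    then show ?case using one_mul car[OF assms(3)] by simp
  next
    case (Cons x xs)
    then show ?case using car[OF assms(3)] car[of xs] by (simp add: mul_assoc)
  qed
qed

lemma eval_letter_closed:
  assumes A: "omega_algebra \<Omega> A" and "\<And>l. l \<in> L \<Longrightarrow> \<phi> l \<in> carr A"
    and w: "w \<in> omega_monoid \<Omega> L"
  shows "eval_letter A \<phi> ` set w \<subseteq> carr A"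
  using w
proof (induction rule: omega_monoid_induct)
  case (Brk \<tau> u w)
  then have "List.foldr (mul A) (map (eval_letter A \<phi>) u) (one A) \<in> carr A"
    using foldr_mul_append(1)[OF A, of "map (eval_letter A \<phi>) u" "[]"] by simp
  then show ?case using Brk omega_algebra.opr_closed[OF A] by simp
qed (use assms in auto)

lemma eval_word_simps:
  assumes A: "omega_algebra \<Omega> A" and L: "\<And>l. l \<in> L \<Longrightarrow> \<phi> l \<in> carr A"
  shows "w \<in> omega_monoid \<Omega> L \<Longrightarrow> eval_word A \<phi> w \<in> carr A"
    and "\<lbrakk>v \<in> omega_monoid \<Omega> L; w \<in> omega_monoid \<Omega> L\<rbrakk>
      \<Longrightarrow> eval_word A \<phi> (v @ w) = mul A (eval_word A \<phi> v) (eval_word A \<phi> w)"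
    and "w \<in> omega_monoid \<Omega> L \<Longrightarrow> \<tau> \<in> \<Omega> \<Longrightarrow>
      eval_word A \<phi> [Brk \<tau> w] = opr A \<tau> (eval_word A \<phi> w)"
    and "l \<in> L \<Longrightarrow> eval_word A \<phi> [Var l] = \<phi> l"
proof -
  interpret omega_algebra \<Omega> A by fact
  have car: "set (map (eval_letter A \<phi>) w) \<subseteq> carr A" if "w \<in> omega_monoid \<Omega> L" for w
    using eval_letter_closed[OF A L that] by simp
  show *: "eval_word A \<phi> w \<in> carr A" if "w \<in> omega_monoid \<Omega> L" for w
    unfolding eval_word_def using foldr_mul_append(1)[OF A car[OF that], of "[]"] by simp
  show "eval_word A \<phi> (v @ w) = mul A (eval_word A \<phi> v) (eval_word A \<phi> w)"
    if "v \<in> omega_monoid \<Omega> L" "w \<in> omega_monoid \<Omega> L"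
    using foldr_mul_append(2)[OF A car[OF that(1)] car[OF that(2)]] by (simp add: eval_word_def)
  show "eval_word A \<phi> [Brk \<tau> w] = opr A \<tau> (eval_word A \<phi> w)"
    if "w \<in> omega_monoid \<Omega> L" "\<tau> \<in> \<Omega>"
    using *[OF that(1)] that(2) mul_one opr_closed by (simp add: eval_word_def)
  show "eval_word A \<phi> [Var l] = \<phi> l" if "l \<in> L"
    using L[OF that] mul_one by (simp add: eval_word_def)
qed

lemma poly_alg_sel:
  "carr (poly_alg \<Omega> Z) = {p. Poly_Mapping.keys p \<subseteq> omega_monoid \<Omega> Z}"
  "mul (poly_alg \<Omega> Z) = (*)" "one (poly_alg \<Omega> Z) = 1" "opr (poly_alg \<Omega> Z) = poly_op"
  by (simp_all add: poly_alg_def)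

text \<open>
  The target algebra \<open>A\<close> and the morphism \<open>h\<close> are kept general because contexts act both on 1-cells
  (\<open>h\<close> the inclusion of 0-cells as identities) and on 0-cells (\<open>h\<close> the identity).
\<close>

lemma eval_context:
  fixes h :: "('z, 'o, 'k::field) poly \<Rightarrow> 'a"
  assumes A: "omega_algebra \<Omega> A" and h: "n_hom 0 \<Omega> (poly_alg \<Omega> Z) A h" and f: "f \<in> carr A"
  defines "E \<equiv> eval_word A (\<lambda>l. case l of None \<Rightarrow> f | Some z \<Rightarrow> h (mon [Var z]))"
  shows "E [Var None] = f"
    and "\<lbrakk>\<tau> \<in> \<Omega>; q \<in> contexts \<Omega> Z\<rbrakk> \<Longrightarrow> E [Brk \<tau> q] = opr A \<tau> (E q)"
    and "\<lbrakk>l \<in> omega_monoid \<Omega> Z; q \<in> contexts \<Omega> Z\<rbrakk> \<Longrightarrow> E (emb l @ q) = mul A (h (mon l)) (E q)"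
    and "\<lbrakk>q \<in> contexts \<Omega> Z; r \<in> omega_monoid \<Omega> Z\<rbrakk> \<Longrightarrow> E (q @ emb r) = mul A (E q) (h (mon r))"
proof -
  let ?L = "insert None (Some ` Z)"
  have mon: "mon w \<in> carr (poly_alg \<Omega> Z :: (('z, 'o, 'k) poly, 'o, 'k) n_alg)"
    if "w \<in> omega_monoid \<Omega> Z" for w
    using that by (simp add: poly_alg_sel)
  have Ho: "h (poly_op \<tau> p) = opr A \<tau> (h p)"
    if "p \<in> carr (poly_alg \<Omega> Z)" "\<tau> \<in> \<Omega>" for p \<tau>
    using h that unfolding n_hom_def poly_alg_sel by blast
  have Hm: "h (p * p') = mul A (h p) (h p')"
    if "p \<in> carr (poly_alg \<Omega> Z)" "p' \<in> carr (poly_alg \<Omega> Z)" for p p'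
    using h that unfolding n_hom_def poly_alg_sel by blast
  have one: "h 1 = one A" using h unfolding n_hom_def poly_alg_sel by blast
  have L: "(case l of None \<Rightarrow> f | Some z \<Rightarrow> h (mon [Var z])) \<in> carr A" if "l \<in> ?L" for l
    using that f h mon by (auto simp: n_hom_def Var_omega_monoid)
  define \<phi> where "\<phi> = (\<lambda>l. case l of None \<Rightarrow> f | Some z \<Rightarrow> h (mon [Var z]))"
  have E: "E = eval_word A \<phi>" by (simp add: E_def \<phi>_def)
  have L': "\<phi> l \<in> carr A" if "l \<in> ?L" for l
    using L[OF that] by (simp add: \<phi>_def)
  note ev = eval_word_simps[where A=A and \<phi>=\<phi> and L="?L", OF A L', folded E]
  have E_emb: "E (emb w) = h (mon w)" "emb w \<in> omega_monoid \<Omega> ?L"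
    if "w \<in> omega_monoid \<Omega> Z" for w
  proof -
    show "E (emb w) = h (mon w)"
      using that
    proof (induction rule: omega_monoid_induct)
      case Nil
      have "mon [] = (1 :: ('z, 'o, 'k) poly)" by (simp add: zero_list_def[symmetric])
      then show ?case by (simp add: E_def eval_word_def one)
    next
      case (Var z w)
      have "E ([Var (Some z)] @ emb w) = mul A (E [Var (Some z)]) (E (emb w))"
        using Var(1,2) holes_emb[of w \<Omega> Z] by (intro ev(2)) (auto simp: Var_omega_monoid)
      moreover have "E [Var (Some z)] = h (mon [Var z])"
        using ev(4)[of "Some z"] Var(1) by (simp add: \<phi>_def)
      moreover have "h (mon [Var z] * mon w) = mul A (h (mon [Var z])) (h (mon w))"
        using Var(1,2) by (intro Hm mon) (auto simp: Var_omega_monoid)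
      ultimately show ?case using Var.IH by (simp add: mult_single plus_list_def)
    next
      case (Brk \<tau> u w)
      have "E ([Brk \<tau> (emb u)] @ emb w) = mul A (E [Brk \<tau> (emb u)]) (E (emb w))"
        using Brk(1-3) holes_emb[of w \<Omega> Z] holes_emb[of u \<Omega> Z]
        by (intro ev(2)) (auto simp: Brk_omega_monoid)
      moreover have "E [Brk \<tau> (emb u)] = h (mon [Brk \<tau> u])"
        using ev(3)[of "emb u" \<tau>] Brk(1-4) holes_emb[of u \<Omega> Z] Ho[OF mon, of u \<tau>]
        by (simp add: poly_op_single)
      moreover have "h (mon [Brk \<tau> u] * mon w) = mul A (h (mon [Brk \<tau> u])) (h (mon w))"
        using Brk(1-3) by (intro Hm mon) (auto simp: Brk_omega_monoid)
      ultimately show ?case using Brk.IH by (simp add: mult_single plus_list_def)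
    qed
    show "emb w \<in> omega_monoid \<Omega> ?L" using holes_emb that by blast
  qed
  have ctx: "q \<in> omega_monoid \<Omega> ?L" if "q \<in> contexts \<Omega> Z" for q
    using that by (simp add: contexts_def)
  show "E [Var None] = f" using ev(4)[of None] by (simp add: \<phi>_def)
  show "\<lbrakk>\<tau> \<in> \<Omega>; q \<in> contexts \<Omega> Z\<rbrakk> \<Longrightarrow> E [Brk \<tau> q] = opr A \<tau> (E q)"
    using ev(3) ctx by blast
  show "\<lbrakk>l \<in> omega_monoid \<Omega> Z; q \<in> contexts \<Omega> Z\<rbrakk> \<Longrightarrow> E (emb l @ q) = mul A (h (mon l)) (E q)"
    using ev(2)[of "emb l" q] E_emb[of l] ctx[of q] by simp
  show "\<lbrakk>q \<in> contexts \<Omega> Z; r \<in> omega_monoid \<Omega> Z\<rbrakk> \<Longrightarrow> E (q @ emb r) = mul A (E q) (h (mon r))"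
    using ev(2)[of q "emb r"] E_emb[of r] ctx[of q] by simp
qed

context rewriting_system
begin

abbreviation plug1 where "plug1 q f \<equiv> plug \<Omega> X q f"

lemma plug_simps:
  "f \<in> carr A1 \<Longrightarrow> plug1 [Var None] f = f"
  "\<lbrakk>\<tau> \<in> \<Omega>; q \<in> ctx; f \<in> carr A1\<rbrakk> \<Longrightarrow> plug1 [Brk \<tau> q] f = opr A1 \<tau> (plug1 q f)"
  "\<lbrakk>l \<in> words; q \<in> ctx; f \<in> carr A1\<rbrakk> \<Longrightarrow> plug1 (emb l @ q) f = \<iota> (mon l) \<otimes> plug1 q f"
  "\<lbrakk>q \<in> ctx; r \<in> words; f \<in> carr A1\<rbrakk> \<Longrightarrow> plug1 (q @ emb r) f = plug1 q f \<otimes> \<iota> (mon r)"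
proof -
  have "n_hom 0 \<Omega> (alg0 \<Omega> X) A1 (id1 \<Omega> X)"
    using iota_closed iota_add iota_scl iota_mul iota_opr iota_one
    unfolding n_hom_def carr0 by (simp add: alg0_def poly_alg_def)
  note * = eval_context[OF A1.omega_algebra_axioms this[unfolded alg0_def], folded plug_def]
  show "f \<in> carr A1 \<Longrightarrow> plug1 [Var None] f = f"
    "\<lbrakk>\<tau> \<in> \<Omega>; q \<in> ctx; f \<in> carr A1\<rbrakk> \<Longrightarrow> plug1 [Brk \<tau> q] f = opr A1 \<tau> (plug1 q f)"
    "\<lbrakk>l \<in> words; q \<in> ctx; f \<in> carr A1\<rbrakk> \<Longrightarrow> plug1 (emb l @ q) f = \<iota> (mon l) \<otimes> plug1 q f"
    "\<lbrakk>q \<in> ctx; r \<in> words; f \<in> carr A1\<rbrakk> \<Longrightarrow> plug1 (q @ emb r) f = plug1 q f \<otimes> \<iota> (mon r)"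
    using *(1)[of f] *(2)[of f \<tau> q] *(3)[of f l q] *(4)[of f q r] by blast+
qed

text \<open>The analogue of \<^const>\<open>plug\<close> on 0-cells, describing sources and targets in a context.\<close>

definition plug0 :: "('z option, 'o) word \<Rightarrow> ('z, 'o, 'k) poly \<Rightarrow> ('z, 'o, 'k) poly" where
  "plug0 q p =
     eval_word (alg0 \<Omega> X) (\<lambda>l. case l of None \<Rightarrow> p | Some z \<Rightarrow> mon [Var z]) q"

lemma plug0_simps:
  "p \<in> polys \<Longrightarrow> plug0 [Var None] p = p"
  "\<lbrakk>\<tau> \<in> \<Omega>; q \<in> ctx; p \<in> polys\<rbrakk> \<Longrightarrow> plug0 [Brk \<tau> q] p = poly_op \<tau> (plug0 q p)"
  "\<lbrakk>l \<in> words; q \<in> ctx; p \<in> polys\<rbrakk> \<Longrightarrow> plug0 (emb l @ q) p = mon l * plug0 q p"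
  "\<lbrakk>q \<in> ctx; r \<in> words; p \<in> polys\<rbrakk> \<Longrightarrow> plug0 (q @ emb r) p = plug0 q p * mon r"
proof -
  let ?A = "poly_alg \<Omega> (vars X) :: (('z, 'o, 'k) poly, 'o, 'k) n_alg"
  have hom: "n_hom 0 \<Omega> ?A ?A (\<lambda>p. p)"
    by (simp add: n_hom_def)
  have sel: "mul (alg0 \<Omega> X) = (*)" "opr (alg0 \<Omega> X) = poly_op"
    by (simp_all add: alg0_def poly_alg_sel)
  note * = eval_context[OF omega_algebra_poly_alg hom, folded alg0_def,
      folded plug0_def, unfolded carr0 sel]
  show "p \<in> polys \<Longrightarrow> plug0 [Var None] p = p"
    "\<lbrakk>\<tau> \<in> \<Omega>; q \<in> ctx; p \<in> polys\<rbrakk> \<Longrightarrow> plug0 [Brk \<tau> q] p = poly_op \<tau> (plug0 q p)"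
    "\<lbrakk>l \<in> words; q \<in> ctx; p \<in> polys\<rbrakk> \<Longrightarrow> plug0 (emb l @ q) p = mon l * plug0 q p"
    "\<lbrakk>q \<in> ctx; r \<in> words; p \<in> polys\<rbrakk> \<Longrightarrow> plug0 (q @ emb r) p = plug0 q p * mon r"
    using *(1)[of p] *(2)[of p \<tau> q] *(3)[of p l q] *(4)[of p q r] by blast+
qed

lemma plug0_closed: "\<lbrakk>q \<in> ctx; p \<in> polys\<rbrakk> \<Longrightarrow> plug0 q p \<in> polys"
  by (induction rule: contexts_induct) (simp_all add: plug0_simps polys_closed)

lemma plug0_single:
  "\<lbrakk>q \<in> ctx; u \<in> words\<rbrakk> \<Longrightarrow> plug0 q (Poly_Mapping.single u r) = Poly_Mapping.single (fill q u) r"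
  by (induction rule: contexts_induct)
    (simp_all add: plug0_simps polys_closed fill_hole fill_Brk fill_append fill_emb poly_op_single
      single_mult_mon)

lemma keys_plug0:
  "\<lbrakk>q \<in> ctx; p \<in> polys\<rbrakk> \<Longrightarrow> Poly_Mapping.keys (plug0 q p) \<subseteq> fill q ` Poly_Mapping.keys p"
proof (induction rule: contexts_induct)
  case (Brk \<tau> q)
  then show ?case using keys_poly_op[of \<tau> "plug0 q p"] by (fastforce simp: plug0_simps fill_Brk)
next
  case (left l q)
  then show ?case
    using keys_mult_mon(2)[of l "plug0 q p"] by (fastforce simp: plug0_simps fill_append fill_emb)
next
  case (right q r)
  then show ?case
    using keys_mult_mon(1)[of "plug0 q p" r] by (fastforce simp: plug0_simps fill_append fill_emb)
qed (auto simp: plug0_simps fill_hole)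

lemma arr_plug: "\<lbrakk>q \<in> ctx; arr f a b\<rbrakk> \<Longrightarrow> arr (plug1 q f) (plug0 q a) (plug0 q b)"
proof (induction rule: contexts_induct)
  case hole
  then show ?case using arrD by (simp add: plug_simps plug0_simps)
next
  case (Brk \<tau> q)
  then show ?case using arrD[OF Brk.prems] arr_opr by (simp add: plug_simps plug0_simps)
next
  case (left l q)
  then show ?case
    using arrD[OF left.prems] arr_mul[OF arr_id] polys_closed(7) by (simp add: plug_simps plug0_simps)
next
  case (right q r)
  then show ?case
    using arrD[OF right.prems] arr_mul[OF _ arr_id] polys_closed(7) by (simp add: plug_simps plug0_simps)
qed

lemma plug_closed: "\<lbrakk>q \<in> ctx; f \<in> carr A1\<rbrakk> \<Longrightarrow> plug1 q f \<in> carr A1"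
  by (induction rule: contexts_induct)
    (simp_all add: plug_simps A1.opr_closed A1.mul_closed iota_closed polys_closed)

lemma plug_add:
  "\<lbrakk>q \<in> ctx; f \<in> carr A1; g \<in> carr A1\<rbrakk> \<Longrightarrow> plug1 q (f \<oplus> g) = plug1 q f \<oplus> plug1 q g"
  by (induction rule: contexts_induct)
    (simp_all add: plug_simps plug_closed A1.add_closed A1.opr_add A1.mul_add A1.add_mul
      iota_closed polys_closed)

lemma plug_scl: "\<lbrakk>q \<in> ctx; f \<in> carr A1\<rbrakk> \<Longrightarrow> plug1 q (r \<bullet> f) = r \<bullet> plug1 q f"
  by (induction rule: contexts_induct)
    (simp_all add: plug_simps plug_closed A1.scl_closed A1.opr_scl A1.mul_scl A1.scl_mul
      iota_closed polys_closed)

lemma plug_iota: "\<lbrakk>q \<in> ctx; p \<in> polys\<rbrakk> \<Longrightarrow> plug1 q (\<iota> p) = \<iota> (plug0 q p)"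
  by (induction rule: contexts_induct)
    (simp_all add: plug_simps plug0_simps plug0_closed iota_opr iota_mul iota_closed polys_closed)

text \<open>
  Linearity on polynomials is inherited from 1-cells, as identities of different polynomials differ.
\<close>

lemma plug0_add: "\<lbrakk>q \<in> ctx; p \<in> polys; p' \<in> polys\<rbrakk> \<Longrightarrow> plug0 q (p + p') = plug0 q p + plug0 q p'"
  using iota_inject[of "plug0 q (p + p')" "plug0 q p + plug0 q p'"]
  by (simp add: plug0_closed polys_closed plug_iota[symmetric] iota_add plug_add iota_closed)

lemma plug0_smult: "\<lbrakk>q \<in> ctx; p \<in> polys\<rbrakk> \<Longrightarrow> plug0 q (smult r p) = smult r (plug0 q p)"
  using iota_inject[of "plug0 q (smult r p)" "smult r (plug0 q p)"]
  by (simp add: plug0_closed polys_closed plug_iota[symmetric] iota_scl plug_scl iota_closed)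

lemma plug_comp:
  assumes "q \<in> ctx" and f: "arr f a b" and g: "arr g b c"
  shows "plug1 q (f \<star> g) = plug1 q f \<star> plug1 q g"
  using assms(1)
proof (induction rule: contexts_induct)
  case hole
  then show ?case using arrD(1)[OF f] arrD(1)[OF g] arrD(1)[OF arr_comp[OF f g]]
    by (simp add: plug_simps)
next
  case (Brk \<tau> q)
  then show ?case
    using arrD(1)[OF f] arrD(1)[OF g] arrD(1)[OF arr_comp[OF f g]]
      comp_opr[OF Brk(1) arr_plug[OF Brk(2) f] arr_plug[OF Brk(2) g]] by (simp add: plug_simps)
next
  case (left l q)
  have l: "arr (\<iota> (mon l)) (mon l) (mon l)" using left by (intro arr_id polys_closed)
  show ?case
    using left arrD(1)[OF f] arrD(1)[OF g] arrD(1)[OF arr_comp[OF f g]] comp_units[OF l]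
      comp_mul[OF l l arr_plug[OF left(2) f] arr_plug[OF left(2) g]] by (simp add: plug_simps)
next
  case (right q r)
  have r: "arr (\<iota> (mon r)) (mon r) (mon r)" using right by (intro arr_id polys_closed)
  show ?case
    using right arrD(1)[OF f] arrD(1)[OF g] arrD(1)[OF arr_comp[OF f g]] comp_units[OF r]
      comp_mul[OF arr_plug[OF right(1) f] arr_plug[OF right(1) g] r r] by (simp add: plug_simps)
qed

lemma sim_plug:
  "\<lbrakk>q \<in> ctx; sim f g a b\<rbrakk> \<Longrightarrow> sim (plug1 q f) (plug1 q g) (plug0 q a) (plug0 q b)"
proof (induction rule: contexts_induct)
  case hole
  then show ?case using sim_arr[OF hole] by (simp add: arr_def plug_simps plug0_simps)
next
  case (Brk \<tau> q)
  then show ?case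
    using sim_arr[OF Brk.prems] sim_opr by (simp add: arr_def plug_simps plug0_simps)
next
  case (left l q)
  then show ?case
    using sim_arr[OF left.prems] sim_mul[OF sim_refl[OF arr_id]] polys_closed(7)
    by (simp add: arr_def plug_simps plug0_simps)
next
  case (right q r)
  then show ?case
    using sim_arr[OF right.prems] sim_mul[OF _ sim_refl[OF arr_id]] polys_closed(7)
    by (simp add: arr_def plug_simps plug0_simps)
qed

text \<open>
  Contexts compose, so contexts act on monomial 1-cells.
\<close>

lemma plug_plug:
  assumes "q \<in> ctx" "q' \<in> ctx"
  shows "\<exists>q''\<in>ctx. \<forall>f\<in>carr A1. plug1 q'' f = plug1 q (plug1 q' f)"
  using assms(1)
proof (induction rule: contexts_induct)
  case hole
  show ?case using assms(2) by (auto simp: plug_simps plug_closed)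
next
  case (Brk \<tau> q)
  then obtain q'' where "q'' \<in> ctx" "\<forall>f\<in>carr A1. plug1 q'' f = plug1 q (plug1 q' f)" by blast
  then show ?case using Brk(1,2) assms(2)
    by (intro bexI[of _ "[Brk \<tau> q'']"]) (auto simp: plug_simps plug_closed contexts_Brk)
next
  case (left l q)
  then obtain q'' where "q'' \<in> ctx" "\<forall>f\<in>carr A1. plug1 q'' f = plug1 q (plug1 q' f)" by blast
  then show ?case using left(1,2) assms(2)
    by (intro bexI[of _ "emb l @ q''"]) (auto simp: plug_simps plug_closed contexts_left)
next
  case (right q r)
  then obtain q'' where "q'' \<in> ctx" "\<forall>f\<in>carr A1. plug1 q'' f = plug1 q (plug1 q' f)" by blast
  then show ?case using right(1,2) assms(2)
    by (intro bexI[of _ "q'' @ emb r"]) (auto simp: plug_simps plug_closed contexts_right)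
qed

section \<open>Monomial 1-cells and rewriting steps\<close>

definition mono_cell where
  "mono_cell f u a \<longleftrightarrow> f \<in> monomials1 \<Omega> X \<and> u \<in> words \<and> arr f (mon u) a"

lemma monoD: "mono_cell f u a \<Longrightarrow> arr f (mon u) a" "mono_cell f u a \<Longrightarrow> u \<in> words"
  by (simp_all add: mono_cell_def)

lemma arr_rule:
  assumes "\<alpha> \<in> cells (rules X)"
  shows "arr (rule_cell \<Omega> X \<alpha>) (csrc (rules X) \<alpha>) (ctgt (rules X) \<alpha>)"
proof -
  let ?A = "alg0 \<Omega> X"
  note S = free_ext_simps[where n=0 and \<Omega>=\<Omega> and A="?A" and Y="rules X"]
  note g = feq.gen_wf[where n=0 and \<Omega>=\<Omega> and A="?A" and Y="rules X", OF assms]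
  have "csrc (rules X) \<alpha> \<in> polys" "ctgt (rules X) \<alpha> \<in> polys"
    using polygraph assms by (auto simp: omega_1_polygraph_def cellular_extension_def carr0)
  moreover have "rule_cell \<Omega> X \<alpha> \<in> carr A1"
    unfolding rule_cell_def alg1_def S using g by blast
  moreover have "bd A1 Src 0 (rule_cell \<Omega> X \<alpha>) = \<iota> (csrc (rules X) \<alpha>)"
    unfolding rule_cell_def alg1_def id1_def
    by (simp only: S(8)[OF le_refl g]) (rule cls_eqI[OF feq.gen_src[OF assms]])
  moreover have "bd A1 Tgt 0 (rule_cell \<Omega> X \<alpha>) = \<iota> (ctgt (rules X) \<alpha>)"
    unfolding rule_cell_def alg1_def id1_def
    by (simp only: S(8)[OF le_refl g]) (rule cls_eqI[OF feq.gen_tgt[OF assms]])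
  ultimately show ?thesis by (simp add: arr_def)
qed

lemma monomials_mono:
  assumes "f \<in> monomials1 \<Omega> X"
  shows "\<exists>u a. mono_cell f u a \<and> u \<notin> Poly_Mapping.keys a"
proof -
  obtain q \<alpha> where q: "q \<in> ctx" and \<alpha>: "\<alpha> \<in> cells (rules X)" and f: "f = plug1 q (rule_cell \<Omega> X \<alpha>)"
    using assms by (auto simp: monomials1_def)
  obtain u where u: "u \<in> words" "csrc (rules X) \<alpha> = mon u"
      "u \<notin> Poly_Mapping.keys (ctgt (rules X) \<alpha>)"
    using polygraph \<alpha> by (auto simp: omega_1_polygraph_def left_monomial_def)
  let ?a = "ctgt (rules X) \<alpha>"
  have r: "arr (rule_cell \<Omega> X \<alpha>) (mon u) ?a"
    using arr_rule[OF \<alpha>] u by simp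
  have "mono_cell f (fill q u) (plug0 q ?a)"
    using assms arr_plug[OF q r] f u plug0_single[OF q u(1)] fill_closed[OF q u(1)]
    by (simp add: mono_cell_def)
  moreover have "fill q u \<notin> Poly_Mapping.keys (plug0 q ?a)"
  proof
    assume "fill q u \<in> Poly_Mapping.keys (plug0 q ?a)"
    then obtain v where "v \<in> Poly_Mapping.keys ?a" "fill q u = fill q v"
      using keys_plug0[OF q arrD(3)[OF r]] by blast
    then show False using u(3) fill_inject[OF q, of u v] by simp
  qed
  ultimately show ?thesis by blast
qed

lemma mono_unique:
  assumes f: "mono_cell f u a" and f': "arr f p b"
  shows "p = mon u" "b = a"
  using arr_unique[OF monoD(1)[OF f] f'] by simp_all

text \<open>
  The left-monomial condition on rules persists in contexts, since filling a context is injective.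
\<close>

lemma mono_irrefl: "mono_cell f u a \<Longrightarrow> u \<notin> Poly_Mapping.keys a"
proof -
  assume f: "mono_cell f u a"
  then obtain v b where g: "mono_cell f v b" "v \<notin> Poly_Mapping.keys b"
    using monomials_mono[of f] by (auto simp: mono_cell_def)
  then have "mon v = (mon u :: ('z, 'o, 'k) poly)" "b = a" using mono_unique[OF f] monoD(1) by blast+
  moreover from this(1) have "v = u" by (metis lookup_single_eq lookup_single_not_eq zero_neq_one)
  ultimately show ?thesis using g(2) by simp
qed

lemma mono_plug:
  assumes q: "q \<in> ctx" and f: "mono_cell f u a"
  shows "mono_cell (plug1 q f) (fill q u) (plug0 q a)"
proof -
  obtain q' \<alpha> where q': "q' \<in> ctx" and \<alpha>: "\<alpha> \<in> cells (rules X)"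
      and f': "f = plug1 q' (rule_cell \<Omega> X \<alpha>)"
    using f by (auto simp: mono_cell_def monomials1_def)
  obtain q'' where "q'' \<in> ctx" "plug1 q f = plug1 q'' (rule_cell \<Omega> X \<alpha>)"
    using plug_plug[OF q q'] arrD(1)[OF arr_rule[OF \<alpha>]] f' by metis
  then have "plug1 q f \<in> monomials1 \<Omega> X"
    using \<alpha> unfolding monomials1_def by blast
  then show ?thesis
    using arr_plug[OF q monoD(1)[OF f]] plug0_single[OF q monoD(2)[OF f]]
      fill_closed[OF q monoD(2)[OF f]] by (simp add: mono_cell_def)
qed

lemma mon_inject: "mon u = (mon v :: ('z, 'o, 'k) poly) \<longleftrightarrow> u = v"
  by (metis lookup_single_eq lookup_single_not_eq zero_neq_one)

lemma has_source_mono: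
  assumes "f \<in> monomials1 \<Omega> X"
  shows "has_source \<Omega> X f u \<longleftrightarrow> (\<exists>a. mono_cell f u a)"
proof
  obtain v a where f: "mono_cell f v a" using monomials_mono[OF assms] by blast
  assume "has_source \<Omega> X f u"
  then have "u \<in> words" "\<iota> (mon u) = \<iota> (mon v)"
    using arrD(4)[OF monoD(1)[OF f]] by (simp_all add: has_source_def)
  then have "mon u = (mon v :: ('z, 'o, 'k) poly)" by (intro iota_inject polys_closed)
  then have "u = v" by (simp only: mon_inject)
  then show "\<exists>a. mono_cell f u a" using f by blast
qed (auto simp: has_source_def mono_cell_def arr_def)

definition step where
  "step F p q \<longleftrightarrow> (\<exists>r f u a c. r \<noteq> 0 \<and> mono_cell f u a \<and> c \<in> polys \<and> u \<notin> Poly_Mapping.keys c \<and>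
     F = affine r f c \<and> p = Poly_Mapping.single u r + c \<and> q = smult r a + c)"

lemma step_arr: "step F p q \<Longrightarrow> arr F p q"
  unfolding step_def using arr_affine monoD(1) by (fastforce simp: smult_algebra)

lemma rewriting_step_iff: "rewriting_step \<Omega> X F \<longleftrightarrow> (\<exists>p q. step F p q)"
proof
  assume "rewriting_step \<Omega> X F"
  then obtain r f u c where *: "r \<noteq> 0" "f \<in> monomials1 \<Omega> X" "has_source \<Omega> X f u"
      "c \<in> polys" "u \<notin> Poly_Mapping.keys c" "F = affine r f c"
    unfolding rewriting_step_def carr0 by blast
  then obtain a where "mono_cell f u a" using has_source_mono by blast
  then show "\<exists>p q. step F p q" using * unfolding step_def by blast
next
  assume "\<exists>p q. step F p q"
  then show "rewriting_step \<Omega> X F"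
    unfolding step_def rewriting_step_def carr0 using has_source_mono mono_cell_def by blast
qed

definition pos where
  "pos f p q \<longleftrightarrow> positive_cell \<Omega> X f \<and> arr f p q"

lemma pos_arr: "pos f p q \<Longrightarrow> arr f p q"
  by (simp add: pos_def)

lemma pos_id: "p \<in> polys \<Longrightarrow> pos (\<iota> p) p p"
  by (simp add: pos_def arr_id positive_cell.empty carr0)

lemma pos_snoc:
  assumes f: "pos f p q" and g: "step g q r"
  shows "pos (f \<star> g) p r"
proof -
  have "rewriting_step \<Omega> X g" using g rewriting_step_iff by blast
  then have "positive_cell \<Omega> X (f \<star> g)"
    using f step_arr[OF g] by (intro positive_cell.snoc) (auto simp: pos_def arr_def)
  then show ?thesis using arr_comp[OF pos_arr[OF f] step_arr[OF g]] by (simp add: pos_def)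
qed

lemma pos_step: "step f p q \<Longrightarrow> pos f p q"
  using pos_snoc[OF pos_id, of p f q] step_arr comp_units(1) arrD(2) by metis

text \<open>
  The two induction principles carry the source and target polynomials of positive 1-cells along:
  \<open>positive_induct\<close> produces them, \<open>pos_induct\<close> takes them as given.
\<close>

lemma positive_induct [consumes 1, case_names id snoc]:
  assumes "positive_cell \<Omega> X f"
    and "\<And>p. p \<in> polys \<Longrightarrow> P (\<iota> p) p p"
    and "\<And>f g p q r. \<lbrakk>pos f p q; P f p q; step g q r\<rbrakk> \<Longrightarrow> P (f \<star> g) p r"
  shows "\<exists>p q. pos f p q \<and> P f p q"
  using assms(1)
proof induction
  case (empty c)
  then show ?case using pos_id assms(2) carr0 by blast
next
  case (snoc f g)
  then obtain p q q' r where *: "pos f p q" "P f p q" "step g q' r"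
    using rewriting_step_iff by blast
  have "\<iota> q = \<iota> q'" using snoc(3) arrD(5)[OF pos_arr[OF *(1)]] arrD(4)[OF step_arr[OF *(3)]] by simp
  then have "q' = q" using iota_inject arrD(3)[OF pos_arr[OF *(1)]] by metis
  then show ?case using * assms(3) pos_snoc by blast
qed

lemma pos_induct [consumes 1, case_names id snoc]:
  assumes "pos f p q"
    and "\<And>p. p \<in> polys \<Longrightarrow> P (\<iota> p) p p"
    and "\<And>f g p q r. \<lbrakk>pos f p q; P f p q; step g q r\<rbrakk> \<Longrightarrow> P (f \<star> g) p r"
  shows "P f p q"
proof -
  have "positive_cell \<Omega> X f" using assms(1) by (simp add: pos_def)
  then have "\<exists>p' q'. pos f p' q' \<and> P f p' q'"
    by (rule positive_induct) (fact assms(2), fact assms(3))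
  then obtain p' q' where "pos f p' q'" "P f p' q'" by blast
  then show ?thesis using arr_unique pos_arr assms(1) by metis
qed

lemma pos_comp:
  assumes f: "pos f p q" and g: "pos g q r"
  shows "pos (f \<star> g) p r"
  using g f
proof (induction rule: pos_induct)
  case (id q)
  then show ?case using comp_units(2)[OF pos_arr] by simp
next
  case (snoc g h q r s)
  then have "f \<star> (g \<star> h) = f \<star> g \<star> h"
    using comp_assoc[OF pos_arr pos_arr step_arr] by metis
  then show ?case using pos_snoc snoc by metis
qed

text \<open>
  Positive 1-cells are generated by appending steps, while Newman's argument needs the first step.
\<close>

lemma pos_cases:
  assumes "pos f p q"
  shows "(f = \<iota> p \<and> q = p) \<or> (\<exists>s p' f'. step s p p' \<and> pos f' p' q \<and> f = s \<star> f')"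
  using assms
proof (induction rule: pos_induct)
  case (snoc f g p q r)
  from snoc.IH show ?case
  proof (elim disjE exE conjE)
    assume "f = \<iota> p" "q = p"
    then show ?thesis
      using snoc.hyps(2) comp_units[OF step_arr[OF snoc.hyps(2)]] pos_id[OF arrD(3)[OF step_arr[OF snoc.hyps(2)]]]
      by metis
  next
    fix s p' f'
    assume "step s p p'" "pos f' p' q" "f = s \<star> f'"
    then show ?thesis
      using comp_assoc[OF step_arr pos_arr step_arr] snoc.hyps(2) pos_snoc by metis
  qed
qed simp

end

section \<open>The order on monomials induced by termination\<close>

context rewriting_system
begin

definition below :: "(('z, 'o) word \<times> ('z, 'o) word) set" where
  "below = {(v, u). \<exists>f a. mono_cell f u a \<and> v \<in> Poly_Mapping.keys a}"

abbreviation less_mon (infix \<open>\<prec>\<close> 50) where "v \<prec> u \<equiv> (v, u) \<in> below\<^sup>+"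

lemma less_mon_key: "\<lbrakk>mono_cell f u a; v \<in> Poly_Mapping.keys a\<rbrakk> \<Longrightarrow> v \<prec> u"
  unfolding below_def by (blast intro: r_into_trancl)

lemma lookup_plug0:
  assumes q: "q \<in> ctx" and p: "p \<in> polys" and u: "u \<in> words"
  shows "Poly_Mapping.lookup (plug0 q p) (fill q u) = Poly_Mapping.lookup p u"
proof -
  let ?r = "Poly_Mapping.lookup p u"
  let ?p = "p - Poly_Mapping.single u ?r"
  have P: "?p \<in> polys" using p unfolding polys_def by (simp add: keys_diff_single) blast
  have "fill q u \<notin> Poly_Mapping.keys (plug0 q ?p)"
  proof
    assume "fill q u \<in> Poly_Mapping.keys (plug0 q ?p)"
    then obtain v where "v \<in> Poly_Mapping.keys ?p" "fill q u = fill q v"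
      using keys_plug0[OF q P] by blast
    then show False using fill_inject[OF q, of u v] by (simp add: keys_diff_single)
  qed
  moreover have "plug0 q p = Poly_Mapping.single (fill q u) ?r + plug0 q ?p"
    using plug0_add[OF q polys_closed(7)[OF u, of ?r] P] plug0_single[OF q u]
    by (simp only: poly_split[symmetric])
  ultimately show ?thesis by (simp add: lookup_add in_keys_iff)
qed

lemma less_mon_fill:
  assumes q: "q \<in> ctx" and "v \<prec> u"
  shows "fill q v \<prec> fill q u"
  using assms(2)
proof induction
  have one: "(fill q v, fill q u) \<in> below" if vu: "(v, u) \<in> below" for u v
  proof -
    obtain f a where f: "mono_cell f u a" "v \<in> Poly_Mapping.keys a"
      using vu by (auto simp: below_def)
    have a: "a \<in> polys" using arrD(3)[OF monoD(1)[OF f(1)]] .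
    then have "fill q v \<in> Poly_Mapping.keys (plug0 q a)" using f(2)
      using lookup_plug0[OF q a, of v] a by (auto simp: in_keys_iff polys_def)
    then show ?thesis using mono_plug[OF q f(1)] by (auto simp: below_def)
  qed
  {
    case (base u)
    then show ?case using one by (blast intro: r_into_trancl)
  next
    case (step u w)
    then show ?case using one by (blast intro: trancl_into_trancl)
  }
qed

lemma stepI:
  "\<lbrakk>r \<noteq> 0; mono_cell f u a; c \<in> polys; u \<notin> Poly_Mapping.keys c\<rbrakk>
    \<Longrightarrow> step (affine r f c) (Poly_Mapping.single u r + c) (smult r a + c)"
  unfolding step_def by blast

lemma step_target:
  assumes "mono_cell f u a" "p \<in> polys" "u \<in> Poly_Mapping.keys p"
  defines "r \<equiv> Poly_Mapping.lookup p u"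
  shows "\<exists>F. step F p (smult r a + (p - Poly_Mapping.single u r))"
proof -
  let ?c = "p - Poly_Mapping.single u r"
  have "?c \<in> polys" "u \<notin> Poly_Mapping.keys ?c"
    using assms(2) unfolding r_def polys_def by (auto simp: keys_diff_single)
  moreover have "r \<noteq> 0" using assms(3) by (simp add: r_def in_keys_iff)
  moreover have "Poly_Mapping.single u r + ?c = p" by (simp add: r_def poly_split[symmetric])
  ultimately show ?thesis using stepI[OF _ assms(1), of r ?c] by metis
qed

lemma wf_steps:
  assumes "terminating \<Omega> X"
  shows "wf {(q, p). \<exists>F. step F p q}"
  unfolding wf_iff_no_infinite_down_chain
proof
  assume "\<exists>p. \<forall>i. (p (Suc i), p i) \<in> {(q, p). \<exists>F. step F p q}"
  then obtain p where "\<forall>i. \<exists>F. step F (p i) (p (Suc i))" by auto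
  then obtain F where F: "\<And>i. step (F i) (p i) (p (Suc i))" by metis
  have "rewriting_step \<Omega> X (F i) \<and> bd A1 Tgt 0 (F i) = bd A1 Src 0 (F (Suc i))" for i
    using F[of i] F[of "Suc i"] step_arr arrD(4,5) rewriting_step_iff by metis
  then show False using assms unfolding terminating_def by blast
qed

text \<open>
  Termination is about polynomials, so an infinite descending chain of monomials does not rewrite
  at once: the monomial wanted next might have been cancelled. Suppose there are monomials
  outside the well-founded part, call them bad, and let \<open>p\<close> be a polynomial with a bad monomial
  which is minimal for rewriting. Modulo good monomials, rewriting a bad \<open>u\<close> in \<open>p\<close> with
  \<open>f: u \<rightarrow> a\<close> gives zero, whence \<open>p = r (u - a)\<close>; some bad \<open>v\<close> occurs in \<open>a\<close>, hence in \<open>p\<close>,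
  and in the same way \<open>p = s (v - b)\<close> for some \<open>g: v \<rightarrow> b\<close>. Rewriting \<open>u\<close> to \<open>a\<close> and then
  \<open>v\<close> to \<open>b\<close> therefore leads from \<open>u\<close> back to \<open>u\<close> modulo good monomials, and this can be
  repeated for ever.
\<close>

theorem wf_below:
  assumes "terminating \<Omega> X"
  shows "wf below"
proof (rule ccontr)
  assume "\<not> wf below"
  define good where "good = {u. u \<in> Wellfounded.acc below}"
  define R where "R = {(q, p). \<exists>F. step F p q}"
  have wfR: "wf R" unfolding R_def by (rule wf_steps[OF assms])
  have bad_step: "\<exists>f a v. mono_cell f u a \<and> v \<in> Poly_Mapping.keys a \<and> v \<notin> good" if "u \<notin> good" for u
  proof (rule ccontr)
    assume *: "\<not> ?thesis"
    have "u \<in> Wellfounded.acc below"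
      by (rule accI) (use * in \<open>auto simp: below_def good_def\<close>)
    then show False using that by (simp add: good_def)
  qed
  define Bad where "Bad = {p \<in> polys. \<not> Poly_Mapping.keys p \<subseteq> good}"
  have "\<exists>u. u \<notin> good"
    using \<open>\<not> wf below\<close> acc_wfI[of below] by (auto simp: good_def)
  then obtain u0 where "u0 \<notin> good" by blast
  moreover from this bad_step[of u0] have "u0 \<in> words" using monoD(2) by blast
  ultimately have "mon u0 \<in> Bad" by (simp add: Bad_def polys_closed)
  then obtain p where p: "p \<in> Bad" and min: "\<And>q. (q, p) \<in> R \<Longrightarrow> q \<notin> Bad"
    using wfE_min[OF wfR] by metis
  have P: "p \<in> polys" using p by (simp add: Bad_def)
  \<comment> \<open>\<open>p = r (u - a)\<close> modulo good monomials, because \<open>p\<close> with \<open>u\<close> rewritten has no bad ones.\<close>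
  have key: "Poly_Mapping.lookup p w =
      Poly_Mapping.lookup p u * ((if w = u then 1 else 0) - Poly_Mapping.lookup a w)"
    if u: "u \<in> Poly_Mapping.keys p" "mono_cell f u a" and w: "w \<notin> good" for u f a w
  proof -
    let ?q = "smult (Poly_Mapping.lookup p u) a + (p - Poly_Mapping.single u (Poly_Mapping.lookup p u))"
    obtain F where F: "step F p ?q" using step_target[OF u(2) P u(1)] by blast
    then have "?q \<notin> Bad" using min by (auto simp: R_def)
    moreover have "?q \<in> polys" using arrD(3)[OF step_arr[OF F]] .
    ultimately have "w \<notin> Poly_Mapping.keys ?q" using w by (auto simp: Bad_def)
    then have "Poly_Mapping.lookup ?q w = 0" by (simp add: in_keys_iff)
    then show ?thesis
      by (auto simp: lookup_add lookup_minus lookup_scale lookup_single when_def algebra_simps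
          split: if_splits)
  qed
  obtain u where u: "u \<in> Poly_Mapping.keys p" "u \<notin> good" using p by (auto simp: Bad_def)
  obtain f a v where f: "mono_cell f u a" and v: "v \<in> Poly_Mapping.keys a" "v \<notin> good"
    using bad_step[OF u(2)] by blast
  have uv: "v \<noteq> u" using mono_irrefl[OF f] v by blast
  have v': "v \<in> Poly_Mapping.keys p"
    using key[OF u(1) f v(2)] uv u(1) v(1) by (simp add: in_keys_iff)
  obtain g b where g: "mono_cell g v b" using bad_step[OF v(2)] by blast
  let ?r = "Poly_Mapping.lookup p u" and ?s = "Poly_Mapping.lookup a v"
  have r: "?r \<noteq> 0" "?s \<noteq> 0" using u v by (simp_all add: in_keys_iff)
  have s: "Poly_Mapping.lookup p v = - ?r * ?s" using key[OF u(1) f v(2)] uv by simp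
  \<comment> \<open>\<open>a + s (b - v) = u\<close> modulo good monomials, with \<open>s\<close> the coefficient of \<open>v\<close> in \<open>a\<close>.\<close>
  have loop: "?s * ((if w = v then 1 else 0) - Poly_Mapping.lookup b w) =
      Poly_Mapping.lookup a w - (if w = u then 1 else 0)" if "w \<notin> good" for w
  proof -
    have "?r * ((if w = u then 1 else 0) - Poly_Mapping.lookup a w) =
        - ?r * ?s * ((if w = v then 1 else 0) - Poly_Mapping.lookup b w)"
      using key[OF u(1) f that] key[OF v' g that] s by simp
    note eq = this
    have "?r * (Poly_Mapping.lookup a w - (if w = u then 1 else 0)) =
        - (?r * ((if w = u then 1 else 0) - Poly_Mapping.lookup a w))"
      by (simp only: right_diff_distrib minus_diff_eq)
    also have "\<dots> = ?r * (?s * ((if w = v then 1 else 0) - Poly_Mapping.lookup b w))"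
      by (simp only: eq mult_minus_left minus_minus mult.assoc)
    finally show ?thesis using r(1) by simp
  qed
  \<comment> \<open>The polynomials equal to \<open>u\<close> modulo good ones; each rewrites to another one in two steps.\<close>
  define L where "L = {q \<in> polys. \<forall>w. w \<notin> good \<longrightarrow>
      Poly_Mapping.lookup q w = (if w = u then 1 else 0)}"
  have "\<exists>q'\<in>L. (q', q) \<in> R\<^sup>+" if q: "q \<in> L" for q
  proof -
    have qu: "Poly_Mapping.lookup q u = 1" and Q: "q \<in> polys" using q u by (simp_all add: L_def)
    define q1 where "q1 = a + (q - mon u)"
    have s1: "(q1, q) \<in> R"
      using step_target[OF f Q] qu by (simp add: R_def q1_def in_keys_iff smult_algebra)
    then have Q1: "q1 \<in> polys" using arrD(3)[OF step_arr] by (auto simp: R_def)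
    have l1: "Poly_Mapping.lookup q1 w = Poly_Mapping.lookup a w" if "w \<notin> good" for w
      using q that by (auto simp: q1_def L_def lookup_add lookup_minus lookup_single when_def)
    define q2 where "q2 = smult ?s b + (q1 - Poly_Mapping.single v ?s)"
    have s2: "(q2, q1) \<in> R"
      using step_target[OF g Q1] l1[OF v(2)] r(2) by (simp add: R_def q2_def in_keys_iff)
    then have "q2 \<in> polys" using arrD(3)[OF step_arr] by (auto simp: R_def)
    moreover have "Poly_Mapping.lookup q2 w = (if w = u then 1 else 0)" if "w \<notin> good" for w
      using loop[OF that] l1[OF that]
      by (auto simp: q2_def lookup_add lookup_minus lookup_scale lookup_single when_def algebra_simps
          split: if_splits)
    ultimately have "q2 \<in> L" by (simp add: L_def)
    then show ?thesis using s1 s2 by (blast intro: trancl.intros)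
  qed
  moreover have "mon u \<in> L"
    using monoD(2)[OF f] by (auto simp: L_def polys_closed lookup_single when_def)
  ultimately show False
    using wfE_min[OF wf_trancl[OF wfR], of "mon u" L] by metis
qed

text \<open>
  A rewriting step replaces one monomial of the support by monomials below it; cancellation
  only shrinks the support.
\<close>

definition smaller :: "(('z, 'o, 'k) poly \<times> ('z, 'o, 'k) poly) set" where
  "smaller = inv_image (mult (below\<^sup>+)) (\<lambda>p. mset_set (Poly_Mapping.keys p))"

lemma wf_smaller: "terminating \<Omega> X \<Longrightarrow> wf smaller"
  unfolding smaller_def by (intro wf_inv_image wf_mult wf_trancl wf_below)

lemma smallerI:
  assumes "finite U" "U \<noteq> {}" "U \<subseteq> Poly_Mapping.keys p"
    and "\<And>v. v \<in> Poly_Mapping.keys q \<Longrightarrow> v \<in> Poly_Mapping.keys p - U \<or> (\<exists>u\<in>U. v \<prec> u)"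
  shows "(q, p) \<in> smaller"
proof -
  let ?P = "Poly_Mapping.keys p" and ?Q = "Poly_Mapping.keys q"
  let ?I = "(?P - U) \<inter> ?Q"
  have I: "finite ?I" by simp
  have P: "mset_set ?P = mset_set ?I + mset_set (?P - ?I)"
    and Q: "mset_set ?Q = mset_set ?I + mset_set (?Q - ?I)"
    by (subst mset_set_Union[symmetric]; force intro: arg_cong[of _ _ mset_set])+
  have "(mset_set ?I + mset_set (?Q - ?I), mset_set ?I + mset_set (?P - ?I)) \<in> mult (below\<^sup>+)"
  proof (rule one_step_implies_mult)
    show "mset_set (?P - ?I) \<noteq> {#}"
      using assms(2,3) by (auto simp: mset_set_empty_iff)
    show "\<forall>k\<in>#mset_set (?Q - ?I). \<exists>j\<in>#mset_set (?P - ?I). k \<prec> j"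
      using assms(3,4) by fastforce
  qed
  then show ?thesis unfolding smaller_def in_inv_image P Q .
qed

end

section \<open>Coherent zigzags\<close>

context rewriting_system
begin

lemma step_smaller: "step F p q \<Longrightarrow> (q, p) \<in> smaller"
proof -
  assume "step F p q"
  then obtain r f u a c where *: "r \<noteq> 0" "mono_cell f u a" "u \<notin> Poly_Mapping.keys c"
      "p = Poly_Mapping.single u r + c" "q = smult r a + c"
    unfolding step_def by blast
  have k: "Poly_Mapping.keys p = insert u (Poly_Mapping.keys c)"
    using * by (auto simp: in_keys_iff lookup_add lookup_single when_def split: if_splits)
  have "Poly_Mapping.keys q \<subseteq> Poly_Mapping.keys a \<union> Poly_Mapping.keys c"
    using Poly_Mapping.keys_add[of "smult r a" c] keys_smult[of r a] *(5) by blast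
  then show ?thesis
    using k *(3) less_mon_key[OF *(2)] by (intro smallerI[of "{u}"]) auto
qed

definition joined where
  "joined f g p x y \<longleftrightarrow> (\<exists>h k d. pos h x d \<and> pos k y d \<and> sim (f \<star> h) (g \<star> k) p d)"

definition conf where
  "conf p \<longleftrightarrow> (\<forall>f g x y. pos f p x \<and> pos g p y \<longrightarrow> joined f g p x y)"

text \<open>
  A 1-cell \<open>e\<close>, in general a zigzag of rewriting steps, is coherently joinable when it can be
  completed by positive 1-cells to a triangle filled by a 2-cell.
\<close>

definition joinable where
  "joinable e x y \<longleftrightarrow> arr e x y \<and> (\<exists>h k d. pos h x d \<and> pos k y d \<and> sim (e \<star> k) h x d)"

lemma joinable_id: "p \<in> polys \<Longrightarrow> joinable (\<iota> p) p p"
  unfolding joinable_def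
  by (intro conjI exI[of _ "\<iota> p"] exI[of _ p] arr_id pos_id)
    (simp_all add: comp_units[OF arr_id] sim_refl arr_id)

text \<open>
  The triangles of \<open>e\<close> and \<open>e'\<close> leave a branching of positive cells at the middle polynomial.
\<close>

lemma joinable_comp:
  assumes e: "joinable e x y" and e': "joinable e' y z" and y: "conf y"
  shows "joinable (e \<star> e') x z"
proof -
  obtain h k d where hk: "pos h x d" "pos k y d" "sim (e \<star> k) h x d" and E: "arr e x y"
    using e by (auto simp: joinable_def)
  obtain h' k' d' where hk': "pos h' y d'" "pos k' z d'" "sim (e' \<star> k') h' y d'"
      and E': "arr e' y z"
    using e' by (auto simp: joinable_def)
  obtain m m' c where m: "pos m d c" "pos m' d' c" "sim (k \<star> m) (h' \<star> m') y c"
    using y hk(2) hk'(1) unfolding conf_def joined_def by blast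
  note a = pos_arr[OF hk(1)] pos_arr[OF hk(2)] pos_arr[OF hk'(1)] pos_arr[OF hk'(2)]
    pos_arr[OF m(1)] pos_arr[OF m(2)]
  have "e \<star> e' \<star> (k' \<star> m') = e \<star> (e' \<star> k' \<star> m')"
    using comp_assoc[OF E E' arr_comp[OF a(4,6)]] comp_assoc[OF E' a(4,6)] by simp
  moreover have "sim (e \<star> (e' \<star> k' \<star> m')) (e \<star> (h' \<star> m')) x c"
    using sim_comp[OF sim_refl[OF E] sim_comp[OF hk'(3) sim_refl[OF a(6)]]] .
  moreover have "sim (e \<star> (h' \<star> m')) (e \<star> (k \<star> m)) x c"
    using sim_comp[OF sim_refl[OF E] sim_sym[OF m(3)]] .
  moreover have "e \<star> (k \<star> m) = e \<star> k \<star> m"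
    using comp_assoc[OF E a(2,5)] by simp
  moreover have "sim (e \<star> k \<star> m) (h \<star> m) x c"
    using sim_comp[OF hk(3) sim_refl[OF a(5)]] .
  ultimately have "sim (e \<star> e' \<star> (k' \<star> m')) (h \<star> m) x c"
    using sim_trans by metis
  then show ?thesis
    unfolding joinable_def
    using arr_comp[OF E E'] pos_comp[OF hk(1) m(1)] pos_comp[OF hk'(2) m(2)] by blast
qed

lemma pos_affine:
  assumes f: "mono_cell f u a" and c: "c \<in> polys" "u \<notin> Poly_Mapping.keys c"
  shows "pos (affine r f c) (Poly_Mapping.single u r + c) (smult r a + c)"
proof (cases "r = 0")
  case True
  then show ?thesis
    using pos_id[OF c(1)] affine_zero[OF arrD(1)[OF monoD(1)[OF f]] c(1)] by (simp add: smult_algebra)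
next
  case False
  then show ?thesis using pos_step[OF stepI[OF _ f c]] by blast
qed

text \<open>
  The cell \<open>r f + c\<close> need not be a rewriting step, since the source \<open>u\<close> of \<open>f\<close> may occur in
  \<open>c\<close>. If \<open>s\<close> is the coefficient of \<open>u\<close> in \<open>c\<close>, the steps which rewrite all of \<open>(r + s) u\<close> at the
  source, and the remaining \<open>s u\<close> at the target, form a commuting triangle with it.
\<close>

lemma joinable_affine:
  assumes f: "mono_cell f u a" and c: "c \<in> polys"
  shows "joinable (affine r f c) (Poly_Mapping.single u r + c) (smult r a + c)"
proof -
  let ?s = "Poly_Mapping.lookup c u"
  let ?c = "c - Poly_Mapping.single u ?s"
  note F = monoD(1)[OF f]
  have A: "a \<in> polys" by (rule arrD(3)[OF F])
  have c0: "?c \<in> polys" "u \<notin> Poly_Mapping.keys ?c"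
    using c unfolding polys_def by (auto simp: keys_diff_single)
  have cs: "smult ?s (mon u) + ?c = c"
    by (simp add: smult_algebra poly_split[symmetric])
  have "u \<notin> Poly_Mapping.keys (smult r a + ?c)"
    using Poly_Mapping.keys_add[of "smult r a" ?c] keys_smult[of r a] c0(2) mono_irrefl[OF f] by blast
  then have k: "pos (affine ?s f (smult r a + ?c)) (smult r a + c)
      (smult ?s a + (smult r a + ?c))"
    using pos_affine[OF f _ , of "smult r a + ?c" ?s] polys_closed(3)[OF polys_closed(4)[OF A] c0(1)]
      cs by (simp add: smult_algebra add.left_commute)
  have h: "pos (affine (r + ?s) f ?c) (Poly_Mapping.single u r + c) (smult (r + ?s) a + ?c)"
    using pos_affine[OF f c0, of "r + ?s"] cs
    by (simp add: smult_algebra single_add add.assoc)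
  have t: "smult (r + ?s) a + ?c = smult ?s a + (smult r a + ?c)"
    by (simp add: smult_algebra(2) algebra_simps)
  have "affine r f c \<star> affine ?s f (smult r a + ?c) = affine (r + ?s) f ?c"
    using affine_same[OF F c0(1), of r ?s] by (simp only: cs)
  then show ?thesis
    unfolding joinable_def
    using arr_affine[OF F c, of r] h k sim_refl[OF pos_arr[OF h]]
    by (simp add: smult_algebra(7) t) metis
qed

text \<open>
  \<open>zigzag W\<close> consists of the linear combinations and composites of monomial 1-cells with source
  below \<open>W\<close>. These cells are stable under contexts, have
  inverses, and never leave the polynomials to which an induction hypothesis below \<open>W\<close> applies.
\<close>

inductive zigzag for W where
  ident: "\<lbrakk>p \<in> polys; \<forall>v\<in>Poly_Mapping.keys p. v \<prec> W\<rbrakk> \<Longrightarrow> zigzag W (\<iota> p) p p"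
| cell: "\<lbrakk>mono_cell f u a; u \<prec> W\<rbrakk> \<Longrightarrow> zigzag W f (mon u) a"
| scale: "zigzag W e x y \<Longrightarrow> zigzag W (r \<bullet> e) (smult r x) (smult r y)"
| plus: "\<lbrakk>zigzag W e x y; zigzag W e' x' y'\<rbrakk> \<Longrightarrow> zigzag W (e \<oplus> e') (x + x') (y + y')"
| comp: "\<lbrakk>zigzag W e x y; zigzag W e' y z\<rbrakk> \<Longrightarrow> zigzag W (e \<star> e') x z"

lemma keys_smult_less:
  "\<forall>v\<in>Poly_Mapping.keys p. Q v \<Longrightarrow> \<forall>v\<in>Poly_Mapping.keys (smult r p). Q v"
  using keys_smult[of r p] by blast

lemma keys_add_less:
  "\<lbrakk>\<forall>v\<in>Poly_Mapping.keys p. Q v; \<forall>v\<in>Poly_Mapping.keys q. Q v\<rbrakk>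
    \<Longrightarrow> \<forall>v\<in>Poly_Mapping.keys (p + q). Q v"
  using Poly_Mapping.keys_add[of p q] by blast

lemma zigzag_arr: "zigzag W e x y \<Longrightarrow> arr e x y"
  by (induction rule: zigzag.induct) (auto intro: arr_id monoD arr_scl arr_add arr_comp)

lemma zigzag_keys:
  "zigzag W e x y \<Longrightarrow>
    (\<forall>v\<in>Poly_Mapping.keys x. v \<prec> W) \<and> (\<forall>v\<in>Poly_Mapping.keys y. v \<prec> W)"
proof (induction rule: zigzag.induct)
  case (cell f u a)
  then show ?case using trancl_trans[OF less_mon_key[OF cell(1)] cell(2)] by auto
next
  case (scale e x y r)
  show ?case
    by (intro conjI keys_smult_less scale.IH[THEN conjunct1] scale.IH[THEN conjunct2])
next
  case (plus e x y e' x' y')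
  show ?case
    by (intro conjI keys_add_less plus.IH[THEN conjunct1] plus.IH[THEN conjunct2])
qed simp_all

lemma zigzag_affine:
  "\<lbrakk>zigzag W e x y; c \<in> polys; \<forall>v\<in>Poly_Mapping.keys c. v \<prec> W\<rbrakk>
    \<Longrightarrow> zigzag W (affine r e c) (smult r x + c) (smult r y + c)"
  unfolding lin_def by (intro zigzag.plus zigzag.scale zigzag.ident)

lemma zigzag_inv: 
  assumes "zigzag W e x y"
  shows "zigzag W (inv1 e x y) y x"
proof -
  note a = zigzag_arr[OF assms]
  have "zigzag W (inv1 e x y) (smult (- 1) x + (x + y)) (smult (- 1) y + (x + y))"
    unfolding inv1_def using zigzag_keys[OF assms] arrD(2,3)[OF a]
    by (intro zigzag_affine assms polys_closed(3) keys_add_less) auto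
  then show ?thesis using zigzag_arr arr_inv1[OF a] arr_unique by metis
qed

lemma zigzag_plug:
  assumes q: "q \<in> ctx" and "zigzag W e x y"
  shows "zigzag (fill q W) (plug1 q e) (plug0 q x) (plug0 q y)"
  using assms(2)
proof (induction rule: zigzag.induct)
  case (ident p)
  then show ?case
    using keys_plug0[OF q ident(1)] less_mon_fill[OF q]
    by (auto simp: plug_iota[OF q] plug0_closed[OF q] intro!: zigzag.ident)
next
  case (cell f u a)
  then show ?case
    using zigzag.cell[OF mono_plug[OF q cell(1)] less_mon_fill[OF q cell(2)]]
    by (simp add: plug0_single[OF q monoD(2)])
next
  case (scale e x y r)
  then show ?case
    using zigzag.scale arrD[OF zigzag_arr[OF scale(1)]]
    by (simp add: plug_scl[OF q] plug0_smult[OF q])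
next
  case (plus e x y e' x' y')
  then show ?case
    using zigzag.plus arrD[OF zigzag_arr[OF plus(1)]] arrD[OF zigzag_arr[OF plus(2)]]
    by (simp add: plug_add[OF q] plug0_add[OF q])
next
  case (comp e x y e' z)
  then show ?case
    using zigzag.comp plug_comp[OF q zigzag_arr[OF comp(1)] zigzag_arr[OF comp(2)]] by simp
qed

lemma zigzag_pos:
  "\<lbrakk>pos h x d; \<forall>v\<in>Poly_Mapping.keys x. v \<prec> W\<rbrakk> \<Longrightarrow> zigzag W h x d"
proof (induction rule: pos_induct)
  case (id p)
  then show ?case by (intro zigzag.ident) auto
next
  case (snoc f g p q r)
  then have z: "zigzag W f p q" by blast
  obtain s g' u a c where *: "s \<noteq> 0" "mono_cell g' u a" "c \<in> polys" "u \<notin> Poly_Mapping.keys c"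
      "g = affine s g' c" "q = Poly_Mapping.single u s + c" "r = smult s a + c"
    using snoc.hyps(2) unfolding step_def by blast
  have k: "Poly_Mapping.keys q = insert u (Poly_Mapping.keys c)"
    using * by (auto simp: in_keys_iff lookup_add lookup_single when_def split: if_splits)
  have "zigzag W g (smult s (mon u) + c) r"
    unfolding *(5,7) using *(2,3) zigzag_keys[OF z] k by (intro zigzag_affine zigzag.cell) auto
  then show ?case using z zigzag.comp *(6) by (simp add: smult_algebra)
qed

text \<open>
  Sums become composites by applying the summands one after the other. All intermediate
  polynomials are supported on \<open>c\<close> and on monomials below \<open>W\<close>, so that confluence at these
  polynomials suffices for pasting the triangles of the elementary cells. The scalar \<open>r\<close> and the
  polynomial \<open>c\<close> vary in the induction, as a summand sees the rest of the sum as part of \<open>c\<close>.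
\<close>

lemma zigzag_joinable:
  assumes "zigzag W e x y" and c: "c \<in> polys"
    and conf: "\<And>p. \<lbrakk>p \<in> polys; \<forall>v\<in>Poly_Mapping.keys p. v \<in> Poly_Mapping.keys c \<or> v \<prec> W\<rbrakk> \<Longrightarrow> conf p"
  shows "joinable (affine r e c) (smult r x + c) (smult r y + c)"
proof -
  let ?Q = "\<lambda>v. v \<in> Poly_Mapping.keys c \<or> v \<prec> W"
  have "joinable (affine r e c') (smult r x + c') (smult r y + c')"
    if "c' \<in> polys" "\<forall>v\<in>Poly_Mapping.keys c'. ?Q v" for c' r
    using assms(1) that
  proof (induction arbitrary: c' r rule: zigzag.induct)
    case (ident p)
    then have "affine r (\<iota> p) c' = \<iota> (smult r p + c')"
      by (simp add: lin_def iota_add iota_scl polys_closed)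
    then show ?case using ident joinable_id polys_closed(3,4) by simp
  next
    case (cell f u a)
    then show ?case using joinable_affine[of f u a c' r] by (simp add: smult_algebra)
  next
    case (scale e x y s)
    have "affine r (s \<bullet> e) c' = affine (r * s) e c'"
      using arrD(1)[OF zigzag_arr[OF scale(1)]] by (simp add: lin_def A1.scl_scl)
    then show ?case using scale(2)[OF scale(3,4), of "r * s"] by (simp add: smult_algebra)
  next
    case (plus e x y e' x' y')
    note A = zigzag_arr[OF plus(1)] and A' = zigzag_arr[OF plus(2)]
    note a = arrD[OF A] and a' = arrD[OF A']
    have K: "\<forall>v\<in>Poly_Mapping.keys x'. ?Q v" "\<forall>v\<in>Poly_Mapping.keys y. ?Q v"
      using zigzag_keys[OF plus(1)] zigzag_keys[OF plus(2)] by simp_all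
    have Q: "\<forall>v\<in>Poly_Mapping.keys (smult r x' + c'). ?Q v"
        "\<forall>v\<in>Poly_Mapping.keys (smult r y + c'). ?Q v"
        "\<forall>v\<in>Poly_Mapping.keys (smult r y + (smult r x' + c')). ?Q v"
      by (intro keys_smult_less[where Q="?Q"] keys_add_less[where Q="?Q"] K plus.prems(2))+
    have P: "smult r x' + c' \<in> polys" "smult r y + c' \<in> polys"
        "smult r y + (smult r x' + c') \<in> polys"
      by (intro polys_closed(3,4) a(2,3) a'(2,3) plus.prems(1))+
    have "affine r (e \<oplus> e') c' = affine r e (smult r x' + c') \<star> affine r e' (smult r y + c')"
      unfolding affine_comp[OF A A' plus.prems(1)] unfolding lin_def
      using a(1) a'(1) plus.prems(1)
      by (simp add: A1.scl_add A1.add_assoc A1.scl_closed iota_closed)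
    moreover have "joinable (affine r e (smult r x' + c')) (smult r x + (smult r x' + c'))
        (smult r y + (smult r x' + c'))"
      by (rule plus.IH(1)[OF P(1) Q(1)])
    moreover have "joinable (affine r e' (smult r y + c')) (smult r y + (smult r x' + c'))
        (smult r y' + (smult r y + c'))"
      using plus.IH(2)[OF P(2) Q(2), of r] by (simp only: add.left_commute)
    ultimately have "joinable (affine r (e \<oplus> e') c') (smult r x + (smult r x' + c'))
        (smult r y' + (smult r y + c'))"
      using joinable_comp conf[OF P(3) Q(3)] by metis
    then show ?case by (simp only: smult_algebra(1) add.assoc add.left_commute)
  next
    case (comp e x y e' z)
    note A = zigzag_arr[OF comp(1)] and A' = zigzag_arr[OF comp(2)]
    have "conf (smult r y + c')"
      using zigzag_keys[OF comp(1)]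
      by (intro conf keys_add_less[where Q="?Q"] keys_smult_less[where Q="?Q"] comp.prems
          polys_closed(3,4) arrD(3)[OF A]) simp
    then show ?case
      using joinable_comp comp.IH(1)[OF comp.prems, of r] comp.IH(2)[OF comp.prems, of r]
        comp_affine[OF A A' comp.prems(1), of r] by metis
  qed
  then show ?thesis using c by blast
qed

end

section \<open>Resolution of branchings at a single monomial\<close>

context rewriting_system
begin

text \<open>
  The form in which confluence of a branching of monomial 1-cells can be transported: the
  positive cells closing it are replaced by a zigzag, since positivity is lost when a multiple of a
  cell is added to a polynomial, whereas zigzags are stable under all operations.
\<close>

definition resolved where
  "resolved f g W \<longleftrightarrow> (\<exists>a b e. arr f (mon W) a \<and> zigzag W e a b \<and> sim (f \<star> e) g (mon W) b)"

lemma resolved_refl: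
  assumes "mono_cell f W a"
  shows "resolved f f W"
proof -
  note f = monoD(1)[OF assms]
  have "zigzag W (\<iota> a) a a"
    using arrD(3)[OF f] less_mon_key[OF assms] by (intro zigzag.ident) auto
  then show ?thesis
    using f sim_refl[OF f] comp_units(2)[OF f] unfolding resolved_def by metis
qed

lemma resolved_sym:
  assumes "resolved f g W"
  shows "resolved g f W"
proof -
  obtain a b e where *: "arr f (mon W) a" "zigzag W e a b" "sim (f \<star> e) g (mon W) b"
    using assms by (auto simp: resolved_def)
  note e = zigzag_arr[OF *(2)] and e' = arr_inv1[OF zigzag_arr[OF *(2)]]
  have "sim (g \<star> inv1 e a b) (f \<star> e \<star> inv1 e a b) (mon W) a"
    by (intro sim_comp[OF sim_sym[OF *(3)]] sim_refl e')
  moreover have "f \<star> e \<star> inv1 e a b = f"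
    using comp_assoc[OF *(1) e e'] comp_inv1(1)[OF e] comp_units(2)[OF *(1)] by simp
  ultimately show ?thesis
    using zigzag_inv[OF *(2)] sim_arr(2)[OF *(3)] unfolding resolved_def by metis
qed

lemma resolved_plug:
  assumes q: "q \<in> ctx" and W: "W \<in> words" and "resolved f g W"
  shows "resolved (plug1 q f) (plug1 q g) (fill q W)"
proof -
  obtain a b e where *: "arr f (mon W) a" "zigzag W e a b" "sim (f \<star> e) g (mon W) b"
    using assms by (auto simp: resolved_def)
  have "sim (plug1 q f \<star> plug1 q e) (plug1 q g) (mon (fill q W)) (plug0 q b)"
    using sim_plug[OF q *(3)] plug_comp[OF q *(1) zigzag_arr[OF *(2)]] plug0_single[OF q W]
    by simp
  then show ?thesis
    using arr_plug[OF q *(1)] zigzag_plug[OF q *(2)] plug0_single[OF q W]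
    unfolding resolved_def by metis
qed

text \<open>
  A linear map which sends the monomials of \<open>p\<close> to zigzags sends \<open>p\<close> to a zigzag. The end points
  are left implicit, being determined by the 1-cell.
\<close>

lemma zigzag_linear:
  assumes add: "\<And>p p'. \<lbrakk>p \<in> polys; p' \<in> polys\<rbrakk> \<Longrightarrow> M (p + p') = M p \<oplus> M p'"
    and scl: "\<And>p r. p \<in> polys \<Longrightarrow> M (smult r p) = r \<bullet> M p"
    and car: "\<And>p. p \<in> polys \<Longrightarrow> M p \<in> carr A1"
    and "p \<in> polys" and "\<And>w. w \<in> Poly_Mapping.keys p \<Longrightarrow> \<exists>x y. zigzag W (M (mon w)) x y"
  shows "\<exists>x y. zigzag W (M p) x y"
  using assms(4,5)
proof (induction "card (Poly_Mapping.keys p)" arbitrary: p)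
  case 0
  then have "p = 0" by simp
  then have "M p = \<iota> 0"
    using scl[of 0 0] scl_zero[OF car[of 0]] polys_closed(1) by (simp add: smult_algebra iota_zero)
  then show ?case using zigzag.ident[of 0 W] polys_closed(1) by auto
next
  case (Suc n)
  then obtain w where w: "w \<in> Poly_Mapping.keys p" by fastforce
  let ?r = "Poly_Mapping.lookup p w"
  let ?p = "p - Poly_Mapping.single w ?r"
  have P: "?p \<in> polys" "mon w \<in> polys"
    using Suc.prems(1) w unfolding polys_def by (auto simp: keys_diff_single)
  have "\<exists>x y. zigzag W (M ?p) x y"
  proof (rule Suc.hyps(1)[OF _ P(1)])
    show "n = card (Poly_Mapping.keys ?p)" using Suc.hyps(2) w by (simp add: keys_diff_single)
    show "\<exists>x y. zigzag W (M (mon v)) x y" if "v \<in> Poly_Mapping.keys ?p" for v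
      using Suc.prems(2)[of v] that by (simp only: keys_diff_single Diff_iff)
  qed
  then obtain x y where xy: "zigzag W (M ?p) x y" by blast
  obtain x' y' where xy': "zigzag W (M (mon w)) x' y'" using Suc.prems(2)[OF w] by blast
  have "M p = ?r \<bullet> M (mon w) \<oplus> M ?p"
    using add[OF polys_closed(4)[OF P(2)] P(1), of ?r] scl[OF P(2), of ?r]
    by (simp add: smult_algebra(7) poly_split[symmetric])
  then show ?case using zigzag.plus[OF zigzag.scale[OF xy'] xy] by metis
qed

text \<open>
  The two cells of a Peiffer branching commute by the exchange law, which closes the branching by
  \<open>a g\<close> and \<open>f b\<close>. These are not monomial 1-cells, but they are linear combinations of monomial
  1-cells with a source below \<open>u v\<close>.
\<close>

lemma resolved_product:
  assumes f: "mono_cell f u a" and g: "mono_cell g v b"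
  shows "resolved (f \<otimes> \<iota> (mon v)) (\<iota> (mon u) \<otimes> g) (u @ v)"
proof -
  note F = monoD(1)[OF f] and G = monoD(1)[OF g]
  note uv = monoD(2)[OF f] monoD(2)[OF g]
  note I = arr_id[OF arrD(2)[OF F]] arr_id[OF arrD(3)[OF F]] arr_id[OF arrD(2)[OF G]]
    arr_id[OF arrD(3)[OF G]]
  have right_ctx: "[Var None] @ emb w \<in> ctx" and left_ctx: "emb w @ [Var None] \<in> ctx"
    if "w \<in> words" for w
    using that contexts_hole by (blast intro: contexts_left contexts_right)+
  have right: "plug1 ([Var None] @ emb w) k = k \<otimes> \<iota> (mon w)" "fill ([Var None] @ emb w) x = x @ w"
    and left: "plug1 (emb w @ [Var None]) k = \<iota> (mon w) \<otimes> k" "fill (emb w @ [Var None]) x = w @ x"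
    if "w \<in> words" "k \<in> carr A1" for w k x
    using that contexts_hole[of \<Omega> "vars X"]
    by (simp_all only: plug_simps fill_append fill_hole fill_emb[OF that(1)])
  have "\<exists>x y. zigzag (u @ v) (\<iota> a \<otimes> g) x y"
  proof (rule zigzag_linear[where M="\<lambda>p. \<iota> p \<otimes> g"])
    fix w assume w: "w \<in> Poly_Mapping.keys a"
    then have W: "w \<in> words" using arrD(3)[OF F] by (auto simp: polys_def)
    have "w @ v \<prec> u @ v"
      using less_mon_fill[OF right_ctx[OF uv(2)] less_mon_key[OF f w]]
      by (simp only: right(2)[OF uv(2) arrD(1)[OF F]])
    then show "\<exists>x y. zigzag (u @ v) (\<iota> (mon w) \<otimes> g) x y"
      using mono_plug[OF left_ctx[OF W] g] zigzag.cell left[OF W arrD(1)[OF G]] by metis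
  qed (use arrD[OF F] arrD[OF G] in \<open>simp_all add: iota_add iota_scl A1.add_mul A1.scl_mul
      A1.mul_closed iota_closed\<close>)
  then have z1: "zigzag (u @ v) (\<iota> a \<otimes> g) (a * mon v) (a * b)"
    using zigzag_arr arr_unique arr_mul[OF I(2) G] by metis
  have "\<exists>x y. zigzag (u @ v) (f \<otimes> \<iota> b) x y"
  proof (rule zigzag_linear[where M="\<lambda>p. f \<otimes> \<iota> p"])
    fix w assume w: "w \<in> Poly_Mapping.keys b"
    then have W: "w \<in> words" using arrD(3)[OF G] by (auto simp: polys_def)
    have "u @ w \<prec> u @ v"
      using less_mon_fill[OF left_ctx[OF uv(1)] less_mon_key[OF g w]]
      by (simp only: left(2)[OF uv(1) arrD(1)[OF F]])
    then show "\<exists>x y. zigzag (u @ v) (f \<otimes> \<iota> (mon w)) x y"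
      using mono_plug[OF right_ctx[OF W] f] zigzag.cell right[OF W arrD(1)[OF F]] by metis
  qed (use arrD[OF F] arrD[OF G] in \<open>simp_all add: iota_add iota_scl A1.mul_add A1.mul_scl
      A1.mul_closed iota_closed\<close>)
  then have z2: "zigzag (u @ v) (f \<otimes> \<iota> b) (mon u * b) (a * b)"
    using zigzag_arr arr_unique arr_mul[OF F I(4)] by metis
  let ?k = "inv1 (f \<otimes> \<iota> b) (mon u * b) (a * b)"
  have m: "mon u * mon v = (mon (u @ v) :: ('z, 'o, 'k) poly)"
    by (simp add: single_mult_mon)
  note f1 = arr_mul[OF F I(3), unfolded m] and g1 = arr_mul[OF I(1) G, unfolded m]
  note e1 = zigzag_arr[OF z1] and e2 = zigzag_arr[OF z2]
  have "f \<otimes> \<iota> (mon v) \<star> (\<iota> a \<otimes> g) = f \<otimes> g"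
    using comp_mul[OF F I(2) I(3) G] comp_units[OF F] comp_units[OF G] by simp
  moreover have "\<iota> (mon u) \<otimes> g \<star> (f \<otimes> \<iota> b) = f \<otimes> g"
    using comp_mul[OF I(1) F G I(4)] comp_units[OF F] comp_units[OF G] by simp
  ultimately have "f \<otimes> \<iota> (mon v) \<star> (\<iota> a \<otimes> g \<star> ?k) = \<iota> (mon u) \<otimes> g"
    using comp_assoc[OF f1 e1 arr_inv1[OF e2]] comp_assoc[OF g1 e2 arr_inv1[OF e2]]
      comp_inv1(1)[OF e2] comp_units(2)[OF g1] by simp
  then show ?thesis
    using f1 zigzag.comp[OF z1 zigzag_inv[OF z2]] sim_refl[OF g1] unfolding resolved_def by metis
qed

lemma single_eq_mon:
  assumes "r \<noteq> 0" "w \<notin> Poly_Mapping.keys c"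
    and "Poly_Mapping.single w r + c = (mon W :: ('z, 'o, 'k) poly)"
  shows "w = W" "r = 1" "c = 0"
proof -
  have l: "Poly_Mapping.lookup (Poly_Mapping.single w r + c) x = Poly_Mapping.lookup (mon W :: ('z, 'o, 'k) poly) x" for x
    using assms(3) by simp
  show w: "w = W"
    using l[of w] assms(1,2)
    by (auto simp: lookup_add lookup_single when_def in_keys_iff split: if_splits)
  show r: "r = 1"
    using l[of w] assms(2) w by (simp add: lookup_add lookup_single in_keys_iff)
  show "c = 0" using assms(3) w r by simp
qed

text \<open>
  Since its source is the single monomial \<open>W\<close>, such a branching has scalar \<open>1\<close> and no additional
  polynomial, and is the image of a branching of \<open>f v\<close> and \<open>u g\<close> under two contexts.
\<close>

lemma peiffer_resolved:
  assumes P: "peiffer_branching \<Omega> X F G" and F: "arr F (mon W) a"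
  shows "resolved F G W"
proof -
  obtain r f g u v q \<tau> c where
    f: "f \<in> monomials1 \<Omega> X" "has_source \<Omega> X f u" and g: "g \<in> monomials1 \<Omega> X" "has_source \<Omega> X g v"
    and q: "q \<in> ctx" and \<tau>: "set_option \<tau> \<subseteq> \<Omega>" and r: "r \<noteq> 0" and c: "c \<in> polys"
    and k: "fill q (brk \<tau> (u @ v)) \<notin> Poly_Mapping.keys c"
    and FG: "F = affine r (plug1 q (opr0 A1 \<tau> (f \<otimes> \<iota> (mon v)))) c"
      "G = affine r (plug1 q (opr0 A1 \<tau> (\<iota> (mon u) \<otimes> g))) c"
    using P unfolding peiffer_branching_def carr0 by blast
  obtain a' b' where f': "mono_cell f u a'" and g': "mono_cell g v b'"
    using f g has_source_mono by blast
  have uv: "u \<in> words" "v \<in> words" "u @ v \<in> words"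
    using monoD(2)[OF f'] monoD(2)[OF g'] by (simp_all add: append_omega_monoid)
  let ?t = "brk \<tau> [Var None]"
  have t: "?t \<in> ctx" using contexts_brk[OF contexts_hole \<tau>] .
  have fill_t: "fill ?t w = brk \<tau> w" for w :: "('z, 'o) word"
    by (cases \<tau>) (simp_all add: brk_def fill_hole fill_Brk)
  have plug_t: "plug1 ?t x = opr0 A1 \<tau> x" if "x \<in> carr A1" for x
    using that \<tau> contexts_hole[of \<Omega> "vars X"]
    by (cases \<tau>) (simp_all add: brk_def opr0_def plug_simps)
  have "resolved (plug1 q (plug1 ?t (f \<otimes> \<iota> (mon v)))) (plug1 q (plug1 ?t (\<iota> (mon u) \<otimes> g)))
      (fill q (fill ?t (u @ v)))"
    using resolved_product[OF f' g'] q t uv(3) fill_closed[OF t] by (intro resolved_plug) auto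
  moreover have "f \<otimes> \<iota> (mon v) \<in> carr A1" "\<iota> (mon u) \<otimes> g \<in> carr A1"
    using arrD(1)[OF monoD(1)[OF f']] arrD(1)[OF monoD(1)[OF g']] uv
    by (auto intro: A1.mul_closed iota_closed polys_closed)
  ultimately have res: "resolved (plug1 q (opr0 A1 \<tau> (f \<otimes> \<iota> (mon v))))
      (plug1 q (opr0 A1 \<tau> (\<iota> (mon u) \<otimes> g))) (fill q (brk \<tau> (u @ v)))"
    by (simp add: plug_t fill_t)
  then obtain x y where x: "arr (plug1 q (opr0 A1 \<tau> (f \<otimes> \<iota> (mon v)))) (mon (fill q (brk \<tau> (u @ v)))) x"
    and y: "arr (plug1 q (opr0 A1 \<tau> (\<iota> (mon u) \<otimes> g))) (mon (fill q (brk \<tau> (u @ v)))) y"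
    unfolding resolved_def using sim_arr(2) by blast
  have "Poly_Mapping.single (fill q (brk \<tau> (u @ v))) r + c = mon W"
    using arr_unique[OF F, of "smult r (mon (fill q (brk \<tau> (u @ v)))) + c"]
      arr_affine[OF x c, of r] FG(1) by (simp add: smult_algebra)
  note * = single_eq_mon[OF r k this]
  then show ?thesis
    using res arrD(1)[OF x] arrD(1)[OF y] FG by (simp add: affine_trivial)
qed

text \<open>The source of an additive branching has at least two monomials.\<close>

lemma not_additive:
  assumes F: "arr F (mon W) a"
  shows "\<not> additive_branching \<Omega> X F G"
proof
  assume "additive_branching \<Omega> X F G"
  then obtain r r' f u v c where f: "f \<in> monomials1 \<Omega> X" "has_source \<Omega> X f u"
    and *: "r \<noteq> 0" "r' \<noteq> 0" "u \<noteq> v" "c \<in> polys" "u \<notin> Poly_Mapping.keys c" "v \<notin> Poly_Mapping.keys c"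
    and v: "v \<in> words" and FG: "F = affine r f (Poly_Mapping.single v r' + c)"
    unfolding additive_branching_def carr0 has_source_def by blast
  obtain b where "mono_cell f u b" using f has_source_mono by blast
  then have "arr F (smult r (mon u) + (Poly_Mapping.single v r' + c))
      (smult r b + (Poly_Mapping.single v r' + c))"
    unfolding FG using * v by (intro arr_affine monoD(1) polys_closed)
  then have "Poly_Mapping.single u r + (Poly_Mapping.single v r' + c) = mon W"
    using arr_unique[OF F] by (simp add: smult_algebra)
  then have l: "Poly_Mapping.lookup (Poly_Mapping.single u r + (Poly_Mapping.single v r' + c)) x =
      Poly_Mapping.lookup (mon W :: ('z, 'o, 'k) poly) x" for x
    by simp
  have "u = W" "v = W"
    using l[of u] l[of v] * by (auto simp: lookup_add lookup_single when_def in_keys_iff split: if_splits)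
  then show False using *(3) by simp
qed

lemma positive_pos:
  assumes "positive_cell \<Omega> X h" "bd A1 Src 0 h = \<iota> p" "p \<in> polys"
  shows "\<exists>q. pos h p q"
proof -
  have "\<exists>p' q. pos h p' q \<and> True"
    using assms(1) by (rule positive_induct) simp_all
  then obtain p' q where h: "pos h p' q" by blast
  then have "\<iota> p = \<iota> p'" using assms(2) arrD(4)[OF pos_arr[OF h]] by simp
  then have "p = p'" by (rule iota_inject[OF assms(3)])
  then show ?thesis using h by blast
qed

text \<open>
  Induction on the size of \<open>W\<close>: a pair of cells with source \<open>W\<close> which is not critical although it is
  overlapping is the image under a proper context of a pair with a smaller source.
\<close>

theorem monomials_resolved:
  assumes crit: "critically_confluent \<Omega> X Y"
    and "mono_cell f W a" "mono_cell g W b"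
  shows "resolved f g W"
  using assms(2,3)
proof (induction "weight W" arbitrary: W f g a b rule: less_induct)
  case less
  note F = monoD(1)[OF less.prems(1)] and G = monoD(1)[OF less.prems(2)]
  have mem: "f \<in> monomials1 \<Omega> X" "g \<in> monomials1 \<Omega> X"
    using less.prems by (simp_all add: mono_cell_def)
  have src: "has_source \<Omega> X f W" "has_source \<Omega> X g W"
    using less.prems mem has_source_mono by blast+
  consider "f = g" | "peiffer_branching \<Omega> X f g" | "peiffer_branching \<Omega> X g f"
    | "f \<noteq> g" "\<not> peiffer_branching \<Omega> X f g" "\<not> peiffer_branching \<Omega> X g f" by blast
  then show ?case
  proof cases
    case 1
    then show ?thesis using resolved_refl less.prems(1) by blast
  next
    case 2
    then show ?thesis using peiffer_resolved F by blast
  next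
    case 3
    then show ?thesis using peiffer_resolved resolved_sym G by blast
  next
    case 4
    have over: "overlapping_branching \<Omega> X 1 0 f g"
      unfolding overlapping_branching_def
      by (intro exI[of _ f] exI[of _ g] exI[of _ W] conjI mem src 4 not_additive[OF F])
        (use 4 affine_trivial arrD(1)[OF F] arrD(1)[OF G] polys_closed(1) carr0
          in \<open>auto simp: aspherical_branching_def\<close>)
    show ?thesis
    proof (cases "critical_branching \<Omega> X f g")
      case True
      then obtain h k D where *: "positive_cell \<Omega> X h" "positive_cell \<Omega> X k"
        "bd A1 Tgt 0 f = bd A1 Src 0 h" "bd A1 Tgt 0 g = bd A1 Src 0 k"
        "bd A1 Tgt 0 h = bd A1 Tgt 0 k" "D \<in> carr A2" "bd A2 Src 1 D = two (f \<star> h)"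
        "bd A2 Tgt 1 D = two (g \<star> k)"
        using crit unfolding critically_confluent_def confluent_branching_def by blast
      obtain d where h: "pos h a d"
        using positive_pos[OF *(1)] *(3) arrD[OF F] by metis
      obtain d' where k': "pos k b d'"
        using positive_pos[OF *(2)] *(4) arrD[OF G] by metis
      have "\<iota> d = \<iota> d'" using *(5) arrD(5)[OF pos_arr[OF h]] arrD(5)[OF pos_arr[OF k']] by simp
      then have k: "pos k b d" using k' iota_inject[OF arrD(3)[OF pos_arr[OF h]]] by blast
      note H = pos_arr[OF h] and K = pos_arr[OF k]
      have s: "sim (f \<star> h) (g \<star> k) (mon W) d"
        unfolding sim_def using arr_comp[OF F H] arr_comp[OF G K] * by blast
      have "\<forall>v\<in>Poly_Mapping.keys a. v \<prec> W" "\<forall>v\<in>Poly_Mapping.keys b. v \<prec> W"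
        using less_mon_key less.prems by blast+
      then have "zigzag W (h \<star> inv1 k b d) a b"
        by (intro zigzag.comp[OF zigzag_pos[OF h] zigzag_inv[OF zigzag_pos[OF k]]])
      moreover have "sim (f \<star> h \<star> inv1 k b d) (g \<star> k \<star> inv1 k b d) (mon W) b"
        by (intro sim_comp[OF s] sim_refl arr_inv1 K)
      moreover have "g \<star> k \<star> inv1 k b d = g"
        using comp_assoc[OF G K arr_inv1[OF K]] comp_inv1(1)[OF K] comp_units(2)[OF G] by simp
      moreover have "f \<star> h \<star> inv1 k b d = f \<star> (h \<star> inv1 k b d)"
        using comp_assoc[OF F H arr_inv1[OF K]] .
      ultimately show ?thesis using F unfolding resolved_def by metis
    next
      case False
      then obtain q f' g' where q: "q \<in> ctx" "q \<noteq> [Var None]"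
        and mem': "f' \<in> monomials1 \<Omega> X" "g' \<in> monomials1 \<Omega> X"
        and fg: "f = plug1 q f'" "g = plug1 q g'"
        using over unfolding critical_branching_def by blast
      obtain u a' v b' where f': "mono_cell f' u a'" and g': "mono_cell g' v b'"
        using mem' monomials_mono by blast
      have "mon W = (mon (fill q u) :: ('z, 'o, 'k) poly)" "mon W = (mon (fill q v) :: ('z, 'o, 'k) poly)"
        using arr_unique[OF F, unfolded fg] arr_unique[OF G, unfolded fg]
          monoD(1)[OF mono_plug[OF q(1) f']] monoD(1)[OF mono_plug[OF q(1) g']] by metis+
      then have W: "W = fill q u" "W = fill q v" by (simp_all only: mon_inject)
      then have "v = u" using fill_inject[OF q(1), of u v] by simp
      then have "resolved f' g' u"
        using less.hyps[of u] weight_fill[OF q(1), of u] q(2) W(1) f' g' by blast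
      then show ?thesis
        unfolding fg W(1) by (intro resolved_plug q(1) monoD(2)[OF f'])
    qed
  qed
qed


section \<open>Local branchings and confluence\<close>

text \<open>
  Zigzags from the two targets to a common polynomial suffice, provided that confluence
  is known there: it relates the two positive cells that leave this polynomial.
\<close>

lemma joined_via:
  assumes F: "arr F p x" and G: "arr G p y"
    and e1: "joinable e1 x m" and e2: "joinable e2 y m" and m: "conf m"
    and FG: "sim (F \<star> e1) (G \<star> e2) p m"
  shows "joined F G p x y"
proof -
  obtain h1 k1 d1 where 1: "pos h1 x d1" "pos k1 m d1" "sim (e1 \<star> k1) h1 x d1" "arr e1 x m"
    using e1 by (auto simp: joinable_def)
  obtain h2 k2 d2 where 2: "pos h2 y d2" "pos k2 m d2" "sim (e2 \<star> k2) h2 y d2" "arr e2 y m"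
    using e2 by (auto simp: joinable_def)
  obtain l1 l2 c where l: "pos l1 d1 c" "pos l2 d2 c" "sim (k1 \<star> l1) (k2 \<star> l2) m c"
    using m 1(2) 2(2) unfolding conf_def joined_def by blast
  have rearrange: "sim (F \<star> (h \<star> l)) (F \<star> e \<star> (k \<star> l)) p c"
    if "arr F p x" "pos k m d" "pos l d c" "arr e x m" "sim (e \<star> k) h x d" for F x e k h l d
  proof -
    note a = pos_arr[OF that(2)] pos_arr[OF that(3)]
    have "sim (F \<star> (h \<star> l)) (F \<star> (e \<star> k \<star> l)) p c"
      by (intro sim_comp[OF sim_refl[OF that(1)] sim_comp[OF sim_sym[OF that(5)] sim_refl[OF a(2)]]])
    moreover have "F \<star> (e \<star> k \<star> l) = F \<star> e \<star> (k \<star> l)"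
      using comp_assoc[OF that(4) a] comp_assoc[OF that(1,4) arr_comp[OF a]] by simp
    ultimately show ?thesis by simp
  qed
  have "sim (F \<star> (h1 \<star> l1)) (G \<star> (h2 \<star> l2)) p c"
    by (rule sim_trans[OF sim_trans[OF rearrange[OF F 1(2) l(1) 1(4,3)] sim_comp[OF FG l(3)]]
          sim_sym[OF rearrange[OF G 2(2) l(2) 2(4,3)]]])
  then show ?thesis
    unfolding joined_def using pos_comp[OF 1(1) l(1)] pos_comp[OF 2(1) l(2)] by blast
qed

text \<open>
  Two steps which rewrite the same monomial with coefficient \<open>r\<close> have the form \<open>r f + c\<close>,
  \<open>r g + c\<close>, and the zigzag from \<open>f\<close> to \<open>g\<close> is scaled and translated. Two steps which
  rewrite different monomials \<open>u \<noteq> v\<close> are closed at the polynomial in which both \<open>u\<close> and \<open>v\<close> are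
  replaced; the closing cells need not be positive, as \<open>v\<close> may occur in the target of \<open>f\<close> and
  \<open>u\<close> in that of \<open>g\<close>.
\<close>

lemma local_confluence:
  assumes crit: "critically_confluent \<Omega> X Y"
    and F: "step F p x" and G: "step G p y"
    and conf: "\<And>q. \<lbrakk>q \<in> polys; (q, p) \<in> smaller\<rbrakk> \<Longrightarrow> conf q"
  shows "joined F G p x y"
proof -
  obtain r f u a c where f: "r \<noteq> 0" "mono_cell f u a" "c \<in> polys" "u \<notin> Poly_Mapping.keys c"
      "F = affine r f c" "p = Poly_Mapping.single u r + c" "x = smult r a + c"
    using F unfolding step_def by blast
  obtain s g v b c' where g: "s \<noteq> 0" "mono_cell g v b" "c' \<in> polys" "v \<notin> Poly_Mapping.keys c'"
      "G = affine s g c'" "p = Poly_Mapping.single v s + c'" "y = smult s b + c'"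
    using G unfolding step_def by blast
  note F1 = monoD(1)[OF f(2)] and G1 = monoD(1)[OF g(2)]
  have pu: "Poly_Mapping.lookup p u = r"
    unfolding f(6) using f(4) by (simp add: lookup_add in_keys_iff)
  have pv: "Poly_Mapping.lookup p v = s"
    unfolding g(6) using g(4) by (simp add: lookup_add in_keys_iff)
  have kp: "Poly_Mapping.keys p = insert u (Poly_Mapping.keys c)"
    using f(1,4,6) by (auto simp: in_keys_iff lookup_add lookup_single when_def split: if_splits)
  show ?thesis
  proof (cases "u = v")
    case True
    then have eq: "s = r" "c' = c" using pu pv f(6) g(6) by simp_all
    obtain e where e: "zigzag u e a b" "sim (f \<star> e) g (mon u) b"
      using monomials_resolved[OF crit f(2), of g b] g(2) True arr_unique[OF F1] arr_unique[OF G1]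
        sim_arr(2) unfolding resolved_def by metis
    note E = zigzag_arr[OF e(1)]
    have "joinable (affine r e c) (smult r a + c) (smult r b + c)"
    proof (rule zigzag_joinable[OF e(1) f(3)])
      fix q assume "q \<in> polys" "\<forall>v\<in>Poly_Mapping.keys q. v \<in> Poly_Mapping.keys c \<or> v \<prec> u"
      then show "conf q" using kp f(4) by (intro conf smallerI[of "{u}"]) auto
    qed
    moreover have "joinable (\<iota> y) y y" using arrD(3)[OF step_arr[OF G]] by (rule joinable_id)
    moreover have "conf y" using step_smaller[OF G] conf arrD(3)[OF step_arr[OF G]] by blast
    moreover have "sim (F \<star> affine r e c) (G \<star> \<iota> y) p y"
      using sim_affine[OF e(2) f(3), of r] comp_affine[OF F1 E f(3), of r]
        comp_units(2)[OF step_arr[OF G]] f(5-7) g(5-7) eq by (simp add: smult_algebra)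
    ultimately show ?thesis
      using joined_via[OF step_arr[OF F] step_arr[OF G]] f(7) g(7) eq by metis
  next
    case False
    let ?c = "c - Poly_Mapping.single v s"
    have cv: "Poly_Mapping.lookup c v = s"
      using pv[unfolded f(6)] False by (simp add: lookup_add lookup_single_not_eq)
    have c0: "?c \<in> polys" "u \<notin> Poly_Mapping.keys ?c" "v \<notin> Poly_Mapping.keys ?c"
      using f(3,4) keys_diff_single[of c v] unfolding cv polys_def by auto
    have c: "c = Poly_Mapping.single v s + ?c"
      using poly_split[of c v] cv by simp
    have c': "c' = Poly_Mapping.single u r + ?c"
      using f(6) g(6) c by (metis add.left_commute add_left_cancel)
    have A: "a \<in> polys" "b \<in> polys" using arrD(3) F1 G1 by blast+
    let ?m = "smult r a + (smult s b + ?c)"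
    have P: "smult r a + ?c \<in> polys" "smult s b + ?c \<in> polys" "?m \<in> polys"
      by (intro polys_closed(3,4) A c0(1))+
    have "v \<in> Poly_Mapping.keys c" using cv g(1) by (simp add: in_keys_iff)
    moreover have "Poly_Mapping.keys ?m \<subseteq>
        Poly_Mapping.keys a \<union> (Poly_Mapping.keys b \<union> (Poly_Mapping.keys c - {v}))"
    proof -
      have "Poly_Mapping.keys ?c = Poly_Mapping.keys c - {v}"
        using keys_diff_single[of c v] cv by simp
      then show ?thesis
        using Poly_Mapping.keys_add[of "smult s b" ?c] keys_smult[of s b] keys_smult[of r a]
          Poly_Mapping.keys_add[of "smult r a" "smult s b + ?c"] by blast
    qed
    ultimately have "(?m, p) \<in> smaller"
      using kp f(4) less_mon_key[OF f(2)] less_mon_key[OF g(2)]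
      by (intro smallerI[of "{u, v}"]) auto
    then have m: "conf ?m" by (rule conf[OF P(3)])
    have e1: "joinable (affine s g (smult r a + ?c)) x ?m"
    proof -
      have "x = Poly_Mapping.single v s + (smult r a + ?c)"
        unfolding f(7) by (subst c) (rule add.left_commute)
      then show ?thesis
        using joinable_affine[OF g(2) P(1), of s] add.left_commute[of "smult s b" "smult r a" ?c]
        by (simp only:)
    qed
    have e2: "joinable (affine r f (smult s b + ?c)) y ?m"
    proof -
      have "y = Poly_Mapping.single u r + (smult s b + ?c)"
        unfolding g(7) c' by (rule add.left_commute)
      then show ?thesis using joinable_affine[OF f(2) P(2), of r] by (simp only:)
    qed
    have "F \<star> affine s g (smult r a + ?c) = G \<star> affine r f (smult s b + ?c)"
      using affine_comp_swap[OF F1 G1 c0(1), of r s] f(5) g(5) c c' by (simp add: smult_algebra)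
    moreover have "arr (affine s g (smult r a + ?c)) x ?m" using e1 unfolding joinable_def by blast
    ultimately have "sim (F \<star> affine s g (smult r a + ?c)) (G \<star> affine r f (smult s b + ?c)) p ?m"
      using sim_refl[OF arr_comp[OF step_arr[OF F]]] by metis
    then show ?thesis by (rule joined_via[OF step_arr[OF F] step_arr[OF G] e1 e2 m])
  qed
qed

text \<open>Newman's lemma: the 2-cells of three branchings, at \<open>p\<close>, \<open>p1\<close> and \<open>p2\<close>, are pasted.\<close>

lemma confluence:
  assumes termi: "terminating \<Omega> X" and crit: "critically_confluent \<Omega> X Y"
  shows "p \<in> polys \<Longrightarrow> conf p"
proof (induction p rule: wf_induct_rule[OF wf_smaller[OF termi]])
  case (1 p)
  show ?case
    unfolding conf_def
  proof (intro allI impI, elim conjE)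
    fix f g x y assume f: "pos f p x" and g: "pos g p y"
    note fa = pos_arr[OF f] and ga = pos_arr[OF g]
    consider "f = \<iota> p" "x = p" | "g = \<iota> p" "y = p"
      | s f' p1 t g' p2 where "step s p p1" "pos f' p1 x" "f = s \<star> f'"
          "step t p p2" "pos g' p2 y" "g = t \<star> g'"
      using pos_cases[OF f] pos_cases[OF g] by metis
    then show "joined f g p x y"
    proof cases
      case 1
      then show ?thesis
        unfolding joined_def using g pos_id[OF arrD(3)[OF ga]] sim_refl[OF ga] comp_units[OF ga] by metis
    next
      case 2
      then show ?thesis
        unfolding joined_def using f pos_id[OF arrD(3)[OF fa]] sim_refl[OF fa] comp_units[OF fa] by metis
    next
      case 3
      note S = step_arr[OF 3(1)] and T = step_arr[OF 3(4)]
        and fa' = pos_arr[OF 3(2)] and ga' = pos_arr[OF 3(5)]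
      have "joined s t p p1 p2"
        using local_confluence[OF crit 3(1,4)] 1 by blast
      then obtain h k d where hk: "pos h p1 d" "pos k p2 d" "sim (s \<star> h) (t \<star> k) p d"
        by (auto simp: joined_def)
      note ha = pos_arr[OF hk(1)] and ka = pos_arr[OF hk(2)]
      have "conf p1" using "1.IH" step_smaller[OF 3(1)] arrD(3)[OF S] by blast
      then obtain m n c where mn: "pos m x c" "pos n d c" "sim (f' \<star> m) (h \<star> n) p1 c"
        using 3(2) hk(1) unfolding conf_def joined_def by blast
      note ma = pos_arr[OF mn(1)] and na = pos_arr[OF mn(2)]
      have "conf p2" using "1.IH" step_smaller[OF 3(4)] arrD(3)[OF T] by blast
      then obtain m' n' c' where mn': "pos m' c c'" "pos n' y c'" "sim (k \<star> n \<star> m') (g' \<star> n') p2 c'"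
        using 3(5) pos_comp[OF hk(2) mn(2)] unfolding conf_def joined_def by blast
      note ma' = pos_arr[OF mn'(1)] and na' = pos_arr[OF mn'(2)]
      have "f \<star> (m \<star> m') = s \<star> (f' \<star> m \<star> m')"
        using comp_assoc[OF S fa' arr_comp[OF ma ma']] comp_assoc[OF fa' ma ma'] 3(3) by simp
      moreover have "sim (s \<star> (f' \<star> m \<star> m')) (s \<star> (h \<star> n \<star> m')) p c'"
        by (intro sim_comp[OF sim_refl[OF S]] sim_comp[OF mn(3)] sim_refl ma')
      moreover have "s \<star> (h \<star> n \<star> m') = s \<star> h \<star> (n \<star> m')"
        using comp_assoc[OF ha na ma'] comp_assoc[OF S ha arr_comp[OF na ma']] by simp
      moreover have "sim (s \<star> h \<star> (n \<star> m')) (t \<star> k \<star> (n \<star> m')) p c'"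
        by (intro sim_comp[OF hk(3)] sim_refl arr_comp[OF na ma'])
      moreover have "t \<star> k \<star> (n \<star> m') = t \<star> (k \<star> n \<star> m')"
        using comp_assoc[OF ka na ma'] comp_assoc[OF T ka arr_comp[OF na ma']] by simp
      moreover have "sim (t \<star> (k \<star> n \<star> m')) (t \<star> (g' \<star> n')) p c'"
        by (intro sim_comp[OF sim_refl[OF T]] mn'(3))
      moreover have "t \<star> (g' \<star> n') = g \<star> n'"
        using comp_assoc[OF T ga' na'] 3(6) by simp
      ultimately have "sim (f \<star> (m \<star> m')) (g \<star> n') p c'"
        using sim_trans by metis
      then show ?thesis
        unfolding joined_def using pos_comp[OF mn(1) mn'(1)] mn'(2) by blast
    qed
  qed
qed

end

theorem theorem3p2p7:
  fixes \<Omega> :: "'o set"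
    and X :: "('z, 'o, 'x, 'k::field_char_0) polygraph"
    and Y :: "('y, ('z, 'o, 'x, 'k) cell1) cell_ext"
  assumes "omega_1_polygraph \<Omega> X"
    and "terminating \<Omega> X"
    and "cellular_extension 1 (alg1 \<Omega> X) Y"
    and "critically_confluent \<Omega> X Y"
  shows "confluent \<Omega> X Y"
  unfolding confluent_def
proof (intro allI impI)
  interpret rewriting_system \<Omega> X Y
    by unfold_locales (fact assms(1))
  fix f g assume fg: "branching \<Omega> X f g"
  have "\<exists>p x. pos f p x \<and> True"
    using fg unfolding branching_def by (intro positive_induct) simp_all
  then obtain p x where f: "pos f p x" by blast
  obtain y where g: "pos g p y"
    using positive_pos[of g p] fg arrD(2,4)[OF pos_arr[OF f]] unfolding branching_def by metis
  obtain h k d where h: "pos h x d" and k: "pos k y d" and hk: "sim (f \<star> h) (g \<star> k) p d"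
    using confluence[OF assms(2,4) arrD(2)[OF pos_arr[OF f]]] f g
    unfolding conf_def joined_def by blast
  obtain F where F: "F \<in> carr A2" "bd A2 Src 1 F = two (f \<star> h)" "bd A2 Tgt 1 F = two (g \<star> k)"
    using hk by (auto simp: sim_def)
  note ends = pos_arr[OF f, THEN arrD(5)] pos_arr[OF g, THEN arrD(5)]
    pos_arr[OF h, THEN arrD(4)] pos_arr[OF h, THEN arrD(5)]
    pos_arr[OF k, THEN arrD(4)] pos_arr[OF k, THEN arrD(5)]
  show "confluent_branching \<Omega> X Y f g"
    unfolding confluent_branching_def
    by (intro exI[of _ h] exI[of _ k] exI[of _ F] conjI F)
      (use h k in \<open>simp_all only: pos_def ends\<close>)
qed

end
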